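(* Let $k$ be a field of characteristic zero and $R=k[x_1,x_2,x_3,x_4]$. Let $a\ge 3$, let $X$ be an $a\times a$ grid on a smooth quadric surface in $\mathbb P^3$, and let $d\ge a-1$. Let $q,r$ be the non-negative integers such that $d=(a-1)q+r$ with $0\le r<a-1$. Set $I=\Lambda_{X,d}$ and $A=R/I$. Then: (a) $\Delta h_A(d+q-1)<(q+1)\cdot\binom{r+1}{2}$. (b) For a general linear form $\ell$, the multiplication map $\times\ell:[A]_{d+q-2}\to[A]_{d+q-1}$ has $$\dim_k\operatorname{coker}(\times\ell)=(q+1)\cdot\binom{r+1}{2}\ge 0.$$ Therefore, if $r>0$ then $\times\ell$ (in (b)) fails to be injective and $A$ fails to have the Weak Lefschetz Property.
   Context: $R$ has the standard grading; $[M]_t$ denotes the degree $t$ component of a graded module $M$. An $a\times a$ grid on a smooth quadric surface $\mathcal Q\subset\mathbb P^3$ is the set of $a^2$ intersection points of $a$ distinct lines in one ruling of $\mathcal Q$ with $a$ distinct lines in the other ruling. The linear form dual to a point $[\alpha_1:\dots:\alpha_4]$ is $\sum\alpha_i x_i$ (up to scalar). $\Lambda_{X,d}$ is the ideal of $R$ generated by the $d$-th powers of the linear forms dual to the points of $X$. $h_A(t)=\dim_k[A]_t$ and $\Delta h_A(t)=h_A(t)-h_A(t-1)$. An artinian graded $k$-algebra $A$ has the Weak Lefschetz Property if for a general linear form $\ell$ the map $\times\ell:[A]_{t-1}\to[A]_t$ is injective or surjective for all $t$. *)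

theory Defs
  imports
    "HOL-Analysis.Cartesian_Space"
    "HOL-Library.Numeral_Type"
    "HOL-Library.Poly_Mapping"
    "HOL-Algebra.QuotRing"
    "Jordan_Normal_Form.VS_Connect"
begin

section \<open>The polynomial ring in four variables\<close>

text \<open>The variables are indexed by the four-element type \<open>4\<close>; a monomial is its exponent vector.
  The standard grading is given by total degree.\<close>

type_synonym 'k mpoly4 = "(4 \<Rightarrow>\<^sub>0 nat) \<Rightarrow>\<^sub>0 'k"

abbreviation poly_ring :: "'k::field mpoly4 ring" where
  "poly_ring \<equiv> class_ring"

definition homog :: "nat \<Rightarrow> 'k::field mpoly4 set" where
  "homog t = {f. \<forall>m \<in> Poly_Mapping.keys f. (\<Sum>i\<in>UNIV. Poly_Mapping.lookup m i) = t}"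

definition const_poly :: "'k::field \<Rightarrow> 'k mpoly4" where
  "const_poly c = Poly_Mapping.single 0 c"

definition var_poly :: "4 \<Rightarrow> 'k::field mpoly4" where
  "var_poly i = Poly_Mapping.single (Poly_Mapping.single i 1) 1"

definition lin_form :: "'k::field ^ 4 \<Rightarrow> 'k mpoly4" where
  "lin_form \<alpha> = (\<Sum>i\<in>UNIV. const_poly (vec_nth \<alpha> i) * var_poly i)"

definition eval_poly :: "'k::field ^ 4 \<Rightarrow> 'k mpoly4 \<Rightarrow> 'k" where
  "eval_poly p f =
    (\<Sum>m \<in> Poly_Mapping.keys f.
      Poly_Mapping.lookup f m * (\<Prod>i\<in>UNIV. vec_nth p i ^ Poly_Mapping.lookup m i))"

definition partial_deriv :: "4 \<Rightarrow> 'k::field mpoly4 \<Rightarrow> 'k mpoly4" where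
  "partial_deriv i f =
    (\<Sum>m \<in> Poly_Mapping.keys f.
      Poly_Mapping.single (m - Poly_Mapping.single i 1)
        (of_nat (Poly_Mapping.lookup m i) * Poly_Mapping.lookup f m))"


section \<open>Quadric surfaces in projective 3-space and grids on them\<close>

text \<open>Points and lines of projective 3-space are the linear subspaces of \<open>k\<^sup>4\<close> of dimension 1 and 2;
  the zero locus of a form is represented by its affine cone.\<close>

definition zero_cone :: "'k::field mpoly4 \<Rightarrow> ('k ^ 4) set" where
  "zero_cone F = {p. eval_poly p F = 0}"

text \<open>Jacobian criterion. The partial derivatives of a quadratic form are linear forms, so they have
  a nontrivial common zero over the algebraic closure iff they have one over \<open>k\<close>; testing the
  \<open>k\<close>-rational points therefore gives smoothness in the geometric sense.\<close>

definition smooth_quadric :: "'k::field mpoly4 \<Rightarrow> bool" where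
  "smooth_quadric F \<longleftrightarrow> F \<in> homog 2 \<and>
     (\<forall>p. p \<noteq> 0 \<and> p \<in> zero_cone F \<longrightarrow> (\<exists>i. eval_poly p (partial_deriv i F) \<noteq> 0))"

definition lines_on :: "'k::field mpoly4 \<Rightarrow> ('k ^ 4) set set" where
  "lines_on F = {L. vec.subspace L \<and> vec.dim L = 2 \<and> L \<subseteq> zero_cone F}"

text \<open>The lines on the quadric fall into two families: lines of the same family are disjoint
  in projective space, lines of different families meet in exactly one point.\<close>

definition rulings :: "'k::field mpoly4 \<Rightarrow> ('k ^ 4) set set \<Rightarrow> ('k ^ 4) set set \<Rightarrow> bool" where
  "rulings F \<A> \<B> \<longleftrightarrow>
     \<A> \<union> \<B> = lines_on F \<and> \<A> \<inter> \<B> = {} \<and>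
     (\<forall>L\<in>\<A>. \<forall>L'\<in>\<A>. L \<noteq> L' \<longrightarrow> L \<inter> L' = {0}) \<and>
     (\<forall>M\<in>\<B>. \<forall>M'\<in>\<B>. M \<noteq> M' \<longrightarrow> M \<inter> M' = {0}) \<and>
     (\<forall>L\<in>\<A>. \<forall>M\<in>\<B>. vec.dim (L \<inter> M) = 1)"

definition is_grid :: "'k::field mpoly4 \<Rightarrow> nat \<Rightarrow> ('k ^ 4) set set \<Rightarrow> bool" where
  "is_grid F a X \<longleftrightarrow>
     (\<exists>\<A> \<B> S T. rulings F \<A> \<B> \<and>
        S \<subseteq> \<A> \<and> finite S \<and> card S = a \<and>
        T \<subseteq> \<B> \<and> finite T \<and> card T = a \<and>
        X = {L \<inter> M |L M. L \<in> S \<and> M \<in> T})"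

text \<open>All scalar multiples of the dual linear form of each point are used; this does not change the
  ideal.\<close>

definition power_ideal :: "('k::field ^ 4) set set \<Rightarrow> nat \<Rightarrow> 'k mpoly4 set" where
  "power_ideal X d =
     genideal poly_ring {lin_form \<alpha> ^ d |\<alpha>. \<alpha> \<noteq> 0 \<and> (\<exists>P\<in>X. \<alpha> \<in> P)}"


section \<open>Graded quotients of the polynomial ring\<close>

definition quot_alg :: "'k::field mpoly4 set \<Rightarrow> ('k, 'k mpoly4 set) module" where
  "quot_alg I =
     \<lparr>carrier = carrier (poly_ring Quot I), mult = mult (poly_ring Quot I),
      one = one (poly_ring Quot I), zero = zero (poly_ring Quot I), add = add (poly_ring Quot I),
      smult = (\<lambda>c C. (I +>\<^bsub>poly_ring\<^esub> const_poly c) \<otimes>\<^bsub>poly_ring Quot I\<^esub> C)\<rparr>"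

definition component :: "'k::field mpoly4 set \<Rightarrow> nat \<Rightarrow> ('k, 'k mpoly4 set) module" where
  "component I t = (quot_alg I)\<lparr>carrier := (\<lambda>f. I +>\<^bsub>poly_ring\<^esub> f) ` homog t\<rparr>"

definition hilb :: "'k::field mpoly4 set \<Rightarrow> nat \<Rightarrow> nat" where
  "hilb I t = vectorspace.dim class_ring (component I t)"

definition delta_hilb :: "'k::field mpoly4 set \<Rightarrow> nat \<Rightarrow> int" where
  "delta_hilb I t = int (hilb I t) - (if t = 0 then 0 else int (hilb I (t - 1)))"

definition mult_map :: "'k::field mpoly4 set \<Rightarrow> 'k mpoly4 \<Rightarrow> 'k mpoly4 set \<Rightarrow> 'k mpoly4 set" where
  "mult_map I l C = (I +>\<^bsub>poly_ring\<^esub> l) \<otimes>\<^bsub>quot_alg I\<^esub> C"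

definition mult_inj :: "'k::field mpoly4 set \<Rightarrow> 'k mpoly4 \<Rightarrow> nat \<Rightarrow> bool" where
  "mult_inj I l s \<longleftrightarrow> inj_on (mult_map I l) (carrier (component I s))"

definition mult_surj :: "'k::field mpoly4 set \<Rightarrow> 'k mpoly4 \<Rightarrow> nat \<Rightarrow> nat \<Rightarrow> bool" where
  "mult_surj I l s t \<longleftrightarrow>
     mult_map I l ` carrier (component I s) = carrier (component I t)"

text \<open>The quotient of a module by a submodule; the ring multiplication slots of the record carry
  no meaning.\<close>

definition quot_module :: "('k, 'v, 'm) module_scheme \<Rightarrow> 'v set \<Rightarrow> ('k, 'v set) module" where
  "quot_module V W =
     \<lparr>carrier = a_rcosets\<^bsub>V\<^esub> W, mult = (\<lambda>_ _. W), one = W, zero = W, add = set_add V,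
      smult = (\<lambda>c C. \<Union>x\<in>C. W +>\<^bsub>V\<^esub> (c \<odot>\<^bsub>V\<^esub> x))\<rparr>"

definition mult_coker ::
    "'k::field mpoly4 set \<Rightarrow> 'k mpoly4 \<Rightarrow> nat \<Rightarrow> nat \<Rightarrow> ('k, 'k mpoly4 set set) module" where
  "mult_coker I l s t = quot_module (component I t) (mult_map I l ` carrier (component I s))"


section \<open>General linear forms and the Weak Lefschetz Property\<close>

definition zariski_open :: "('k::field ^ 4) set \<Rightarrow> bool" where
  "zariski_open U \<longleftrightarrow> (\<exists>G. U = {\<alpha>. \<exists>g\<in>G. eval_poly \<alpha> g \<noteq> 0})"

definition for_general_lin_form :: "('k::field mpoly4 \<Rightarrow> bool) \<Rightarrow> bool" where
  "for_general_lin_form P \<longleftrightarrow>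
     (\<exists>U. zariski_open U \<and> U \<noteq> {} \<and> (\<forall>\<alpha>\<in>U. P (lin_form \<alpha>)))"

text \<open>Degrees \<open>t \<le> 0\<close> are omitted: there the source of the multiplication map is zero.\<close>

definition weak_lefschetz :: "'k::field mpoly4 set \<Rightarrow> bool" where
  "weak_lefschetz I \<longleftrightarrow>
     for_general_lin_form (\<lambda>l. \<forall>t\<ge>1. mult_inj I l (t - 1) \<or> mult_surj I l (t - 1) t)"

end

theory Submission
  imports Defs "HOL-Computational_Algebra.Polynomial"
begin

text \<open>
  Put \<open>t = d + q - 1 = a q + r - 1\<close>. A general linear form \<open>\<ell>\<close> is a point off the quadric; in suitable
  coordinates the quadric consists of the tensors \<open>(1, s) \<otimes> (1, u)\<close>, the point \<open>\<ell>\<close> is the antisymmetric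
  tensor, and the grid is \<open>{(\<sigma>\<^sub>i, \<upsilon>\<^sub>j)}\<close> with \<open>2 a\<close> distinct scalars. Let \<open>L(s, u)\<close> be the linear form dual
  to the point \<open>(s, u)\<close>, and let \<open>f\<close>, \<open>g\<close> be the polynomials with roots \<open>\<sigma>\<^sub>i\<close> and \<open>\<upsilon>\<^sub>j\<close>.

  A functional \<open>\<theta>\<close> on the cokernel in degree \<open>t\<close> is determined by \<open>T(s, u) = \<theta>(L(s, u)\<^sup>t)\<close>. The functions \<open>T\<close>
  that arise are the symmetric polynomials of degree at most \<open>t\<close> in each variable that vanish to order
  \<open>q\<close> at the grid, that is, plane curves of degree \<open>t\<close> with \<open>q\<close>-fold points at the projection of the
  grid from \<open>\<ell>\<close>. The projected grid is the complete intersection of \<open>F = f(s) f(u)\<close> and \<open>G = g(s) g(u)\<close>.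
  Restricting to the lines of \<open>F\<close>, on which \<open>T\<close> is divisible by \<open>g\<^sup>q\<close>, gives by induction on \<open>q\<close> a
  decomposition of the space of all \<open>T\<close> into \<open>q + 1\<close> summands \<open>F\<^sup>i G\<^sup>q\<^sup>-\<^sup>i H\<close> with \<open>H\<close> of degree \<open>r - 1\<close>.

  On a line of the first ruling, each \<open>w\<close> orthogonal to the polynomials of degree less than \<open>r\<close> yields
  a relation \<open>\<Sum>\<^sub>j w\<^sub>j g(\<sigma>\<^sub>j)\<^sup>-\<^sup>q L(\<sigma>\<^sub>i, \<sigma>\<^sub>j)\<^sup>t \<in> I\<close>. A combination of such relations over \<open>i\<close>, made antisymmetric
  in \<open>i\<close> and \<open>j\<close>, is \<open>\<ell>\<close> times a form \<open>Y\<close>, and a suitable product of planes through the lines of the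
  grid gives a functional that kills \<open>I\<close> but not \<open>Y\<close>. Hence multiplication by \<open>\<ell>\<close> has a nonzero kernel,
  and the first difference of the Hilbert function is smaller than the dimension of the cokernel.
\<close>

section \<open>The polynomial ring\<close>

text \<open>Projection from the point of the linear form identifies (s, u) with (u, s): it is the
  map from pairs to unordered pairs of points of the projective line, branched along the conic s =
  u. Lines of both rulings become tangents of this conic, and s = c and u = c share the image (s -
  c)(u - c) = 0; this is why F = f(s) f(u) appears and why plane forms are symmetric polynomials.
  The factor \<open>(r + 1) choose 2\<close> is the dimension of plane forms of degree r - 1.
  Membership in the ideal is always proved dually: every functional killing the ideal kills the
  element. In characteristic zero, powers of L(s, u) suffice to test a functional. Conversely, each
  basis polynomial is a product of lines of the plane, hence of planes through the centre, and
  differentiating along these planes realises it as a functional; this makes the dimension count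
  exact. The strict inequality does not follow from the cokernel, since the first difference is dim
  coker - dim ker. An explicit kernel element is required for all q >= 1 and all r, also for r = 0,
  where the cokernel vanishes.\<close>

abbreviation mscale :: "'k::field \<Rightarrow> 'k mpoly4 \<Rightarrow> 'k mpoly4" where
  "mscale c f \<equiv> const_poly c * f"

lemma const_poly_mult [simp]: "const_poly (c * d) = const_poly c * const_poly d"
  by (simp add: const_poly_def mult_single)

lemma const_poly_0 [simp]: "const_poly 0 = 0"
  by (simp add: const_poly_def)

lemma const_poly_1 [simp]: "const_poly 1 = 1"
  by (simp add: const_poly_def)

lemma const_poly_add [simp]: "const_poly (c + d) = const_poly c + const_poly d"
  by (simp add: const_poly_def single_add)

lemma const_poly_diff [simp]: "const_poly (c - d) = const_poly c - const_poly d"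
  by (simp add: const_poly_def single_diff)

lemma const_poly_uminus [simp]: "const_poly (- c) = - const_poly c"
  by (simp add: const_poly_def single_uminus)

lemma const_poly_power [simp]: "const_poly (c ^ n) = const_poly c ^ n"
  by (induction n) simp_all

lemma const_poly_of_nat [simp]: "const_poly (of_nat n) = of_nat n"
  by (simp add: const_poly_def)

lemma const_poly_numeral [simp]: "const_poly (numeral n) = numeral n"
  using const_poly_of_nat[of "numeral n"] by simp

interpretation mp: vector_space "mscale :: 'k::field \<Rightarrow> 'k mpoly4 \<Rightarrow> 'k mpoly4"
  by unfold_locales (simp_all add: algebra_simps)

text \<open>As a simp rule it loops together with \<open>const_poly_mult\<close> and \<open>mult.assoc\<close>.\<close>
declare mp.scale_scale [simp del]

interpretation fv: vector_space "(*) :: 'k::field \<Rightarrow> 'k \<Rightarrow> 'k"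
  by unfold_locales (simp_all add: algebra_simps)

text \<open>Pairs polynomials with the field, so that \<open>lfun_separate\<close> can extend a
  functional from an independent set.\<close>

interpretation mpf: vector_space_pair "mscale :: 'k::field \<Rightarrow> 'k mpoly4 \<Rightarrow> 'k mpoly4"
    "(*) :: 'k::field \<Rightarrow> 'k \<Rightarrow> 'k" ..

lemma keys_sum_superset:
  assumes "finite S" "Poly_Mapping.keys f \<subseteq> S" "\<And>m. h m 0 = 0"
  shows "(\<Sum>m\<in>Poly_Mapping.keys f. h m (Poly_Mapping.lookup f m))
       = (\<Sum>m\<in>S. h m (Poly_Mapping.lookup f m))"
  by (rule sum.mono_neutral_left) (use assms in \<open>auto simp: in_keys_iff\<close>)

text \<open>Supports may shrink under addition; since \<open>h m 0 = 0\<close>, all sums can be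
  taken over the union of the supports. Additivity of evaluation and of partial derivatives comes
  from here.\<close>

lemma keys_sum_add:
  fixes f g :: "'a \<Rightarrow>\<^sub>0 'b::comm_monoid_add" and h :: "'a \<Rightarrow> 'b \<Rightarrow> 'c::comm_monoid_add"
  assumes "\<And>m. h m 0 = 0" "\<And>m x y. h m (x + y) = h m x + h m y"
  shows "(\<Sum>m\<in>Poly_Mapping.keys (f + g). h m (Poly_Mapping.lookup (f + g) m))
       = (\<Sum>m\<in>Poly_Mapping.keys f. h m (Poly_Mapping.lookup f m))
       + (\<Sum>m\<in>Poly_Mapping.keys g. h m (Poly_Mapping.lookup g m))"
proof -
  let ?S = "Poly_Mapping.keys f \<union> Poly_Mapping.keys g"
  have "Poly_Mapping.keys (f + g) \<subseteq> ?S" by (rule Poly_Mapping.keys_add)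
  then show ?thesis
    using assms keys_sum_superset[of ?S "f + g" h] keys_sum_superset[of ?S f h]
      keys_sum_superset[of ?S g h] by (simp add: lookup_add sum.distrib)
qed

lemma mpoly4_as_sum:
  "f = (\<Sum>m\<in>Poly_Mapping.keys f. Poly_Mapping.single m (Poly_Mapping.lookup f m))"
proof (rule poly_mapping_eqI)
  fix k
  show "Poly_Mapping.lookup f k = Poly_Mapping.lookup (\<Sum>m\<in>Poly_Mapping.keys f.
      Poly_Mapping.single m (Poly_Mapping.lookup f m)) k"
    by (cases "k \<in> Poly_Mapping.keys f")
      (simp_all add: lookup_sum lookup_single when_def in_keys_iff)
qed

lemma mpoly4_induct [case_names single add]:
  assumes "\<And>m c. P (Poly_Mapping.single m c)" "\<And>f g. P f \<Longrightarrow> P g \<Longrightarrow> P (f + g)"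
  shows "P (f :: 'k::field mpoly4)"
proof -
  have "P (\<Sum>m\<in>S. Poly_Mapping.single m (Poly_Mapping.lookup f m))" if "finite S" for S
    using that
  proof induction
    case empty
    show ?case using assms(1)[of 0 0] by simp
  qed (simp add: assms)
  from this[of "Poly_Mapping.keys f"] show ?thesis using mpoly4_as_sum[of f] by simp
qed

section \<open>Evaluation at a point\<close>

lemma eval_poly_add [simp]: "eval_poly p (f + g) = eval_poly p f + eval_poly p g"
  unfolding eval_poly_def
  by (rule keys_sum_add[where h = "\<lambda>m x. x * (\<Prod>i\<in>UNIV. vec_nth p i ^ Poly_Mapping.lookup m i)"])
    (simp_all add: algebra_simps)

lemma eval_poly_single:
  "eval_poly p (Poly_Mapping.single m c) = c * (\<Prod>i\<in>UNIV. vec_nth p i ^ Poly_Mapping.lookup m i)"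
  by (cases "c = 0") (simp_all add: eval_poly_def)

lemma eval_poly_mult [simp]: "eval_poly p (f * g) = eval_poly p f * eval_poly p g"
proof (induction f rule: mpoly4_induct)
  case (single m c)
  show ?case
    by (induction g rule: mpoly4_induct)
      (simp_all add: mult_single eval_poly_single lookup_add power_add prod.distrib algebra_simps)
qed (simp add: algebra_simps)

lemma eval_poly_0 [simp]: "eval_poly p 0 = 0"
  by (simp add: eval_poly_def)

lemma eval_poly_const [simp]: "eval_poly p (const_poly c) = c"
  by (simp add: const_poly_def eval_poly_single)

lemma eval_poly_1 [simp]: "eval_poly p 1 = 1"
  using eval_poly_const[of p 1] by simp

lemma eval_poly_sum [simp]: "eval_poly p (sum f S) = (\<Sum>x\<in>S. eval_poly p (f x))"
  by (induction S rule: infinite_finite_induct) simp_all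

lemma eval_poly_minus [simp]: "eval_poly p (f - g) = eval_poly p f - eval_poly p g"
  using eval_poly_add[of p "f - g" g] by simp

lemma eval_poly_var [simp]: "eval_poly p (var_poly i) = vec_nth p i"
proof -
  have "(\<Prod>j\<in>UNIV. vec_nth p j ^ Poly_Mapping.lookup (Poly_Mapping.single i 1) j)
      = (\<Prod>j\<in>UNIV. if j = i then vec_nth p j else 1)"
    by (rule prod.cong) (auto simp: lookup_single when_def)
  then show ?thesis by (simp add: var_poly_def eval_poly_single)
qed

section \<open>Forms of a fixed degree\<close>

lemma homog_0 [simp]: "0 \<in> homog t"
  by (simp add: homog_def)

lemma homog_add: "f \<in> homog t \<Longrightarrow> g \<in> homog t \<Longrightarrow> f + g \<in> homog t"
  unfolding homog_def using Poly_Mapping.keys_add[of f g] by blast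

lemma homog_single:
  "(\<Sum>i\<in>UNIV. Poly_Mapping.lookup m i) = t \<Longrightarrow> Poly_Mapping.single m c \<in> homog t"
  by (cases "c = 0") (simp_all add: homog_def)

lemma homog_mult: "f \<in> homog s \<Longrightarrow> g \<in> homog t \<Longrightarrow> f * g \<in> homog (s + t)"
  using Poly_Mapping.keys_mult[of f g]
  by (fastforce simp: homog_def lookup_add sum.distrib)

lemma homog_sum: "(\<And>x. x \<in> S \<Longrightarrow> f x \<in> homog t) \<Longrightarrow> sum f S \<in> homog t"
  by (induction S rule: infinite_finite_induct) (auto intro: homog_add)

lemma homog_const: "const_poly c \<in> homog 0"
  unfolding const_poly_def by (rule homog_single) simp

lemma homog_scale: "f \<in> homog t \<Longrightarrow> const_poly c * f \<in> homog t"
  using homog_mult[OF homog_const] by fastforce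

lemma homog_var: "var_poly i \<in> homog 1"
proof -
  have "(\<Sum>j\<in>UNIV. Poly_Mapping.lookup (Poly_Mapping.single i (1::nat)) j)
      = (\<Sum>j\<in>UNIV. if j = i then 1 else 0)"
    by (rule sum.cong) (auto simp: lookup_single when_def)
  then show ?thesis unfolding var_poly_def by (intro homog_single) simp
qed

lemma homog_lin_form: "lin_form \<alpha> \<in> homog 1"
  unfolding lin_form_def by (intro homog_sum homog_scale homog_var)

lemma homog_power: "f \<in> homog s \<Longrightarrow> f ^ n \<in> homog (n * s)"
  by (induction n) (use homog_const[of 1] homog_mult in \<open>auto simp: algebra_simps\<close>)

lemma homog_lin_form_power: "lin_form \<alpha> ^ n \<in> homog n"
  using homog_power[OF homog_lin_form, of \<alpha> n] by simp

lemma subspace_homog: "mp.subspace (homog t)"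
  by (intro mp.subspaceI) (simp_all add: homog_add homog_scale)

lemma homog_induct [consumes 1, case_names zero single add]:
  assumes "f \<in> homog t" "P 0"
    "\<And>m c. (\<Sum>i\<in>UNIV. Poly_Mapping.lookup m i) = t \<Longrightarrow> P (Poly_Mapping.single m c)"
    "\<And>f g. P f \<Longrightarrow> P g \<Longrightarrow> P (f + g)"
  shows "P (f :: 'k::field mpoly4)"
proof -
  have "P (\<Sum>m\<in>S. Poly_Mapping.single m (Poly_Mapping.lookup f m))"
    if "finite S" "S \<subseteq> Poly_Mapping.keys f" for S
    using that
  proof induction
    case (insert m S)
    then have "(\<Sum>i\<in>UNIV. Poly_Mapping.lookup m i) = t" using assms(1) by (simp add: homog_def)
    with insert show ?case by (simp add: assms)
  qed (simp add: assms)
  from this[of "Poly_Mapping.keys f"] show ?thesis using mpoly4_as_sum[of f] by simp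
qed

lemma single_eq_var_mult:
  assumes "Poly_Mapping.lookup m i > 0"
  shows "Poly_Mapping.single m c = var_poly i * Poly_Mapping.single (m - Poly_Mapping.single i 1) c"
proof -
  have "Poly_Mapping.single i 1 + (m - Poly_Mapping.single i 1) = m"
    by (rule poly_mapping_eqI) (use assms in \<open>auto simp: lookup_add lookup_minus lookup_single when_def\<close>)
  then show ?thesis by (simp add: var_poly_def mult_single)
qed

lemma degree_minus_single:
  assumes "Poly_Mapping.lookup m i > 0"
  shows "(\<Sum>j\<in>UNIV. Poly_Mapping.lookup (m - Poly_Mapping.single (i::4) 1) j)
       = (\<Sum>j\<in>UNIV. Poly_Mapping.lookup m j) - (1::nat)"
proof -
  have "(\<Sum>j\<in>UNIV. Poly_Mapping.lookup (m - Poly_Mapping.single i 1) j)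
      = (\<Sum>j\<in>UNIV-{i}. Poly_Mapping.lookup m j) + (Poly_Mapping.lookup m i - 1)"
    by (subst sum.remove[of _ i]) (auto simp: lookup_minus lookup_single when_def intro!: sum.cong)
  moreover have "(\<Sum>j\<in>UNIV. Poly_Mapping.lookup m j)
      = (\<Sum>j\<in>UNIV-{i}. Poly_Mapping.lookup m j) + Poly_Mapping.lookup m i"
    by (subst sum.remove[of _ i]) auto
  ultimately show ?thesis using assms by simp
qed

lemma homog_Suc_span:
  assumes "f \<in> homog (Suc t)"
  shows "f \<in> mp.span {var_poly i * g |i g. g \<in> homog t}"
  using assms
proof (induction rule: homog_induct)
  case (single m c)
  then have "\<exists>i. Poly_Mapping.lookup m i > 0"
    by (metis gr0I nat.distinct(1) sum.neutral)
  then obtain i where i: "Poly_Mapping.lookup m i > 0" by blast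
  show ?case unfolding single_eq_var_mult[OF i]
    using degree_minus_single[OF i] single by (intro mp.span_base) (auto intro!: homog_single)
qed (auto intro: mp.span_zero mp.span_add)

lemma homog_0_const:
  assumes "f \<in> homog 0"
  obtains c where "f = const_poly c"
proof -
  have "\<exists>c. f = const_poly c" using assms
  proof (induction rule: homog_induct)
    case (single m c)
    then have "m = 0" by (intro poly_mapping_eqI) simp
    then show ?case by (auto simp: const_poly_def)
  next
    case (add f g)
    then show ?case by (metis const_poly_add)
  qed (metis const_poly_0)
  then show ?thesis using that by blast
qed

lemma lin_form_add: "lin_form (\<alpha> + \<beta>) = lin_form \<alpha> + lin_form \<beta>"
  by (simp add: lin_form_def algebra_simps sum.distrib)

lemma lin_form_scale: "lin_form (c *s \<alpha>) = const_poly c * lin_form \<alpha>"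
  by (simp add: lin_form_def algebra_simps sum_distrib_left)

lemma lin_form_minus: "lin_form (\<alpha> - \<beta>) = lin_form \<alpha> - lin_form \<beta>"
  using lin_form_add[of "\<alpha> - \<beta>" \<beta>] by simp

lemma lin_form_axis: "lin_form (axis i 1) = var_poly i"
proof -
  have "(\<Sum>j\<in>UNIV. const_poly (vec_nth (axis i 1 :: 'a ^ 4) j) * var_poly j) =
     (\<Sum>j\<in>UNIV. if j = i then var_poly j else 0)"
    by (rule sum.cong) (auto simp: axis_def)
  then show ?thesis unfolding lin_form_def by simp
qed

section \<open>Directional derivatives and their pairing with points\<close>

definition const_coeff :: "'k::field mpoly4 \<Rightarrow> 'k" where
  "const_coeff f = eval_poly 0 f"

text \<open>The derivation that sends \<open>lin_form p\<close> to the scalar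
  \<open>dotp u p\<close>; the vector u stands for the plane of all p with
  \<open>dotp u p = 0\<close>.\<close>

definition dderiv :: "'k::field ^ 4 \<Rightarrow> 'k mpoly4 \<Rightarrow> 'k mpoly4" where
  "dderiv u f = (\<Sum>i\<in>UNIV. const_poly (vec_nth u i) * partial_deriv i f)"

lemma partial_deriv_add: "partial_deriv i (f + g) = partial_deriv i f + partial_deriv i g"
  unfolding partial_deriv_def
  by (rule keys_sum_add[where h = "\<lambda>m x. Poly_Mapping.single (m - Poly_Mapping.single i 1)
        (of_nat (Poly_Mapping.lookup m i) * x)"]) (simp_all add: algebra_simps single_add)

lemma partial_deriv_single:
  "partial_deriv i (Poly_Mapping.single m c) =
   Poly_Mapping.single (m - Poly_Mapping.single i 1) (of_nat (Poly_Mapping.lookup m i) * c)"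
  by (cases "c = 0") (simp_all add: partial_deriv_def)

lemma partial_deriv_mult:
  "partial_deriv i (f * g) = partial_deriv i f * g + f * partial_deriv i g"
proof (induction f rule: mpoly4_induct)
  case (single m c)
  show ?case
  proof (induction g rule: mpoly4_induct)
    case (single n d)
    let ?e = "Poly_Mapping.single i (1::nat)"
    have 1: "(m - ?e) + n = m + n - ?e" if "Poly_Mapping.lookup m i \<noteq> 0"
      by (rule poly_mapping_eqI) (use that in \<open>auto simp: lookup_add lookup_minus lookup_single when_def\<close>)
    have 2: "m + (n - ?e) = m + n - ?e" if "Poly_Mapping.lookup n i \<noteq> 0"
      by (rule poly_mapping_eqI) (use that in \<open>auto simp: lookup_add lookup_minus lookup_single when_def\<close>)
    have "Poly_Mapping.single (m - ?e) (of_nat (Poly_Mapping.lookup m i) * c) * Poly_Mapping.single n d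
        = Poly_Mapping.single (m + n - ?e) (of_nat (Poly_Mapping.lookup m i) * c * d)"
      by (cases "Poly_Mapping.lookup m i = 0") (use 1 in \<open>simp_all add: mult_single\<close>)
    moreover have "Poly_Mapping.single m c * Poly_Mapping.single (n - ?e) (of_nat (Poly_Mapping.lookup n i) * d)
        = Poly_Mapping.single (m + n - ?e) (of_nat (Poly_Mapping.lookup n i) * c * d)"
      by (cases "Poly_Mapping.lookup n i = 0") (use 2 in \<open>simp_all add: mult_single algebra_simps\<close>)
    ultimately show ?case
      by (simp add: mult_single partial_deriv_single lookup_add algebra_simps flip: single_add)
  qed (simp add: partial_deriv_add algebra_simps)
qed (simp add: partial_deriv_add algebra_simps)

lemma dderiv_add: "dderiv u (f + g) = dderiv u f + dderiv u g"
  by (simp add: dderiv_def partial_deriv_add algebra_simps sum.distrib)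

lemma dderiv_mult: "dderiv u (f * g) = dderiv u f * g + f * dderiv u g"
  by (simp add: dderiv_def partial_deriv_mult algebra_simps sum.distrib sum_distrib_left)

lemma dderiv_const [simp]: "dderiv u (const_poly c) = 0"
  by (simp add: dderiv_def const_poly_def partial_deriv_single)

lemma dderiv_0 [simp]: "dderiv u 0 = 0"
  using dderiv_const[of u 0] by simp

lemma dderiv_1 [simp]: "dderiv u 1 = 0"
  using dderiv_const[of u 1] by simp

lemma dderiv_scale: "dderiv u (const_poly c * f) = const_poly c * dderiv u f"
  by (simp add: dderiv_mult)

definition dotp :: "'k::field ^ 4 \<Rightarrow> 'k ^ 4 \<Rightarrow> 'k" where
  "dotp u p = (\<Sum>i\<in>UNIV. vec_nth u i * vec_nth p i)"

lemma partial_deriv_var: "partial_deriv i (var_poly j) = (if i = j then 1 else 0)"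
proof -
  have "Poly_Mapping.single j 1 - Poly_Mapping.single j (1::nat) = 0"
    by (rule poly_mapping_eqI) (simp add: lookup_minus)
  then show ?thesis
    by (auto simp: var_poly_def partial_deriv_single lookup_single when_def)
qed

lemma partial_deriv_sum: "partial_deriv i (sum f S) = (\<Sum>x\<in>S. partial_deriv i (f x))"
  by (induction S rule: infinite_finite_induct)
    (simp_all add: partial_deriv_add, simp_all add: partial_deriv_def)

lemma partial_deriv_lin_form: "partial_deriv i (lin_form p) = const_poly (vec_nth p i)"
proof -
  have [simp]: "partial_deriv i (const_poly c) = 0" for c :: 'a
    by (simp add: const_poly_def partial_deriv_single)
  show ?thesis
    by (simp add: lin_form_def partial_deriv_sum partial_deriv_mult partial_deriv_var
        if_distrib[of "(*) _"] cong: if_cong)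
qed

lemma const_poly_sum: "const_poly (sum f S) = (\<Sum>x\<in>S. const_poly (f x))"
  by (induction S rule: infinite_finite_induct) simp_all

lemma dderiv_lin_form: "dderiv u (lin_form p) = const_poly (dotp u p)"
  by (simp add: dderiv_def partial_deriv_lin_form dotp_def const_poly_sum)

lemma eval_lin_form: "eval_poly p (lin_form u) = dotp u p"
  by (simp add: lin_form_def dotp_def)

lemma const_coeff_simps [simp]:
  "const_coeff (f + g) = const_coeff f + const_coeff g" "const_coeff (f * g) = const_coeff f * const_coeff g"
  "const_coeff (const_poly c) = c" "const_coeff (lin_form p) = 0" "const_coeff 0 = 0" "const_coeff 1 = 1"
  by (simp_all add: const_coeff_def eval_lin_form dotp_def)

section \<open>Linear algebra modulo a subspace\<close>

text \<open>A basis of S modulo its intersection with W, kept as representatives in S. As W may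
  stick out of S, the whole ideal can stand for its part of one degree.\<close>

definition quot_basis :: "'k::field mpoly4 set \<Rightarrow> 'k mpoly4 set \<Rightarrow> 'k mpoly4 set \<Rightarrow> bool" where
  "quot_basis S W B \<longleftrightarrow> finite B \<and> B \<subseteq> S \<and>
     (\<forall>x\<in>S. \<exists>c. x - (\<Sum>b\<in>B. const_poly (c b) * b) \<in> W) \<and>
     (\<forall>c. (\<Sum>b\<in>B. const_poly (c b) * b) \<in> W \<longrightarrow> (\<forall>b\<in>B. c b = 0))"

lemma quot_basis_notin:
  assumes "quot_basis S W B" "b \<in> B"
  shows "b \<notin> W"
proof
  assume bW: "b \<in> W"
  define c where "c = (\<lambda>x. if x = b then 1 else (0::'a))"
  have "(\<Sum>x\<in>B. const_poly (c x) * x) = (\<Sum>x\<in>{b}. const_poly (c x) * x)"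
    by (rule sum.mono_neutral_right) (use assms in \<open>auto simp: c_def quot_basis_def\<close>)
  then have "(\<Sum>x\<in>B. const_poly (c x) * x) \<in> W" using bW by (simp add: c_def)
  then have "c b = 0" using assms unfolding quot_basis_def by blast
  then show False by (simp add: c_def)
qed

text \<open>A basis of the intersection of S and W is extended first by Y and then to all of S;
  dropping the initial part leaves a basis modulo W through Y. The prescribed Y will be a kernel
  element.\<close>

lemma quot_basis_extend:
  assumes S: "mp.subspace S" and W: "mp.subspace W"
    and T: "finite T" "S \<subseteq> mp.span T" and Y: "Y \<in> S" "Y \<notin> W"
  obtains B where "quot_basis S W B" "Y \<in> B"
proof -
  obtain B1 where B1: "B1 \<subseteq> S \<inter> W" "mp.independent B1" "S \<inter> W \<subseteq> mp.span B1"
    using mp.maximal_independent_subset by blast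
  have sB1: "mp.span B1 \<subseteq> W" by (rule mp.span_minimal) (use B1 W in auto)
  then have "mp.independent (insert Y B1)" using Y B1 by (intro mp.independent_insertI) auto
  moreover have "insert Y B1 \<subseteq> S" using Y B1 by auto
  ultimately obtain B2 where B2: "insert Y B1 \<subseteq> B2" "B2 \<subseteq> S" "mp.independent B2" "S \<subseteq> mp.span B2"
    using mp.maximal_independent_subset_extend[of "insert Y B1" S] by blast
  have fin: "finite B2" using mp.independent_span_bound[OF T(1) B2(3)] B2 T by blast
  define B where "B = B2 - B1"
  have B12: "B1 \<subseteq> B2" using B2 by auto
  have finB1: "finite B1" using B12 fin finite_subset by blast
  have split: "sum h B2 = sum h B + sum h B1" for h :: "'a mpoly4 \<Rightarrow> 'a mpoly4"
    unfolding B_def using sum.subset_diff[OF B12 fin, of h] by simp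
  have "quot_basis S W B" unfolding quot_basis_def
  proof (intro conjI ballI allI impI)
    show "finite B" "B \<subseteq> S" using fin B2 by (auto simp: B_def)
    fix x assume "x \<in> S"
    then have "x \<in> range (\<lambda>u. \<Sum>v\<in>B2. const_poly (u v) * v)"
      using B2(4) mp.span_finite[OF fin] by auto
    then obtain u where u: "x = (\<Sum>v\<in>B2. const_poly (u v) * v)" by auto
    have "(\<Sum>v\<in>B1. const_poly (u v) * v) \<in> W"
      by (intro mp.subspace_sum mp.subspace_scale W) (use B1 in auto)
    then show "\<exists>c. x - (\<Sum>b\<in>B. const_poly (c b) * b) \<in> W"
      by (intro exI[of _ u]) (simp add: u split)
  next
    fix c b assume c: "(\<Sum>b\<in>B. const_poly (c b) * b) \<in> W" and b: "b \<in> B"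
    have "(\<Sum>b\<in>B. const_poly (c b) * b) \<in> S"
      by (intro mp.subspace_sum mp.subspace_scale S) (use B2 in \<open>auto simp: B_def\<close>)
    then have "(\<Sum>b\<in>B. const_poly (c b) * b) \<in> range (\<lambda>u. \<Sum>v\<in>B1. const_poly (u v) * v)"
      using B1 c mp.span_finite[OF finB1] by auto
    then obtain u where u: "(\<Sum>b\<in>B. const_poly (c b) * b) = (\<Sum>v\<in>B1. const_poly (u v) * v)" by auto
    \<comment> \<open>With the right-hand side moved over, this is a relation among the independent
      vectors \<open>B2\<close>.\<close>
    define w where "w = (\<lambda>b. if b \<in> B1 then - u b else c b)"
    have "(\<Sum>b\<in>B2. const_poly (w b) * b) =
        (\<Sum>b\<in>B. const_poly (c b) * b) + (\<Sum>b\<in>B1. - (const_poly (u b) * b))"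
      unfolding split by (intro arg_cong2[where f = "(+)"] sum.cong) (auto simp: w_def B_def)
    also have "\<dots> = 0" using u by (simp add: sum_negf)
    finally have "w b = 0"
      using mp.independentD[OF B2(3) fin order.refl] b by (auto simp: B_def)
    then show "c b = 0" using b by (simp add: w_def B_def)
  qed
  moreover have "Y \<in> B" using B2 Y B1 by (auto simp: B_def)
  ultimately show ?thesis using that by blast
qed

lemma quot_basis_exists:
  assumes S: "mp.subspace S" and W: "mp.subspace W"
    and T: "finite T" "S \<subseteq> mp.span T"
  obtains B where "quot_basis S W B"
proof (cases "S \<subseteq> W")
  case True
  then have "quot_basis S W {}" by (auto simp: quot_basis_def)
  then show ?thesis using that by blast
next
  case False
  then show ?thesis using quot_basis_extend[OF S W T] that by blast
qed

text \<open>Graded components and cokernels are both records whose carrier is the image of a space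
  of polynomials; the locale computes their dimensions from representatives, once for both.\<close>

locale module_image =
  fixes V :: "('k::field, 'v, 'x) module_scheme" and \<kappa> :: "'k mpoly4 \<Rightarrow> 'v"
    and S W :: "'k mpoly4 set"
  assumes S: "mp.subspace S"
    and carr: "carrier V = \<kappa> ` S"
    and zero: "\<zero>\<^bsub>V\<^esub> = \<kappa> 0"
    and add: "\<And>x y. x \<in> S \<Longrightarrow> y \<in> S \<Longrightarrow> \<kappa> x \<oplus>\<^bsub>V\<^esub> \<kappa> y = \<kappa> (x + y)"
    and smult: "\<And>c x. x \<in> S \<Longrightarrow> c \<odot>\<^bsub>V\<^esub> \<kappa> x = \<kappa> (const_poly c * x)"
    and ker: "\<And>x y. x \<in> S \<Longrightarrow> y \<in> S \<Longrightarrow> \<kappa> x = \<kappa> y \<longleftrightarrow> x - y \<in> W"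
begin

lemma vs: "vectorspace class_ring V"
proof (rule vs_criteria)
  show "field (class_ring :: 'k ring)" by (rule class_field)
  show "\<zero>\<^bsub>V\<^esub> \<in> carrier V" using S by (auto simp: carr zero mp.subspace_0)
  show "\<forall>v\<in>carrier V. \<exists>neg_v\<in>carrier V. v \<oplus>\<^bsub>V\<^esub> neg_v = \<zero>\<^bsub>V\<^esub>"
  proof
    fix v assume "v \<in> carrier V"
    then obtain x where "x \<in> S" "v = \<kappa> x" by (auto simp: carr)
    then show "\<exists>neg_v\<in>carrier V. v \<oplus>\<^bsub>V\<^esub> neg_v = \<zero>\<^bsub>V\<^esub>"
      using mp.subspace_neg[OF S] by (intro bexI[of _ "\<kappa> (- x)"]) (auto simp: carr zero add)
  qed
  have aS: "x + y \<in> S" if "x \<in> S" "y \<in> S" for x y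
    using mp.subspace_add[OF S that] .
  have cS: "const_poly c * x \<in> S" if "x \<in> S" for c x
    using mp.subspace_scale[OF S that] .
  show "\<forall>v w. v \<in> carrier V \<and> w \<in> carrier V \<longrightarrow> v \<oplus>\<^bsub>V\<^esub> w \<in> carrier V"
    using aS by (auto simp: carr add)
  show "\<forall>c v. c \<in> carrier class_ring \<and> v \<in> carrier V \<longrightarrow> c \<odot>\<^bsub>V\<^esub> v \<in> carrier V"
    using cS by (auto simp: carr smult)
  show "\<forall>v w. v \<in> carrier V \<and> w \<in> carrier V \<longrightarrow> v \<oplus>\<^bsub>V\<^esub> w = w \<oplus>\<^bsub>V\<^esub> v"
    by (auto simp: carr add add.commute)
  show "\<forall>v w x. v \<in> carrier V \<and> w \<in> carrier V \<and> x \<in> carrier V \<longrightarrow>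
      (v \<oplus>\<^bsub>V\<^esub> w) \<oplus>\<^bsub>V\<^esub> x = v \<oplus>\<^bsub>V\<^esub> (w \<oplus>\<^bsub>V\<^esub> x)"
    by (auto simp: carr add aS add.assoc)
  show "\<forall>v\<in>carrier V. v \<oplus>\<^bsub>V\<^esub> \<zero>\<^bsub>V\<^esub> = v"
    by (auto simp: carr add zero mp.subspace_0[OF S])
  show "\<forall>a b v. a \<in> carrier class_ring \<and> b \<in> carrier class_ring \<and> v \<in> carrier V \<longrightarrow>
      (a \<otimes>\<^bsub>class_ring\<^esub> b) \<odot>\<^bsub>V\<^esub> v = a \<odot>\<^bsub>V\<^esub> (b \<odot>\<^bsub>V\<^esub> v)"
    by (auto simp: carr smult cS mult.assoc)
  show "\<forall>v\<in>carrier V. \<one>\<^bsub>class_ring\<^esub> \<odot>\<^bsub>V\<^esub> v = v"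
    by (auto simp: carr smult)
  show "\<forall>a b v. a \<in> carrier class_ring \<and> b \<in> carrier class_ring \<and> v \<in> carrier V \<longrightarrow>
      (a \<oplus>\<^bsub>class_ring\<^esub> b) \<odot>\<^bsub>V\<^esub> v = a \<odot>\<^bsub>V\<^esub> v \<oplus>\<^bsub>V\<^esub> b \<odot>\<^bsub>V\<^esub> v"
    by (auto simp: carr smult add cS distrib_right)
  show "\<forall>a v w. a \<in> carrier class_ring \<and> v \<in> carrier V \<and> w \<in> carrier V \<longrightarrow>
      a \<odot>\<^bsub>V\<^esub> (v \<oplus>\<^bsub>V\<^esub> w) = a \<odot>\<^bsub>V\<^esub> v \<oplus>\<^bsub>V\<^esub> a \<odot>\<^bsub>V\<^esub> w"
    by (auto simp: carr smult add aS cS distrib_left)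
qed

interpretation VS: vectorspace class_ring V by (rule vs)

lemma lincomb_image:
  assumes "finite B" "B \<subseteq> S" "inj_on \<kappa> B"
  shows "VS.lincomb a (\<kappa> ` B) = \<kappa> (\<Sum>b\<in>B. const_poly (a (\<kappa> b)) * b)"
  using assms
proof (induction B rule: finite_induct)
  case empty
  then show ?case by (simp add: VS.lincomb_def zero)
next
  case (insert b B)
  have mem: "const_poly c * x \<in> S" if "x \<in> S" for c x using S that by (rule mp.subspace_scale)
  have sm: "(\<Sum>b\<in>B. const_poly (a (\<kappa> b)) * b) \<in> S"
    by (intro mp.subspace_sum S mem) (use insert in auto)
  have "VS.lincomb a (insert (\<kappa> b) (\<kappa> ` B)) = a (\<kappa> b) \<odot>\<^bsub>V\<^esub> \<kappa> b \<oplus>\<^bsub>V\<^esub> VS.lincomb a (\<kappa> ` B)"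
    unfolding VS.lincomb_def
    by (rule VS.finsum_insert) (use insert mem in \<open>auto simp: carr smult\<close>)
  then show ?case using insert sm mem by (simp add: smult add)
qed

lemma dim_eq:
  assumes B: "quot_basis S W B"
  shows "vectorspace.dim class_ring V = card B"
proof -
  note B' = B[unfolded quot_basis_def]
  have fin: "finite B" and BS: "B \<subseteq> S" using B' by auto
  have scS: "const_poly c * x \<in> S" if "x \<in> S" for c x using S that by (rule mp.subspace_scale)
  have smS: "(\<Sum>b\<in>B. const_poly (a b) * b) \<in> S" for a
    by (intro mp.subspace_sum S scS) (use BS in auto)
  have inj: "inj_on \<kappa> B"
  proof (rule inj_onI, rule ccontr)
    fix x y assume xy: "x \<in> B" "y \<in> B" "\<kappa> x = \<kappa> y" "x \<noteq> y"
    then have "x - y \<in> W" using ker BS by blast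
    define c where "c = (\<lambda>b. if b = x then 1 else if b = y then -1 else (0::'k))"
    have "(\<Sum>b\<in>B. const_poly (c b) * b) = (\<Sum>b\<in>{x,y}. const_poly (c b) * b)"
      by (rule sum.mono_neutral_right) (use fin xy in \<open>auto simp: c_def\<close>)
    also have "\<dots> = x - y" using xy by (simp add: c_def)
    finally have "c x = 0" using B' \<open>x - y \<in> W\<close> xy by simp
    then show False by (simp add: c_def)
  qed
  have carr': "\<kappa> ` B \<subseteq> carrier V" using BS carr by auto
  have li: "\<not> VS.lin_dep (\<kappa> ` B)"
  proof (rule VS.finite_lin_indpt2)
    fix a assume "VS.lincomb a (\<kappa> ` B) = \<zero>\<^bsub>V\<^esub>"
    then have "\<kappa> (\<Sum>b\<in>B. const_poly (a (\<kappa> b)) * b) = \<kappa> 0"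
      using lincomb_image[OF fin BS inj] zero by simp
    then have "(\<Sum>b\<in>B. const_poly (a (\<kappa> b)) * b) \<in> W"
      using ker[OF smS mp.subspace_0[OF S], of "\<lambda>b. a (\<kappa> b)"] by simp
    then show "\<forall>v\<in>\<kappa> ` B. a v = \<zero>\<^bsub>class_ring\<^esub>"
      using B'[THEN conjunct2, THEN conjunct2, THEN conjunct2] by force
  qed (use fin carr' in auto)
  have sp: "VS.span (\<kappa> ` B) = carrier V"
  proof
    show "VS.span (\<kappa> ` B) \<subseteq> carrier V" by (rule VS.span_is_subset2[OF carr'])
    show "carrier V \<subseteq> VS.span (\<kappa> ` B)"
    proof
      fix v assume "v \<in> carrier V"
      then obtain x where x: "x \<in> S" "v = \<kappa> x" by (auto simp: carr)
      then obtain c where c: "x - (\<Sum>b\<in>B. const_poly (c b) * b) \<in> W" using B' by blast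
      have "v = \<kappa> (\<Sum>b\<in>B. const_poly (c b) * b)" using x ker[OF x(1) smS] c by blast
      also have "(\<Sum>b\<in>B. const_poly (c b) * b) =
          (\<Sum>b\<in>B. const_poly ((c \<circ> the_inv_into B \<kappa>) (\<kappa> b)) * b)"
        by (intro sum.cong) (auto simp: the_inv_into_f_f[OF inj])
      also have "\<kappa> \<dots> = VS.lincomb (c \<circ> the_inv_into B \<kappa>) (\<kappa> ` B)"
        by (rule lincomb_image[OF fin BS inj, symmetric])
      finally show "v \<in> VS.span (\<kappa> ` B)"
        using VS.finite_span[OF finite_imageI[OF fin] carr'] by auto
    qed
  qed
  have "VS.basis (\<kappa> ` B)" using li sp carr' by (simp add: VS.basis_def)
  then have "VS.dim = card (\<kappa> ` B)" using VS.dim_basis fin by blast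
  then show ?thesis using card_image[OF inj] by simp
qed

end

text \<open>Adding a basis of the relevant part of W to both sides turns the comparison modulo W
  into the usual bound of an independent set by a spanning set.\<close>

lemma quot_basis_card_le:
  assumes S: "mp.subspace S" and W: "mp.subspace W" and B: "quot_basis S W B"
    and C: "finite C" "C \<subseteq> S" "\<And>x. x \<in> S \<Longrightarrow> \<exists>c. x - (\<Sum>b\<in>C. const_poly (c b) * b) \<in> W"
  shows "card B \<le> card C"
proof -
  note B' = B[unfolded quot_basis_def]
  have fin: "finite B" using B' by auto
  \<comment> \<open>W is cut down to the span of the vectors involved, which keeps \<open>B1\<close>
    finite even when W is an ideal.\<close>
  obtain B1 where B1: "B1 \<subseteq> W \<inter> mp.span (B \<union> C)" "mp.independent B1" "W \<inter> mp.span (B \<union> C) \<subseteq> mp.span B1"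
    using mp.maximal_independent_subset by blast
  have finB1: "finite B1"
    using mp.independent_span_bound[OF _ B1(2), of "B \<union> C"] B1 fin C by auto
  have spB1: "mp.span B1 \<subseteq> W" by (rule mp.span_minimal) (use B1 W in auto)
  have disj: "B \<inter> B1 = {}" using quot_basis_notin[OF B] B1 by blast
  have ind: "mp.independent (B \<union> B1)"
  proof (rule mp.independent_if_scalars_zero)
    show "finite (B \<union> B1)" using fin finB1 by auto
    fix u x assume u: "(\<Sum>x\<in>B \<union> B1. const_poly (u x) * x) = 0" and x: "x \<in> B \<union> B1"
    then have sum0: "(\<Sum>x\<in>B. const_poly (u x) * x) = - (\<Sum>x\<in>B1. const_poly (u x) * x)"
      by (simp add: sum.union_disjoint[OF fin finB1 disj] eq_neg_iff_add_eq_0)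
    also have "\<dots> \<in> W"
      by (intro mp.subspace_neg mp.subspace_sum mp.subspace_scale W) (use B1 in auto)
    finally have z: "\<forall>b\<in>B. u b = 0" using B' by blast
    then have "(\<Sum>x\<in>B1. const_poly (u x) * x) = 0" using sum0 by simp
    then have "\<forall>b\<in>B1. u b = 0" using mp.independentD[OF B1(2) finB1 order.refl] by blast
    then show "u x = 0" using z x by blast
  qed
  have "B \<union> B1 \<subseteq> mp.span (C \<union> B1)"
  proof
    fix x assume "x \<in> B \<union> B1"
    then show "x \<in> mp.span (C \<union> B1)"
    proof
      assume x: "x \<in> B"
      then have "x \<in> S" using B' by auto
      then obtain c where c: "x - (\<Sum>b\<in>C. const_poly (c b) * b) \<in> W" using C(3) by blast
      have s: "(\<Sum>b\<in>C. const_poly (c b) * b) \<in> mp.span C"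
        by (intro mp.span_sum mp.span_scale mp.span_base)
      then have "x - (\<Sum>b\<in>C. const_poly (c b) * b) \<in> mp.span (B \<union> C)"
        using x mp.span_mono[of C "B \<union> C"] by (intro mp.span_diff) (auto intro: mp.span_base)
      then have "x - (\<Sum>b\<in>C. const_poly (c b) * b) \<in> mp.span (C \<union> B1)"
        using c B1 mp.span_mono[of B1 "C \<union> B1"] by auto
      moreover have "(\<Sum>b\<in>C. const_poly (c b) * b) \<in> mp.span (C \<union> B1)"
        using s mp.span_mono[of C "C \<union> B1"] by auto
      ultimately show ?thesis using mp.span_add by fastforce
    qed (auto intro: mp.span_base)
  qed
  then have "card (B \<union> B1) \<le> card (C \<union> B1)"
    using mp.independent_span_bound[OF _ ind] C finB1 by auto
  moreover have "card (B \<union> B1) = card B + card B1" using card_Un_disjoint[OF fin finB1 disj] .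
  moreover have "card (C \<union> B1) \<le> card C + card B1" by (rule card_Un_le)
  ultimately show ?thesis by linarith
qed

section \<open>Graded components and cokernels of multiplication maps\<close>

locale mpoly4_ideal =
  fixes I :: "'k::field mpoly4 set"
  assumes is_ideal: "ideal I poly_ring"
begin

interpretation ideal I "poly_ring :: 'k mpoly4 ring" by (rule is_ideal)

lemma add_mem: "x \<in> I \<Longrightarrow> y \<in> I \<Longrightarrow> x + y \<in> I"
  using a_closed by simp

lemma zero_mem: "0 \<in> I"
  using zero_closed by simp

lemma mult_mem: "x \<in> I \<Longrightarrow> r * x \<in> I"
  using I_l_closed[of x r] by simp

lemma minus_mem: "x \<in> I \<Longrightarrow> - x \<in> I"
  using mult_mem[of x "-1"] by simp

lemma diff_mem: "x \<in> I \<Longrightarrow> y \<in> I \<Longrightarrow> x - y \<in> I"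
  using add_mem[OF _ minus_mem, of x y] by simp

lemma subspace_ideal: "mp.subspace I"
  by (intro mp.subspaceI zero_mem add_mem mult_mem)

abbreviation cls :: "'k mpoly4 \<Rightarrow> 'k mpoly4 set" where
  "cls f \<equiv> I +>\<^bsub>poly_ring\<^esub> f"

lemma coset_eq: "cls f = {g. g - f \<in> I}"
proof -
  have "g \<in> (\<lambda>x. x + f) ` I" if "g - f \<in> I" for g
    using that by (intro image_eqI[of _ _ "g - f"]) auto
  then show ?thesis by (auto simp: a_r_coset_def')
qed

lemma coset_eq_iff: "cls f = cls g \<longleftrightarrow> f - g \<in> I"
proof
  assume "cls f = cls g"
  moreover have "f \<in> cls f" using zero_mem by (simp add: coset_eq)
  ultimately show "f - g \<in> I" by (simp add: coset_eq)
next
  assume fg: "f - g \<in> I"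
  have "h - g \<in> I" if "h - f \<in> I" for h using add_mem[OF that fg] by simp
  moreover have "h - f \<in> I" if "h - g \<in> I" for h using diff_mem[OF that fg] by simp
  ultimately show "cls f = cls g" by (auto simp: coset_eq)
qed

lemma coset_add:
  "set_add poly_ring (cls f) (cls g) = cls (f + g)"
  using a_rcos_sum[of f g] by simp

lemma coset_mult:
  "rcoset_mult poly_ring I (cls f) (cls g) = cls (f * g)"
  using rcoset_mult_add[of f g] by simp

lemma component_simps:
  "carrier (component I t) = (\<lambda>f. cls f) ` homog t"
  "add (component I t) = set_add poly_ring"
  "zero (component I t) = I"
  "c \<odot>\<^bsub>component I t\<^esub> (cls f) = cls (const_poly c * f)"
  by (simp_all add: component_def quot_alg_def FactRing_def coset_mult)

lemma ideal_as_coset: "I = cls 0"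
  by (simp add: coset_eq)

lemma mult_map_coset: "mult_map I l (cls f) = cls (l * f)"
  by (simp add: mult_map_def quot_alg_def FactRing_def coset_mult)

lemma module_image_component: "module_image (component I t) (\<lambda>f. cls f) (homog t) I"
  by unfold_locales
    (simp_all add: subspace_homog component_simps coset_add coset_eq_iff flip: ideal_as_coset)

lemma mult_inj_iff: "mult_inj I l s \<longleftrightarrow> (\<forall>f\<in>homog s. l * f \<in> I \<longrightarrow> f \<in> I)"
proof
  assume inj: "mult_inj I l s"
  show "\<forall>f\<in>homog s. l * f \<in> I \<longrightarrow> f \<in> I"
  proof (intro ballI impI)
    fix f assume f: "f \<in> homog s" "l * f \<in> I"
    then have "mult_map I l (cls f) = mult_map I l (cls 0)"
      by (simp add: mult_map_coset coset_eq_iff)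
    then have "cls f = cls 0"
      by (rule inj_onD[OF inj[unfolded mult_inj_def]]) (use f in \<open>auto simp: component_simps\<close>)
    then show "f \<in> I" by (simp add: coset_eq_iff)
  qed
next
  assume k: "\<forall>f\<in>homog s. l * f \<in> I \<longrightarrow> f \<in> I"
  show "mult_inj I l s" unfolding mult_inj_def
  proof (rule inj_onI)
    fix A B assume AB: "A \<in> carrier (component I s)" "B \<in> carrier (component I s)"
      "mult_map I l A = mult_map I l B"
    then obtain f g where fg: "f \<in> homog s" "g \<in> homog s"
      "A = cls f" "B = cls g" by (auto simp: component_simps)
    with AB have "l * (f - g) \<in> I" by (simp add: mult_map_coset coset_eq_iff algebra_simps)
    moreover have "f - g \<in> homog s" using fg mp.subspace_diff[OF subspace_homog] by blast
    ultimately show "A = B" using k fg(3,4) by (simp add: coset_eq_iff)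
  qed
qed

lemma mult_surjD:
  assumes "mult_surj I l s t" "f \<in> homog t"
  shows "\<exists>g\<in>homog s. f - l * g \<in> I"
proof -
  have "cls f \<in> mult_map I l ` carrier (component I s)"
    using assms by (auto simp: mult_surj_def component_simps)
  then show ?thesis by (auto simp: component_simps mult_map_coset coset_eq_iff)
qed

text \<open>Elements of the cokernel record are cosets of cosets; labelling them by polynomials
  makes the cokernel an instance of \<open>module_image\<close>.\<close>

definition coker_class :: "'k mpoly4 \<Rightarrow> nat \<Rightarrow> 'k mpoly4 \<Rightarrow> 'k mpoly4 set set" where
  "coker_class l s f = {cls (l * g + f) |g. g \<in> homog s}"

lemma coker_class_eq:
  "(mult_map I l ` carrier (component I s)) +>\<^bsub>component I t\<^esub> (cls f) = coker_class l s f"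
  unfolding a_r_coset_def'[of "component I t"] component_simps coker_class_def
  by (simp add: image_image mult_map_coset coset_add Setcompr_eq_image UNION_singleton_eq_range)

lemma image_eq_coker_class: "mult_map I l ` carrier (component I s) = coker_class l s 0"
  unfolding component_simps coker_class_def by (simp add: image_image mult_map_coset Setcompr_eq_image)

lemma coker_class_eq_iff:
  "coker_class l s f = coker_class l s f' \<longleftrightarrow> (\<exists>g\<in>homog s. f - f' - l * g \<in> I)"
proof
  assume *: "coker_class l s f = coker_class l s f'"
  have "cls (l * 0 + f) \<in> coker_class l s f"
    unfolding coker_class_def using homog_0 by blast
  then obtain g where "g \<in> homog s" "cls (l * 0 + f) = cls (l * g + f')"
    unfolding * unfolding coker_class_def by blast
  then show "\<exists>g\<in>homog s. f - f' - l * g \<in> I" by (auto simp: coset_eq_iff algebra_simps)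
next
  assume "\<exists>g\<in>homog s. f - f' - l * g \<in> I"
  then obtain g where g: "g \<in> homog s" "f - f' - l * g \<in> I" by blast
  have 1: "cls (l * h + f) = cls (l * (h + g) + f')" for h
    using g by (simp add: coset_eq_iff algebra_simps)
  have 2: "cls (l * h + f') = cls (l * (h - g) + f)" for h
    using minus_mem[OF g(2)] by (simp add: coset_eq_iff algebra_simps)
  have "coker_class l s f \<subseteq> coker_class l s f'"
    unfolding coker_class_def using 1 homog_add[OF _ g(1)] by blast
  moreover have "coker_class l s f' \<subseteq> coker_class l s f"
    unfolding coker_class_def using 2 mp.subspace_diff[OF subspace_homog _ g(1)] by blast
  ultimately show "coker_class l s f = coker_class l s f'" by blast
qed

lemma coker_class_add:
  "set_add (component I t) (coker_class l s f) (coker_class l s f') = coker_class l s (f + f')"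
proof
  show "set_add (component I t) (coker_class l s f) (coker_class l s f') \<subseteq> coker_class l s (f + f')"
  proof
    fix C assume "C \<in> set_add (component I t) (coker_class l s f) (coker_class l s f')"
    then obtain g g' where "g \<in> homog s" "g' \<in> homog s" "C = cls (l * g + f + (l * g' + f'))"
      unfolding set_add_def'[of "component I t"] component_simps coker_class_def
      using coset_add by blast
    then show "C \<in> coker_class l s (f + f')" unfolding coker_class_def
      by (intro CollectI exI[of _ "g + g'"]) (auto simp: homog_add algebra_simps)
  qed
  show "coker_class l s (f + f') \<subseteq> set_add (component I t) (coker_class l s f) (coker_class l s f')"
  proof
    fix C assume "C \<in> coker_class l s (f + f')"
    then obtain g where g: "g \<in> homog s" "C = cls (l * g + (f + f'))"
      by (auto simp: coker_class_def)
    have "cls (l * g + f) \<in> coker_class l s f"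
      "cls (l * 0 + f') \<in> coker_class l s f'"
      unfolding coker_class_def using g homog_0 by blast+
    moreover have "C = (cls (l * g + f)) \<oplus>\<^bsub>component I t\<^esub> (cls (l * 0 + f'))"
      using g by (simp add: component_simps coset_add algebra_simps)
    ultimately show "C \<in> set_add (component I t) (coker_class l s f) (coker_class l s f')"
      unfolding set_add_def' by blast
  qed
qed

lemma coker_class_smult:
  "(\<Union>x\<in>coker_class l s f. coker_class l s 0 +>\<^bsub>component I t\<^esub> (c \<odot>\<^bsub>component I t\<^esub> x))
    = coker_class l s (const_poly c * f)"
proof -
  have "coker_class l s 0 +>\<^bsub>component I t\<^esub> (c \<odot>\<^bsub>component I t\<^esub> (cls (l * g + f)))
      = coker_class l s (const_poly c * f)" if "g \<in> homog s" for g
    unfolding component_simps(4) image_eq_coker_class[symmetric] coker_class_eq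
    by (subst coker_class_eq_iff)
      (use that in \<open>auto intro!: bexI[of _ "const_poly c * g"] homog_scale simp: algebra_simps zero_mem\<close>)
  \<comment> \<open>All members of the union are equal, but an empty union would lose the common
    value.\<close>
  moreover have "coker_class l s f \<noteq> {}" unfolding coker_class_def using homog_0 by blast
  ultimately show ?thesis unfolding coker_class_def by auto
qed

lemma module_image_coker:
  "module_image (mult_coker I l s t) (coker_class l s) (homog t) {x. \<exists>g\<in>homog s. x - l * g \<in> I}"
proof
  show "mp.subspace (homog t)" by (rule subspace_homog)
  show "carrier (mult_coker I l s t) = coker_class l s ` homog t"
  proof -
    have "carrier (mult_coker I l s t) = (\<Union>A\<in>carrier (component I t).
        {(mult_map I l ` carrier (component I s)) +>\<^bsub>component I t\<^esub> A})"
      by (simp add: mult_coker_def quot_module_def A_RCOSETS_def')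
    also have "\<dots> = coker_class l s ` homog t"
      unfolding component_simps(1)[of t] by (auto simp: coker_class_eq)
    finally show ?thesis .
  qed
  show "\<zero>\<^bsub>mult_coker I l s t\<^esub> = coker_class l s 0"
    by (simp add: mult_coker_def quot_module_def image_eq_coker_class)
qed (simp_all add: mult_coker_def quot_module_def coker_class_add image_eq_coker_class
    coker_class_smult coker_class_eq_iff)

end

section \<open>Bivariate polynomials and powers of two-generated ideals\<close>

text \<open>The outer variable of the iterated polynomial is s, the inner one u.\<close>

definition ev :: "'k::comm_ring_1 poly poly \<Rightarrow> 'k \<Rightarrow> 'k \<Rightarrow> 'k" where
  "ev T s u = poly (poly T [:s:]) u"

lemma ev_simps [simp]:
  "ev (p + q) s u = ev p s u + ev q s u" "ev (p - q) s u = ev p s u - ev q s u"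
  "ev (p * q) s u = ev p s u * ev q s u" "ev 0 s u = 0" "ev 1 s u = 1"
  "ev (p ^ n) s u = ev p s u ^ n" "ev [:[:c:]:] s u = c"
  by (simp_all add: ev_def)

lemma ev_sum [simp]: "ev (sum f A) s u = (\<Sum>x\<in>A. ev (f x) s u)"
  by (induction A rule: infinite_finite_induct) simp_all

lemma ev_prod [simp]: "ev (prod f A) s u = (\<Prod>x\<in>A. ev (f x) s u)"
  by (induction A rule: infinite_finite_induct) simp_all

lemma poly_eq_0_infinite:
  fixes p :: "'a::idom poly"
  assumes "infinite A" "\<And>x. x \<in> A \<Longrightarrow> poly p x = 0"
  shows "p = 0"
proof (rule ccontr)
  assume "p \<noteq> 0"
  then have "finite {x. poly p x = 0}" by (rule poly_roots_finite)
  moreover have "A \<subseteq> {x. poly p x = 0}" using assms by auto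
  ultimately show False using assms(1) finite_subset by blast
qed

text \<open>A field of characteristic zero is infinite, so values determine first each
  specialisation in s and then the polynomial. Symmetry and the independence of choices are proved
  through values.\<close>

lemma ev_ext:
  fixes p q :: "'k::field_char_0 poly poly"
  assumes "\<And>s u. ev p s u = ev q s u"
  shows "p = q"
proof -
  have "poly (p - q) [:s:] = 0" for s
    by (rule poly_eq_0_infinite[of UNIV]) (use assms in \<open>simp_all add: ev_def infinite_UNIV_char_0\<close>)
  moreover have "infinite (range (\<lambda>s::'k. [:s:]))"
    using infinite_UNIV_char_0 by (auto dest!: finite_imageD simp: inj_on_def)
  ultimately have "p - q = 0" by (intro poly_eq_0_infinite[of "range (\<lambda>s::'k. [:s:])"]) auto
  then show ?thesis by simp
qed

text \<open>The bound is strict in each variable. With this convention the bound 0 forces the zero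
  polynomial, which is what ends the induction in \<open>VV_span\<close>.\<close>

definition bdeg :: "'k::comm_ring_1 poly poly \<Rightarrow> nat \<Rightarrow> bool" where
  "bdeg T n \<longleftrightarrow> (\<forall>i j. n \<le> i \<or> n \<le> j \<longrightarrow> coeff (coeff T i) j = 0)"

lemma bdeg_add: "bdeg p n \<Longrightarrow> bdeg q n \<Longrightarrow> bdeg (p + q) n"
  by (simp add: bdeg_def)

lemma bdeg_diff: "bdeg p n \<Longrightarrow> bdeg q n \<Longrightarrow> bdeg (p - q) n"
  by (simp add: bdeg_def)

lemma bdeg_0 [simp]: "bdeg 0 n"
  by (simp add: bdeg_def)

lemma bdeg_sum: "(\<And>x. x \<in> A \<Longrightarrow> bdeg (f x) n) \<Longrightarrow> bdeg (sum f A) n"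
  by (induction A rule: infinite_finite_induct) (auto intro: bdeg_add)

lemma bdeg_Suc: "bdeg T (Suc n) \<longleftrightarrow> degree T \<le> n \<and> (\<forall>i. degree (coeff T i) \<le> n)"
proof
  assume T: "bdeg T (Suc n)"
  have "coeff T i = 0" if "n < i" for i
    using T that by (intro poly_eqI) (simp add: bdeg_def)
  then have "degree T \<le> n" by (intro degree_le) auto
  moreover have "degree (coeff T i) \<le> n" for i using T by (intro degree_le) (auto simp: bdeg_def)
  ultimately show "degree T \<le> n \<and> (\<forall>i. degree (coeff T i) \<le> n)" by blast
next
  assume T: "degree T \<le> n \<and> (\<forall>i. degree (coeff T i) \<le> n)"
  show "bdeg T (Suc n)" unfolding bdeg_def
  proof (intro allI impI)
    fix i j assume "Suc n \<le> i \<or> Suc n \<le> j"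
    then show "coeff (coeff T i) j = 0"
    proof
      assume "Suc n \<le> i"
      then have "degree T < i" using T by linarith
      then show ?thesis by (simp add: coeff_eq_0)
    next
      assume "Suc n \<le> j"
      then have "degree (coeff T i) < j" using T by (meson Suc_le_lessD le_less_trans)
      then show ?thesis by (simp add: coeff_eq_0)
    qed
  qed
qed

lemma bdeg_mult:
  assumes "bdeg p (Suc m)" "bdeg q (Suc n)"
  shows "bdeg (p * q) (Suc (m + n))"
  unfolding bdeg_Suc
proof (intro conjI allI)
  show "degree (p * q) \<le> m + n"
    using assms degree_mult_le[of p q] unfolding bdeg_Suc by linarith
  fix i
  show "degree (coeff (p * q) i) \<le> m + n"
    unfolding coeff_mult
  proof (intro degree_sum_le)
    fix x
    show "degree (coeff p x * coeff q (i - x)) \<le> m + n"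
      by (rule order_trans[OF degree_mult_le]) (use assms in \<open>simp add: bdeg_Suc add_mono\<close>)
  qed simp
qed

lemma bdeg_1 [simp]: "bdeg 1 (Suc 0)"
  by (simp add: bdeg_Suc coeff_1 if_distrib)

lemma bdeg_prod:
  assumes "finite A" "\<And>x. x \<in> A \<Longrightarrow> bdeg (f x) (Suc (d x))"
  shows "bdeg (prod f A) (Suc (sum d A))"
  using assms by (induction A rule: finite_induct) (auto intro: bdeg_mult)

lemma bdeg_power: "bdeg p (Suc m) \<Longrightarrow> bdeg (p ^ n) (Suc (n * m))"
  by (induction n) (auto intro: bdeg_mult)

lemma bdeg_poly_const:
  assumes "bdeg T n" "n \<le> j"
  shows "coeff (poly T [:s:]) j = 0"
proof -
  have "coeff (poly T [:s:]) j = (\<Sum>i\<le>degree T. coeff (coeff T i) j * s ^ i)"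
    by (simp add: poly_altdef coeff_sum poly_const_pow mult.commute)
  then show ?thesis using assms by (simp add: bdeg_def)
qed

lemma bdeg_const_mult: "bdeg p n \<Longrightarrow> bdeg ([:[:c:]:] * p) n"
  by (simp add: bdeg_def)

definition swap :: "'k::comm_ring_1 poly poly \<Rightarrow> 'k poly poly" where
  "swap T = (\<Sum>i\<le>degree T. \<Sum>j\<le>degree (coeff T i). monom (monom (coeff (coeff T i) j) i) j)"

lemma ev_monom: "ev (monom (monom c j) i) s u = c * s ^ i * u ^ j"
  by (simp add: ev_def poly_monom)

lemma ev_altdef: "ev T s u = (\<Sum>i\<le>degree T. \<Sum>j\<le>degree (coeff T i). coeff (coeff T i) j * s ^ i * u ^ j)"
proof -
  have "ev T s u = (\<Sum>i\<le>degree T. poly (coeff T i) u * s ^ i)"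
    unfolding ev_def by (simp add: poly_altdef[of T] poly_sum)
  then show ?thesis by (simp add: poly_altdef sum_distrib_left sum_distrib_right mult_ac)
qed

lemma ev_swap [simp]: "ev (swap T) s u = ev T u s"
  unfolding swap_def ev_altdef[of T] by (simp add: ev_monom mult_ac)

lemma coeff_swap: "coeff (coeff (swap T) j) i = coeff (coeff T i) j"
proof -
  have "coeff (coeff (swap T) j) i =
    (\<Sum>i'\<le>degree T. \<Sum>j'\<le>degree (coeff T i'). if j' = j \<and> i' = i then coeff (coeff T i') j' else 0)"
    unfolding swap_def by (auto simp: coeff_sum intro!: sum.cong)
  also have "\<dots> = (\<Sum>i'\<le>degree T. if i' = i then coeff (coeff T i) j else 0)"
  proof (intro sum.cong refl)
    fix i'
    have "(\<Sum>j'\<le>degree (coeff T i'). if j' = j then coeff (coeff T i') j' else 0) = coeff (coeff T i') j"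
      by (auto simp: sum.delta' coeff_eq_0 not_le)
    then show "(\<Sum>j'\<le>degree (coeff T i'). if j' = j \<and> i' = i then coeff (coeff T i') j' else 0)
        = (if i' = i then coeff (coeff T i) j else 0)" by auto
  qed
  also have "\<dots> = coeff (coeff T i) j"
    by (auto simp: sum.delta' not_le coeff_eq_0)
  finally show ?thesis .
qed

text \<open>The powers of the ideal generated by \<open>x\<close> and \<open>y\<close>, through
  \<open>(x, y)\<^sup>q\<^sup>+\<^sup>1 = (y\<^sup>q\<^sup>+\<^sup>1) + x (x, y)\<^sup>q\<close>.\<close>
fun idpow :: "'r::comm_ring_1 \<Rightarrow> 'r \<Rightarrow> nat \<Rightarrow> 'r set" where
  "idpow x y 0 = UNIV"
| "idpow x y (Suc q) = {y ^ Suc q * A + x * Z |A Z. Z \<in> idpow x y q}"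

lemma idpow_0 [simp]: "0 \<in> idpow x y q"
proof (induction q)
  case (Suc q)
  then show ?case unfolding idpow.simps by (intro CollectI exI[of _ 0]) auto
qed simp

lemma idpow_add: "a \<in> idpow x y q \<Longrightarrow> b \<in> idpow x y q \<Longrightarrow> a + b \<in> idpow x y q"
proof (induction q arbitrary: a b)
  case (Suc q)
  then obtain A Z B Y where "a = y ^ Suc q * A + x * Z" "b = y ^ Suc q * B + x * Y"
    and ZY: "Z \<in> idpow x y q" "Y \<in> idpow x y q" by auto
  then have "a + b = y ^ Suc q * (A + B) + x * (Z + Y)" by (simp add: algebra_simps)
  with Suc.IH[OF ZY] show ?case unfolding idpow.simps by blast
qed simp

lemma idpow_mult: "a \<in> idpow x y q \<Longrightarrow> c * a \<in> idpow x y q"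
proof (induction q arbitrary: a)
  case (Suc q)
  then obtain A Z where "a = y ^ Suc q * A + x * Z" and Z: "Z \<in> idpow x y q" by auto
  then have "c * a = y ^ Suc q * (c * A) + x * (c * Z)" by (simp add: algebra_simps)
  with Suc.IH[OF Z] show ?case unfolding idpow.simps by blast
qed simp

lemma idpow_mult_right: "a \<in> idpow x y q \<Longrightarrow> a * c \<in> idpow x y q"
  using idpow_mult[of a x y q c] by (simp add: mult.commute)

lemma idpow_diff: "a \<in> idpow x y q \<Longrightarrow> b \<in> idpow x y q \<Longrightarrow> a - b \<in> idpow x y q"
  using idpow_add[OF _ idpow_mult[of b x y q "-1"], of a] by simp

lemma idpow_sum: "(\<And>i. i \<in> A \<Longrightarrow> f i \<in> idpow x y q) \<Longrightarrow> sum f A \<in> idpow x y q"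
  by (induction A rule: infinite_finite_induct) (auto intro: idpow_add)

lemma idpow_power_mult: "q \<le> i + j \<Longrightarrow> x ^ i * y ^ j \<in> idpow x y q"
proof (induction i arbitrary: q)
  case 0
  then show ?case
  proof (cases q)
    case (Suc p)
    have "x ^ 0 * y ^ j = y ^ Suc p * y ^ (j - Suc p) + x * 0"
      using power_add[of y "Suc p" "j - Suc p"] 0 Suc by simp
    then show ?thesis unfolding Suc idpow.simps using idpow_0 by blast
  qed simp
next
  case (Suc i)
  show ?case
  proof (cases q)
    case (Suc p)
    have "x ^ Suc i * y ^ j = y ^ Suc p * 0 + x * (x ^ i * y ^ j)" by (simp add: mult.assoc)
    moreover have "x ^ i * y ^ j \<in> idpow x y p" using Suc.IH[of p] Suc.prems Suc by simp
    ultimately show ?thesis unfolding Suc idpow.simps by blast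
  qed simp
qed

text \<open>Multiplying by x raises the exponent by one and multiplying by a power of y by its
  exponent; the recursive form of the first factor needs nothing else.\<close>

lemma idpow_mult_both:
  assumes "a \<in> idpow x y p" "b \<in> idpow x y q"
  shows "a * b \<in> idpow x y (p + q)"
  using assms
proof (induction p arbitrary: a)
  case 0
  then show ?case by (simp add: idpow_mult)
next
  case (Suc p)
  then obtain A Z where a: "a = y ^ Suc p * A + x * Z" "Z \<in> idpow x y p" by auto
  have xb: "x * c \<in> idpow x y (Suc m)" if "c \<in> idpow x y m" for c m
  proof -
    have "x * c = y ^ Suc m * 0 + x * c" by simp
    with that show ?thesis unfolding idpow.simps by blast
  qed
  have yb: "y ^ n * c \<in> idpow x y (n + m)" if "c \<in> idpow x y m" for c m n
    using that
  proof (induction m arbitrary: c)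
    case 0
    show ?case using idpow_mult_right[OF idpow_power_mult[of n 0 n x y], of c] by simp
  next
    case (Suc m)
    then obtain B Y where c: "c = y ^ Suc m * B + x * Y" "Y \<in> idpow x y m" by auto
    then have "y ^ n * c = y ^ Suc (n + m) * B + x * (y ^ n * Y)"
      by (simp add: algebra_simps power_add)
    moreover have "y ^ n * Y \<in> idpow x y (n + m)" using Suc.IH c by blast
    ultimately show ?case unfolding add_Suc_right idpow.simps by blast
  qed
  have "a * b = y ^ Suc p * (A * b) + x * (Z * b)" by (simp add: a algebra_simps)
  moreover have "y ^ Suc p * (A * b) \<in> idpow x y (Suc p + q)"
    by (rule yb) (rule idpow_mult[OF Suc.prems(2)])
  moreover have "x * (Z * b) \<in> idpow x y (Suc (p + q))"
    by (rule xb) (rule Suc.IH[OF a(2) Suc.prems(2)])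
  ultimately show ?case by (metis idpow_add add_Suc)
qed

text \<open>The last assumption says that powers of y are nonzerodivisors modulo x. Hence the
  coefficient of the pure power of y is itself divisible by x, and x can be cancelled
  throughout.\<close>

lemma idpow_cancel_x:
  fixes x y :: "'r::idom"
  assumes "x * Z \<in> idpow x y (Suc q)" "x \<noteq> 0" "\<And>n A. x dvd y ^ n * A \<Longrightarrow> x dvd A"
  shows "Z \<in> idpow x y q"
proof -
  obtain A Y where AY: "x * Z = y ^ Suc q * A + x * Y" "Y \<in> idpow x y q" using assms(1) by auto
  then have "y ^ Suc q * A = x * (Z - Y)" by (simp add: algebra_simps)
  then have "x dvd A" using assms(3) by (metis dvd_triv_left)
  then obtain B where "A = x * B" by blast
  with AY have "x * Z = x * (y ^ Suc q * B + Y)" by (simp add: algebra_simps)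
  then have "Z = y ^ Suc q * B + Y" using assms(2) mult_left_cancel by blast
  then have "Z = y ^ q * (y * B) + Y" by (simp add: algebra_simps)
  moreover have "y ^ q * (y * B) \<in> idpow x y q"
    using idpow_mult_right[OF idpow_power_mult[of q 0 q x y], of "y * B"] by simp
  ultimately show ?thesis using AY(2) idpow_add by simp
qed

text \<open>The element w is invertible modulo z, hence modulo every power of z, and the q-th power
  of z lies in the q-th power of the ideal.\<close>

lemma idpow_cancel_unit:
  assumes "w * Z \<in> idpow x y q" "w * m + z = 1" "z = x * n \<or> z = y * n"
  shows "Z \<in> idpow x y q"
proof -
  have z: "z ^ q \<in> idpow x y q"
    using assms(3) idpow_mult_right[OF idpow_power_mult[of q q 0 x y], of "n ^ q"]
      idpow_mult_right[OF idpow_power_mult[of q 0 q x y], of "n ^ q"]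
    by (auto simp: power_mult_distrib)
  have "\<exists>m'. w * m' + z ^ p = 1" for p
  proof (induction p)
    case (Suc p)
    then obtain m' where "w * m' + z ^ p = 1" by blast
    then have "w * (m' + z ^ p * m) + z ^ Suc p = (w * m' + z ^ p) + z ^ p * (w * m + z - 1)"
      by (simp add: algebra_simps)
    with \<open>w * m' + z ^ p = 1\<close> assms(2) show ?case by (metis add.right_neutral mult_zero_right right_minus_eq)
  qed (auto intro: exI[of _ 0])
  then obtain m' where m': "w * m' + z ^ q = 1" by blast
  have "Z = (w * m' + z ^ q) * Z" using m' by simp
  also have "\<dots> = m' * (w * Z) + Z * z ^ q" by (simp add: algebra_simps)
  also have "\<dots> \<in> idpow x y q" by (intro idpow_add idpow_mult assms(1) z)
  finally show ?thesis .
qed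

section \<open>Roots with multiplicity\<close>

lemma prod_powers_dvd:
  fixes p :: "'k::field poly"
  assumes "finite A" "inj_on c A" "\<And>i. i \<in> A \<Longrightarrow> [:- c i, 1:] ^ m i dvd p"
  shows "(\<Prod>i\<in>A. [:- c i, 1:] ^ m i) dvd p"
  using assms
proof (induction A rule: finite_induct)
  case (insert x A)
  then have "(\<Prod>i\<in>A. [:- c i, 1:] ^ m i) dvd p" by auto
  then obtain p' where p': "p = (\<Prod>i\<in>A. [:- c i, 1:] ^ m i) * p'" by blast
  have "[:- c x, 1:] ^ m x dvd p'"
  proof (cases "p = 0")
    case True
    then have "p' = 0" using p' insert(1) by auto
    then show ?thesis by simp
  next
    case False
    have "poly (\<Prod>i\<in>A. [:- c i, 1:] ^ m i) (c x) \<noteq> 0"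
      using insert by (auto simp: poly_prod)
    then have "order (c x) (\<Prod>i\<in>A. [:- c i, 1:] ^ m i) = 0" by (rule order_0I)
    then have "order (c x) p = order (c x) p'" using False p' by (simp add: order_mult)
    then show ?thesis using False insert.prems(2)[of x] p' by (auto simp: order_divides)
  qed
  then show ?case using insert p' by (simp add: mult.commute mult_dvd_mono)
qed simp

text \<open>Counted with multiplicity there are \<open>sum m A\<close> roots, while the degree is
  smaller than that.\<close>

lemma poly_eq_0_many_roots:
  fixes p :: "'k::field poly"
  assumes "finite A" "inj_on c A" "\<And>i. i \<in> A \<Longrightarrow> [:- c i, 1:] ^ m i dvd p"
    "\<And>j. sum m A \<le> j \<Longrightarrow> coeff p j = 0"
  shows "p = 0"
proof (rule ccontr)
  assume p: "p \<noteq> 0"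
  have "(\<Prod>i\<in>A. [:- c i, 1:] ^ m i) dvd p" by (rule prod_powers_dvd[OF assms(1-3)])
  then have "degree (\<Prod>i\<in>A. [:- c i, 1:] ^ m i) \<le> degree p" using p dvd_imp_degree_le by blast
  also have "degree (\<Prod>i\<in>A. [:- c i, 1:] ^ m i) = sum m A"
    by (subst degree_prod_eq_sum_degree) (auto simp: degree_power_eq)
  finally show False using assms(4)[of "degree p"] p by (simp add: leading_coeff_0_iff)
qed

section \<open>Symmetric polynomials vanishing to high order at a planar grid\<close>

text \<open>The coefficients belong to 1, u, s and su: this is a linear form on the ambient space
  restricted to the quadric, that is, a plane section.\<close>

definition biform :: "'k::comm_ring_1 \<Rightarrow> 'k \<Rightarrow> 'k \<Rightarrow> 'k \<Rightarrow> 'k poly poly" where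
  "biform A B C D = [:[:A, B:], [:C, D:]:]"

lemma ev_biform [simp]: "ev (biform A B C D) s u = A + B * u + C * s + D * s * u"
  by (simp add: ev_def biform_def algebra_simps)

lemma bdeg_biform: "bdeg (biform A B C D) (Suc 1)"
proof -
  have "degree [:[:A, B:], [:C, D:]:] \<le> 1" by (simp add: degree_pCons_eq_if)
  moreover have "degree (coeff [:[:A, B:], [:C, D:]:] i) \<le> 1" for i
    by (cases i; cases "i - 1") (simp_all add: degree_pCons_eq_if)
  ultimately show ?thesis unfolding biform_def bdeg_Suc by blast
qed

text \<open>The product (s - c)(u - c), written as a plane section: the tangent at (c, c) to the
  conic s = u in the projected plane.\<close>

definition sline :: "'k::comm_ring_1 \<Rightarrow> 'k poly poly" where
  "sline c = biform (c\<^sup>2) (- c) (- c) 1"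

text \<open>The chord of the conic s = u through (c, c) and (d, d).\<close>

definition schord :: "'k::comm_ring_1 \<Rightarrow> 'k \<Rightarrow> 'k poly poly" where
  "schord c d = biform (2 * c * d) (- (c + d)) (- (c + d)) 2"

lemma ev_sline [simp]: "ev (sline c) s u = (s - c) * (u - c)"
  by (simp add: sline_def algebra_simps power2_eq_square)

lemma ev_schord_same [simp]: "ev (schord c d) c c = 0" "ev (schord c d) d d = 0"
  by (simp_all add: schord_def algebra_simps)

lemma ev_schord_diff: "ev (schord c d) c d = - ((c - d)\<^sup>2)" "ev (schord c d) d c = - ((c - d)\<^sup>2)"
  by (simp_all add: schord_def algebra_simps power2_eq_square)

definition svar :: "'k::comm_ring_1 \<Rightarrow> 'k poly poly" where
  "svar c = [:[:- c:], 1:]"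

definition uvar :: "'k::comm_ring_1 \<Rightarrow> 'k poly poly" where
  "uvar c = [:[:- c, 1:]:]"

lemma sline_eq: "sline c = svar c * uvar c"
  by (simp add: sline_def svar_def uvar_def biform_def power2_eq_square)

lemma poly_svar [simp]: "poly (svar c) [:s:] = [:s - c:]"
  by (simp add: svar_def)

lemma poly_uvar [simp]: "poly (uvar c) p = [:- c, 1:]"
  by (simp add: uvar_def)

lemma ev_svar [simp]: "ev (svar c) s u = s - c" and ev_uvar [simp]: "ev (uvar c) s u = u - c"
  by (simp_all add: ev_def)

lemma poly_idpow_root:
  "T \<in> idpow (svar s) (uvar v) q \<Longrightarrow> [:- v, 1:] ^ q dvd poly T [:s:]"
  by (cases q) auto

lemma svar_dvd_iff: "svar s dvd p \<longleftrightarrow> poly p [:s:] = 0"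
  using poly_eq_0_iff_dvd[of p "[:s:]"] by (simp add: svar_def)

abbreviation ptpow :: "'k::field_char_0 \<Rightarrow> 'k \<Rightarrow> nat \<Rightarrow> 'k poly poly set" where
  "ptpow s v q \<equiv> idpow (svar s) (uvar v) q"

text \<open>Dividing by a local parameter lowers the order by one: for fixed s the other parameter
  stays nonzero, which is the regularity required by \<open>idpow_cancel_x\<close>.\<close>

lemma ptpow_cancel_s:
  assumes "svar s * Z \<in> ptpow s v (Suc q)"
  shows "Z \<in> ptpow s v q"
proof (rule idpow_cancel_x[OF assms])
  show "svar s \<noteq> 0" by (simp add: svar_def)
  fix n A assume "svar s dvd uvar v ^ n * A"
  then show "svar s dvd A" by (simp add: svar_dvd_iff)
qed

text \<open>Away from its zero the factor is a local unit: two different shifts of one variable have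
  a constant difference.\<close>

lemma ptpow_cancel_svar:
  assumes "svar c * Z \<in> ptpow s v q" "c \<noteq> s"
  shows "Z \<in> ptpow s v q"
proof (rule idpow_cancel_unit[OF assms(1)])
  show "svar c * [:[:1 / (s - c):]:] + svar s * [:[:- 1 / (s - c):]:] = 1"
    using assms(2) by (simp add: svar_def one_pCons flip: diff_divide_distrib)
qed (rule disjI1, rule refl)

lemma ptpow_cancel_uvar:
  assumes "uvar c * Z \<in> ptpow s v q" "c \<noteq> v"
  shows "Z \<in> ptpow s v q"
proof (rule idpow_cancel_unit[OF assms(1)])
  show "uvar c * [:[:1 / (v - c):]:] + uvar v * [:[:- 1 / (v - c):]:] = 1"
    using assms(2) by (simp add: uvar_def one_pCons flip: diff_divide_distrib)
qed (rule disjI2, rule refl)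

lemma ptpow_cancel_prod:
  assumes "finite A" "\<And>i. i \<in> A \<Longrightarrow> c i \<noteq> s" "\<And>i. i \<in> A \<Longrightarrow> c i \<noteq> v"
    "(\<Prod>i\<in>A. sline (c i)) * Z \<in> ptpow s v q"
  shows "Z \<in> ptpow s v q"
  using assms
proof (induction A arbitrary: Z rule: finite_induct)
  case (insert x A)
  then have "svar (c x) * (uvar (c x) * ((\<Prod>i\<in>A. sline (c i)) * Z)) \<in> ptpow s v q"
    by (simp add: sline_eq mult_ac)
  then have "uvar (c x) * ((\<Prod>i\<in>A. sline (c i)) * Z) \<in> ptpow s v q"
    by (rule ptpow_cancel_svar) (simp add: insert.prems(1))
  then have "(\<Prod>i\<in>A. sline (c i)) * Z \<in> ptpow s v q"
    by (rule ptpow_cancel_uvar) (simp add: insert.prems(2))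
  then show ?case by (rule insert.IH[rotated -1]) (simp_all add: insert.prems)
qed simp

lemma swap_eqI:
  fixes T :: "'k::field_char_0 poly poly"
  shows "(\<And>s u. ev T s u = ev T u s) \<Longrightarrow> swap T = T"
  by (intro ev_ext) simp

lemma swap_eqD: "swap T = T \<Longrightarrow> ev T s u = ev T u s"
  by (metis ev_swap)

text \<open>The three conditions on the scalars make the 2a tangent lines distinct;
  \<open>ne\<close> also keeps the grid points off the branch curve s = u.\<close>

locale grid_nodes =
  fixes \<sigma> \<upsilon> :: "nat \<Rightarrow> 'k::field_char_0" and a r :: nat
  assumes inj_s: "inj_on \<sigma> {..<a}" and inj_v: "inj_on \<upsilon> {..<a}"
    and ne: "\<And>i j. i < a \<Longrightarrow> j < a \<Longrightarrow> \<sigma> i \<noteq> \<upsilon> j"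
    and ra: "r < a"
begin

lemma s_eq_iff: "i < a \<Longrightarrow> j < a \<Longrightarrow> \<sigma> i = \<sigma> j \<longleftrightarrow> i = j"
  using inj_s by (auto simp: inj_on_def)

definition FF :: "'k poly poly" where "FF = (\<Prod>k<a. sline (\<sigma> k))"
definition GG :: "'k poly poly" where "GG = (\<Prod>k<a. sline (\<upsilon> k))"

text \<open>\<open>HH k l\<close> vanishes at all pairs \<open>(\<sigma> m, \<sigma> n)\<close> of the first \<open>r\<close> nodes except \<open>{m, n} = {k, l}\<close>; for
  \<open>k \<noteq> l\<close> the chord removes the two diagonal points.\<close>
definition HH :: "nat \<Rightarrow> nat \<Rightarrow> 'k poly poly" where
  "HH k l = (\<Prod>m\<in>{..<r} - {k, l}. sline (\<sigma> m)) * (if k = l then 1 else schord (\<sigma> k) (\<sigma> l))"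

text \<open>Only the points (\<open>\<sigma> i\<close>, \<open>\<upsilon> j\<close>) are listed;
  together with the symmetry in \<open>VV\<close> this covers their mirror images.\<close>

definition ords :: "nat \<Rightarrow> 'k poly poly \<Rightarrow> bool" where
  "ords q T \<longleftrightarrow> (\<forall>i<a. \<forall>j<a. T \<in> ptpow (\<sigma> i) (\<upsilon> j) q)"

text \<open>The plane curves of degree \<open>n - 1\<close> with \<open>q\<close>-fold points at the projected grid, pulled back
  to the quadric.\<close>
definition VV :: "nat \<Rightarrow> nat \<Rightarrow> 'k poly poly \<Rightarrow> bool" where
  "VV n q T \<longleftrightarrow> bdeg T n \<and> swap T = T \<and> ords q T"

text \<open>On the line s = \<open>\<sigma> k\<close> there are a zeros of order q at the nodes
  \<open>\<upsilon> i\<close> and r further zeros at the first nodes \<open>\<sigma> l\<close>, in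
  total a q + r, which exceeds the degree.\<close>

lemma vanish:
  assumes T: "VV (a * q + r) q T" and z: "\<And>k l. k < r \<Longrightarrow> l < r \<Longrightarrow> ev T (\<sigma> k) (\<sigma> l) = 0"
    and k: "k < a"
  shows "poly T [:\<sigma> k:] = 0"
proof -
  have *: "poly T [:\<sigma> k:] = 0" if k: "k < a" and z: "\<And>l. l < r \<Longrightarrow> ev T (\<sigma> k) (\<sigma> l) = 0" for k
  proof -
    \<comment> \<open>Both kinds of zeros in one family: indices below a are the q-fold ones, the r
      indices from a on are the simple ones.\<close>
    define c m where "c = (\<lambda>i. if i < a then \<upsilon> i else \<sigma> (i - a))"
      and "m = (\<lambda>i. if i < a then q else 1)"
    show ?thesis
    proof (rule poly_eq_0_many_roots[of "{..<a + r}" c m])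
      show "inj_on c {..<a + r}"
      proof (rule inj_onI)
        fix i j assume ij: "i \<in> {..<a + r}" "j \<in> {..<a + r}" "c i = c j"
        consider "i < a" "j < a" | "i < a" "\<not> j < a" | "\<not> i < a" "j < a" | "\<not> i < a" "\<not> j < a" by blast
        then show "i = j"
        proof cases
          case 1
          then show ?thesis using ij inj_v by (auto simp: c_def inj_on_def)
        next
          case 2
          then have "j - a < a" using ij ra by auto
          then show ?thesis using 2 ij ne[of "j - a" i] by (auto simp: c_def)
        next
          case 3
          then have "i - a < a" using ij ra by auto
          then show ?thesis using 3 ij ne[of "i - a" j] by (auto simp: c_def)
        next
          case 4
          then have "i - a < a" "j - a < a" using ij ra by auto
          then have "i - a = j - a" using 4 ij s_eq_iff[of "i - a" "j - a"] by (auto simp: c_def)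
          then show ?thesis using 4 by linarith
        qed
      qed
      show "[:- c i, 1:] ^ m i dvd poly T [:\<sigma> k:]" if "i \<in> {..<a + r}" for i
      proof (cases "i < a")
        case True
        then have "T \<in> ptpow (\<sigma> k) (\<upsilon> i) q" using T k by (simp add: VV_def ords_def)
        then show ?thesis using poly_idpow_root True by (simp add: c_def m_def)
      next
        case False
        then have "poly (poly T [:\<sigma> k:]) (\<sigma> (i - a)) = 0" using z[of "i - a"] that by (simp add: ev_def)
        then show ?thesis using False by (simp add: c_def m_def poly_eq_0_iff_dvd)
      qed
      show "coeff (poly T [:\<sigma> k:]) j = 0" if "sum m {..<a + r} \<le> j" for j
      proof -
        have "sum m {..<a + r} = sum m {..<a} + sum m {a..<a + r}"
          by (metis le_add1 lessThan_atLeast0 sum.atLeastLessThan_concat zero_le)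
        also have "\<dots> = a * q + r" by (simp add: m_def)
        finally have j: "a * q + r \<le> j" using that by simp
        show ?thesis by (rule bdeg_poly_const[OF _ j]) (use T in \<open>simp add: VV_def\<close>)
      qed
    qed simp
  qed
  \<comment> \<open>The hypothesis settles only the first r lines; symmetry then supplies the r
    simple zeros on every other line.\<close>
  have 1: "poly T [:\<sigma> l:] = 0" if "l < r" for l using * z that ra by auto
  have "ev T (\<sigma> k) (\<sigma> l) = 0" if "l < r" for l
    using swap_eqD[of T "\<sigma> k" "\<sigma> l"] T 1[OF that] by (simp add: VV_def ev_def)
  then show ?thesis using * k by blast
qed

text \<open>Vanishing on the lines s = \<open>\<sigma> k\<close> gives the factors in s. Those in u
  follow from symmetry, as the factors in s are nonzero for almost all s.\<close>

lemma divide_FF: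
  assumes T: "bdeg T n" "swap T = T" and z: "\<And>k. k < a \<Longrightarrow> poly T [:\<sigma> k:] = 0"
  shows "\<exists>T'. T = FF * T' \<and> bdeg T' (n - a) \<and> swap T' = T'"
proof -
  define fs where "fs = (\<Prod>k<a. svar (\<sigma> k))"
  define fu where "fu = (\<Prod>k<a. [:- \<sigma> k, 1:])"
  have FF: "FF = fs * [:fu:]"
  proof -
    have "(\<Prod>k<m. uvar (\<sigma> k)) = [:\<Prod>k<m. [:- \<sigma> k, 1:]:]" for m
      by (induction m) (simp_all add: uvar_def one_pCons mult.commute)
    then show ?thesis by (simp add: FF_def sline_eq prod.distrib fs_def fu_def)
  qed
  have dvd_fs: "\<exists>Q. T = (\<Prod>k<m. svar (\<sigma> k)) * Q" if "m \<le> a" for m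
    using that
  proof (induction m)
    case (Suc m)
    then obtain Q where Q: "T = (\<Prod>k<m. svar (\<sigma> k)) * Q" by auto
    have "poly (\<Prod>k<m. svar (\<sigma> k)) [:\<sigma> m:] \<noteq> 0"
      using Suc s_eq_iff by (auto simp: poly_prod)
    then have "poly Q [:\<sigma> m:] = 0" using z[of m] Suc Q by simp
    then obtain Q' where "Q = svar (\<sigma> m) * Q'" by (auto simp: svar_def poly_eq_0_iff_dvd elim: dvdE)
    then show ?case using Q by (auto simp: mult_ac)
  qed auto
  then obtain Q where Q: "T = fs * Q" unfolding fs_def by blast
  have "fu dvd coeff Q i" for i
  proof -
    have "poly (coeff Q i) (\<sigma> k) = 0" if k: "k < a" for k
    proof -
      \<comment> \<open>The restriction of \<open>Q\<close> to the line u =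
        \<open>\<sigma> k\<close>, a polynomial in s.\<close>
      define Qk where "Qk = map_poly (\<lambda>p. poly p (\<sigma> k)) Q"
      have Qk: "poly Qk s = ev Q s (\<sigma> k)" for s
        unfolding Qk_def ev_def by (induction Q) (simp_all add: map_poly_pCons)
      have "Qk = 0"
      proof (rule poly_eq_0_infinite)
        show "infinite (UNIV - \<sigma> ` {..<a})" using infinite_UNIV_char_0 by (intro Diff_infinite_finite) auto
        fix s assume s: "s \<in> UNIV - \<sigma> ` {..<a}"
        have "ev T s (\<sigma> k) = ev T (\<sigma> k) s" using T(2) by (rule swap_eqD)
        also have "\<dots> = 0" using z k by (simp add: ev_def)
        finally have "(\<Prod>k<a. s - \<sigma> k) * ev Q s (\<sigma> k) = 0" by (simp add: Q fs_def)
        then show "poly Qk s = 0" using s by (auto simp: Qk)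
      qed
      then have "coeff Qk i = 0" by simp
      then show ?thesis by (simp add: Qk_def coeff_map_poly)
    qed
    then show ?thesis
      using prod_powers_dvd[of "{..<a}" \<sigma> "\<lambda>_. 1" "coeff Q i"] inj_s
      by (simp add: fu_def poly_eq_0_iff_dvd)
  qed
  then have "[:fu:] dvd Q" by (simp add: const_poly_dvd_iff)
  then obtain T' where T': "Q = [:fu:] * T'" by blast
  have TT: "T = FF * T'" using Q T' FF by (simp add: mult_ac)
  have FF0: "FF \<noteq> 0" by (simp add: FF_def sline_eq svar_def uvar_def)
  have "FF * swap T' = FF * T'"
  proof (rule ev_ext)
    fix s u
    have "ev FF s u = ev FF u s" by (simp add: FF_def mult.commute)
    then show "ev (FF * swap T') s u = ev (FF * T') s u"
      using swap_eqD[OF T(2), of s u] unfolding TT ev_simps ev_swap by metis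
  qed
  then have sw: "swap T' = T'" using FF0 by simp
  have deg: "coeff T' i = 0" if "n - a \<le> i" for i
  proof (rule ccontr)
    assume i: "coeff T' i \<noteq> 0"
    then have "T' \<noteq> 0" by auto
    have dFF: "degree FF = a"
    proof -
      have "degree fs = (\<Sum>k<a. degree (svar (\<sigma> k)))"
        unfolding fs_def by (rule degree_prod_eq_sum_degree) (simp add: svar_def)
      moreover have "[:fu:] \<noteq> 0" by (simp add: fu_def)
      moreover have "fs \<noteq> 0" by (simp add: fs_def svar_def)
      ultimately show ?thesis unfolding FF by (simp add: degree_mult_eq svar_def)
    qed
    have "degree T = a + degree T'" using FF0 \<open>T' \<noteq> 0\<close> dFF by (simp add: TT degree_mult_eq)
    moreover have "i \<le> degree T'" using i by (rule le_degree)
    ultimately have "n \<le> degree T" using that by linarith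
    then have "coeff T (degree T) = 0" using T(1) by (intro poly_eqI) (simp add: bdeg_def)
    then have "T = 0" by (simp add: leading_coeff_0_iff)
    then show False using TT FF0 \<open>T' \<noteq> 0\<close> by simp
  qed
  \<comment> \<open>So far only the degree in s is bounded; symmetry of \<open>T'\<close> transfers
    the bound to u.\<close>
  then have "coeff (coeff T' j) i = 0" if "n - a \<le> i" for i j
    using coeff_swap[of T' i j] sw that by simp
  with deg have "bdeg T' (n - a)" by (auto simp: bdeg_def)
  then show ?thesis using TT sw by blast
qed

text \<open>At a grid point exactly one factor of \<open>FF\<close> vanishes, the local parameter in
  s. It costs one order, and by \<open>ne\<close> and injectivity all other factors are units
  there.\<close>

lemma ords_divide:
  assumes "ords (Suc q) (FF * T)"
  shows "ords q T"
  unfolding ords_def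
proof (intro allI impI)
  fix i j assume ij: "i < a" "j < a"
  have FF: "FF = sline (\<sigma> i) * (\<Prod>k\<in>{..<a} - {i}. sline (\<sigma> k))"
    unfolding FF_def using ij by (simp add: prod.remove)
  have "svar (\<sigma> i) * (uvar (\<sigma> i) * ((\<Prod>k\<in>{..<a} - {i}. sline (\<sigma> k)) * T)) \<in> ptpow (\<sigma> i) (\<upsilon> j) (Suc q)"
    using assms ij unfolding ords_def FF sline_eq[of "\<sigma> i"] by (simp only: mult.assoc)
  then have "uvar (\<sigma> i) * ((\<Prod>k\<in>{..<a} - {i}. sline (\<sigma> k)) * T) \<in> ptpow (\<sigma> i) (\<upsilon> j) q"
    by (rule ptpow_cancel_s)
  then have "(\<Prod>k\<in>{..<a} - {i}. sline (\<sigma> k)) * T \<in> ptpow (\<sigma> i) (\<upsilon> j) q"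
    by (rule ptpow_cancel_uvar) (use ne ij in auto)
  then show "T \<in> ptpow (\<sigma> i) (\<upsilon> j) q"
    by (rule ptpow_cancel_prod[of "{..<a} - {i}" \<sigma>, rotated -1]) (use ne ij s_eq_iff in auto)
qed

section \<open>A basis of the symmetric polynomials with q-fold points\<close>

definition Idx :: "nat \<Rightarrow> (nat \<times> nat \<times> nat) set" where
  "Idx q = {(i, k, l). i \<le> q \<and> k \<le> l \<and> l < r}"

definition Bas :: "nat \<Rightarrow> nat \<times> nat \<times> nat \<Rightarrow> 'k poly poly" where
  "Bas q = (\<lambda>(i, k, l). FF ^ i * GG ^ (q - i) * HH k l)"

text \<open>Unordered pairs with repetition among r nodes: they index an interpolation basis
  \<open>HH\<close> of the plane forms of degree r - 1.\<close>

definition Pairs :: "(nat \<times> nat) set" where "Pairs = {(k, l). k \<le> l \<and> l < r}"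

lemma finite_Pairs: "finite Pairs"
  by (rule finite_subset[of _ "{..<r} \<times> {..<r}"]) (auto simp: Pairs_def)

lemma Idx_eq: "Idx q = {..q} \<times> Pairs"
  by (auto simp: Idx_def Pairs_def)

lemma finite_Idx: "finite (Idx q)"
  by (simp add: Idx_eq finite_Pairs)

lemma card_Pairs: "card Pairs = (r + 1) choose 2"
proof -
  have "Pairs = (\<lambda>(l, k). (k, l)) ` (SIGMA l:{..<r}. {..l})"
    by (auto simp: Pairs_def image_iff)
  moreover have "inj_on (\<lambda>(l, k). (k, l)) (SIGMA l:{..<r}. {..l})" by (auto simp: inj_on_def)
  ultimately have "card Pairs = (\<Sum>l<r. Suc l)" by (simp add: card_image)
  also have "\<dots> = (r + 1) choose 2"
    by (induction r) (simp_all add: numeral_2_eq_2)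
  finally show ?thesis .
qed

lemma card_Idx: "card (Idx q) = (q + 1) * ((r + 1) choose 2)"
  by (simp add: Idx_eq card_cartesian_product card_Pairs)

lemma HH_ev:
  assumes "k \<le> l" "l < r" "m \<le> n" "n < r"
  shows "ev (HH k l) (\<sigma> m) (\<sigma> n) \<noteq> 0 \<longleftrightarrow> m = k \<and> n = l"
proof (cases "m \<in> {k, l} \<and> n \<in> {k, l}")
  case True
  have "(\<Prod>x\<in>{..<r} - {k, l}. (\<sigma> m - \<sigma> x) * (\<sigma> n - \<sigma> x)) \<noteq> 0"
    using True assms ra s_eq_iff by auto
  then show ?thesis using True assms ra s_eq_iff by (auto simp: HH_def ev_schord_diff)
next
  case False
  then have "(\<Prod>x\<in>{..<r} - {k, l}. (\<sigma> m - \<sigma> x) * (\<sigma> n - \<sigma> x)) = 0"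
    using assms by (intro prod_zero) auto
  then show ?thesis using False assms by (auto simp: HH_def)
qed

lemma HH_sym: "ev (HH k l) s u = ev (HH k l) u s"
  by (simp add: HH_def schord_def mult_ac add_ac)

lemma FF_sym: "ev FF s u = ev FF u s" and GG_sym: "ev GG s u = ev GG u s"
  by (simp_all add: FF_def GG_def mult.commute)

lemma FF_zero: "k < a \<Longrightarrow> ev FF (\<sigma> k) u = 0"
  by (auto simp: FF_def)

lemma GG_nonzero: "k < a \<Longrightarrow> l < a \<Longrightarrow> ev GG (\<sigma> k) (\<sigma> l) \<noteq> 0"
  using ne by (auto simp: GG_def)

lemma bdeg_sline: "bdeg (sline c) (Suc 1)"
  unfolding sline_def by (rule bdeg_biform)

lemma bdeg_FF: "bdeg FF (Suc a)" and bdeg_GG: "bdeg GG (Suc a)"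
  using bdeg_prod[of "{..<a}" "\<lambda>k. sline (\<sigma> k)" "\<lambda>_. 1", OF _ bdeg_sline]
    bdeg_prod[of "{..<a}" "\<lambda>k. sline (\<upsilon> k)" "\<lambda>_. 1", OF _ bdeg_sline] by (simp_all add: FF_def GG_def)

lemma bdeg_HH:
  assumes "k \<le> l" "l < r"
  shows "bdeg (HH k l) (Suc (r - 1))"
proof -
  have "bdeg (\<Prod>m\<in>{..<r} - {k, l}. sline (\<sigma> m)) (Suc (card ({..<r} - {k, l})))"
    using bdeg_prod[of "{..<r} - {k, l}" "\<lambda>k. sline (\<sigma> k)" "\<lambda>_. 1", OF _ bdeg_sline] by simp
  moreover have "card ({..<r} - {k, l}) = r - card {k, l}"
    using assms by (subst card_Diff_subset) auto
  \<comment> \<open>One tangent is omitted if k = l; otherwise two are omitted and the chord adds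
    one degree back.\<close>
  moreover have "r - card {k, l} + (if k = l then 0 else 1) = r - 1" using assms by auto
  moreover have "bdeg (if k = l then 1 else schord (\<sigma> k) (\<sigma> l)) (Suc (if k = l then 0 else 1))"
    by (simp add: schord_def bdeg_biform[unfolded One_nat_def])
  ultimately show ?thesis unfolding HH_def using bdeg_mult by metis
qed

lemma ords_mult: "ords p S \<Longrightarrow> ords q T \<Longrightarrow> ords (p + q) (S * T)"
  by (simp add: ords_def idpow_mult_both)

lemma ords_0: "ords 0 T"
  by (simp add: ords_def)

lemma ords_FF: "ords 1 FF"
  unfolding ords_def
proof (intro allI impI)
  fix i j assume "i < a" "j < a"
  then have "FF = svar (\<sigma> i) ^ 1 * uvar (\<upsilon> j) ^ 0 * (uvar (\<sigma> i) * (\<Prod>k\<in>{..<a} - {i}. sline (\<sigma> k)))"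
    unfolding FF_def by (simp add: prod.remove[of _ i] sline_eq mult_ac)
  then show "FF \<in> ptpow (\<sigma> i) (\<upsilon> j) 1"
    using idpow_mult_right[OF idpow_power_mult[of 1 1 0]] by simp
qed

lemma ords_GG: "ords 1 GG"
  unfolding ords_def
proof (intro allI impI)
  fix i j assume "i < a" "j < a"
  then have "GG = svar (\<sigma> i) ^ 0 * uvar (\<upsilon> j) ^ 1 * (svar (\<upsilon> j) * (\<Prod>k\<in>{..<a} - {j}. sline (\<upsilon> k)))"
    unfolding GG_def by (simp add: prod.remove[of _ j] sline_eq mult_ac)
  then show "GG \<in> ptpow (\<sigma> i) (\<upsilon> j) 1"
    using idpow_mult_right[OF idpow_power_mult[of 1 0 1]] by simp
qed

lemma ords_power: "ords 1 T \<Longrightarrow> ords n (T ^ n)"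
  by (induction n) (use ords_mult[of 1 T] in \<open>auto simp: ords_0\<close>)

lemma VV_Bas:
  assumes "x \<in> Idx q"
  shows "VV (a * q + r) q (Bas q x)"
proof -
  obtain i k l where x: "x = (i, k, l)" and ikl: "i \<le> q" "k \<le> l" "l < r"
    using assms by (auto simp: Idx_def)
  have "bdeg (FF ^ i * GG ^ (q - i) * HH k l) (Suc (i * a + (q - i) * a + (r - 1)))"
    by (intro bdeg_mult bdeg_power bdeg_FF bdeg_GG bdeg_HH ikl)
  moreover have "i * a + (q - i) * a = a * q"
    using ikl by (metis add_mult_distrib le_add_diff_inverse mult.commute)
  then have "Suc (i * a + (q - i) * a + (r - 1)) = a * q + r" using ikl by simp
  moreover have "ords (i + (q - i) + 0) (FF ^ i * GG ^ (q - i) * HH k l)"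
    by (intro ords_mult ords_power ords_FF ords_GG ords_0)
  moreover have "swap (FF ^ i * GG ^ (q - i) * HH k l) = FF ^ i * GG ^ (q - i) * HH k l"
  proof (rule swap_eqI)
    fix s u
    show "ev (FF ^ i * GG ^ (q - i) * HH k l) s u = ev (FF ^ i * GG ^ (q - i) * HH k l) u s"
      using FF_sym[of s u] GG_sym[of s u] HH_sym[of k l s u] by simp
  qed
  ultimately show ?thesis using ikl by (simp add: VV_def Bas_def x)
qed

lemma VV_diff: "VV n q S \<Longrightarrow> VV n q T \<Longrightarrow> VV n q (S - T)"
  unfolding VV_def ords_def using swap_eqD[of S] swap_eqD[of T]
  by (auto intro!: bdeg_diff idpow_diff swap_eqI)

lemma VV_sum: "(\<And>x. x \<in> A \<Longrightarrow> VV n q (f x)) \<Longrightarrow> VV n q (sum f A)"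
proof -
  assume *: "\<And>x. x \<in> A \<Longrightarrow> VV n q (f x)"
  then have "swap (sum f A) = sum f A"
    by (intro swap_eqI) (auto simp: VV_def intro!: sum.cong swap_eqD)
  with * show ?thesis unfolding VV_def ords_def by (auto intro!: bdeg_sum idpow_sum)
qed

lemma VV_const: "VV n q T \<Longrightarrow> VV n q ([:[:c:]:] * T)"
  unfolding VV_def ords_def using swap_eqD[of T]
  by (auto intro!: bdeg_const_mult idpow_mult swap_eqI simp del: mult_pCons_left)

text \<open>The terms without \<open>FF\<close> are split off; the remaining ones, with i shifted,
  are \<open>FF\<close> times the family for q. Both inductions below run on this splitting.\<close>

lemma sum_Idx_Suc:
  fixes h :: "nat \<times> nat \<times> nat \<Rightarrow> 'b::comm_monoid_add"
  shows "sum h (Idx (Suc q)) = (\<Sum>(k, l)\<in>Pairs. h (0, k, l)) + (\<Sum>(i, k, l)\<in>Idx q. h (Suc i, k, l))"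
proof -
  have "sum h (Idx (Suc q)) = (\<Sum>i\<le>Suc q. \<Sum>(k, l)\<in>Pairs. h (i, k, l))"
    unfolding Idx_eq by (simp add: sum.cartesian_product case_prod_unfold)
  also have "\<dots> = (\<Sum>(k, l)\<in>Pairs. h (0, k, l)) + (\<Sum>i\<le>q. \<Sum>(k, l)\<in>Pairs. h (Suc i, k, l))"
    by (rule sum.atMost_Suc_shift)
  also have "(\<Sum>i\<le>q. \<Sum>(k, l)\<in>Pairs. h (Suc i, k, l)) = (\<Sum>(i, k, l)\<in>Idx q. h (Suc i, k, l))"
    unfolding Idx_eq by (simp add: sum.cartesian_product case_prod_unfold)
  finally show ?thesis .
qed

lemma sum_Idx_0:
  fixes h :: "nat \<times> nat \<times> nat \<Rightarrow> 'b::comm_monoid_add"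
  shows "sum h (Idx 0) = (\<Sum>(k, l)\<in>Pairs. h (0, k, l))"
proof -
  have "Idx 0 = Pair 0 ` Pairs" by (auto simp: Idx_eq)
  then show ?thesis by (simp add: sum.reindex inj_on_def case_prod_unfold)
qed

lemma Bas_Suc: "Bas (Suc q) (Suc i, k, l) = FF * Bas q (i, k, l)"
  by (simp add: Bas_def mult_ac)

text \<open>At pairs of the first r nodes the polynomials \<open>HH\<close> form a Lagrange system
  and \<open>GG\<close> is nonzero, so the coefficients of the terms without \<open>FF\<close> can
  be read off from values.\<close>

lemma level0_ev:
  assumes "(m, n) \<in> Pairs"
  shows "ev (\<Sum>(k, l)\<in>Pairs. [:[:c (0, k, l):]:] * Bas q (0, k, l)) (\<sigma> m) (\<sigma> n)
    = c (0, m, n) * ev GG (\<sigma> m) (\<sigma> n) ^ q * ev (HH m n) (\<sigma> m) (\<sigma> n)"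
proof -
  have "ev (\<Sum>(k, l)\<in>Pairs. [:[:c (0, k, l):]:] * Bas q (0, k, l)) (\<sigma> m) (\<sigma> n)
    = (\<Sum>p\<in>Pairs. if p = (m, n) then c (0, m, n) * ev GG (\<sigma> m) (\<sigma> n) ^ q * ev (HH m n) (\<sigma> m) (\<sigma> n) else 0)"
    unfolding ev_sum
  proof (intro sum.cong refl)
    fix p assume p: "p \<in> Pairs"
    obtain k l where [simp]: "p = (k, l)" by fastforce
    show "ev (case p of (k, l) \<Rightarrow> [:[:c (0, k, l):]:] * Bas q (0, k, l)) (\<sigma> m) (\<sigma> n) =
      (if p = (m, n) then c (0, m, n) * ev GG (\<sigma> m) (\<sigma> n) ^ q * ev (HH m n) (\<sigma> m) (\<sigma> n) else 0)"
      using HH_ev[of k l m n] p assms by (auto simp: Bas_def Pairs_def simp del: mult_pCons_left)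
  qed
  then show ?thesis using assms finite_Pairs by (simp add: sum.delta)
qed

text \<open>Subtracting the terms without \<open>FF\<close> that interpolate T at the pairs of the
  first r nodes makes it vanish on all lines of \<open>FF\<close>; the quotient by \<open>FF\<close>
  belongs to the case q - 1.\<close>

theorem VV_span:
  "VV (a * q + r) q T \<Longrightarrow> \<exists>c. T = (\<Sum>x\<in>Idx q. [:[:c x:]:] * Bas q x)"
proof (induction q arbitrary: T)
  case (0 T)
  \<comment> \<open>The interpolating coefficients given by \<open>level0_ev\<close>; the
    denominators are nonzero by \<open>HH_ev\<close>.\<close>
  define c where "c = (\<lambda>(i::nat, k, l). ev T (\<sigma> k) (\<sigma> l) / (ev GG (\<sigma> k) (\<sigma> l) ^ 0 * ev (HH k l) (\<sigma> k) (\<sigma> l)))"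
  define T1 where "T1 = T - (\<Sum>x\<in>Idx 0. [:[:c x:]:] * Bas 0 x)"
  have V1: "VV (a * 0 + r) 0 T1" unfolding T1_def by (intro VV_diff 0 VV_sum VV_const VV_Bas)
  have z: "ev T1 (\<sigma> m) (\<sigma> n) = 0" if "(m, n) \<in> Pairs" for m n
  proof -
    have "ev (HH m n) (\<sigma> m) (\<sigma> n) \<noteq> 0" using HH_ev[of m n m n] that by (simp add: Pairs_def)
    then show ?thesis using level0_ev[OF that, of c 0] unfolding T1_def sum_Idx_0
      by (simp add: c_def case_prod_unfold)
  qed
  have z': "ev T1 (\<sigma> m) (\<sigma> n) = 0" if "m < r" "n < r" for m n
    using z[of m n] z[of n m] that swap_eqD[of T1 "\<sigma> m" "\<sigma> n"] V1
    by (cases "m \<le> n") (auto simp: Pairs_def VV_def)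
  have "\<exists>T'. T1 = FF * T' \<and> bdeg T' (a * 0 + r - a) \<and> swap T' = T'"
    using V1 vanish[OF V1 z'] by (intro divide_FF) (auto simp: VV_def)
  then obtain T' where T': "T1 = FF * T'" "bdeg T' (a * 0 + r - a)" by blast
  \<comment> \<open>Since r < a, the degree bound r - a is truncated to 0.\<close>
  have "T' = 0" using T'(2) ra by (intro poly_eqI) (simp add: bdeg_def)
  then have "T1 = 0" using T'(1) by simp
  then show ?case unfolding T1_def by auto
next
  case (Suc q T)
  define c where "c = (\<lambda>(i::nat, k, l). ev T (\<sigma> k) (\<sigma> l) / (ev GG (\<sigma> k) (\<sigma> l) ^ Suc q * ev (HH k l) (\<sigma> k) (\<sigma> l)))"
  define T1 where "T1 = T - (\<Sum>(k, l)\<in>Pairs. [:[:c (0, k, l):]:] * Bas (Suc q) (0, k, l))"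
  have V1: "VV (a * Suc q + r) (Suc q) T1" unfolding T1_def case_prod_unfold
    by (intro VV_diff Suc VV_sum VV_const VV_Bas) (auto simp: Idx_eq)
  have z: "ev T1 (\<sigma> m) (\<sigma> n) = 0" if "(m, n) \<in> Pairs" for m n
  proof -
    have "ev (HH m n) (\<sigma> m) (\<sigma> n) \<noteq> 0" using HH_ev[of m n m n] that by (simp add: Pairs_def)
    moreover have "ev GG (\<sigma> m) (\<sigma> n) \<noteq> 0" using GG_nonzero that ra by (auto simp: Pairs_def)
    ultimately show ?thesis using level0_ev[OF that, of c "Suc q"] unfolding T1_def
      by (simp add: c_def)
  qed
  have z': "ev T1 (\<sigma> m) (\<sigma> n) = 0" if "m < r" "n < r" for m n
    using z[of m n] z[of n m] that swap_eqD[of T1 "\<sigma> m" "\<sigma> n"] V1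
    by (cases "m \<le> n") (auto simp: Pairs_def VV_def)
  obtain T' where T': "T1 = FF * T'" "bdeg T' (a * Suc q + r - a)" "swap T' = T'"
    using V1 divide_FF[OF _ _ vanish[OF V1 z'], of "a * Suc q + r"] by (auto simp: VV_def)
  have "ords q T'" using V1 T'(1) ords_divide by (auto simp: VV_def)
  \<comment> \<open>Division by \<open>FF\<close> lowers a (q + 1) + r to a q + r and the
    multiplicity q + 1 to q.\<close>
  then have "VV (a * q + r) q T'" using T' by (simp add: VV_def)
  then obtain c' where c': "T' = (\<Sum>x\<in>Idx q. [:[:c' x:]:] * Bas q x)" using Suc.IH by blast
  define e where "e = (\<lambda>(i, k, l). case i of 0 \<Rightarrow> c (0, k, l) | Suc i' \<Rightarrow> c' (i', k, l))"
  have "T = (\<Sum>(k, l)\<in>Pairs. [:[:c (0, k, l):]:] * Bas (Suc q) (0, k, l)) + FF * T'"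
    using T'(1) unfolding T1_def diff_eq_eq by (simp only: add.commute)
  also have "\<dots> = (\<Sum>x\<in>Idx (Suc q). [:[:e x:]:] * Bas (Suc q) x)"
    unfolding sum_Idx_Suc c' sum_distrib_left
    by (intro arg_cong2[where f = "(+)"] sum.cong refl)
      (auto simp: e_def Bas_Suc mult_ac simp del: mult_pCons_left mult_pCons_right)
  finally show ?case by blast
qed

text \<open>Multiples of \<open>FF\<close> vanish at the pairs of nodes, so the coefficients without
  \<open>FF\<close> are zero; then \<open>FF\<close> is cancelled.\<close>

theorem Bas_independent:
  assumes "(\<Sum>x\<in>Idx q. [:[:c x:]:] * Bas q x) = 0" "x \<in> Idx q"
  shows "c x = 0"
  using assms
proof (induction q arbitrary: c x)
  case (0 c x)
  obtain m n where mn: "x = (0, m, n)" "(m, n) \<in> Pairs" using 0(2) by (auto simp: Idx_eq)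
  have "ev (HH m n) (\<sigma> m) (\<sigma> n) \<noteq> 0" using HH_ev[of m n m n] mn by (simp add: Pairs_def)
  moreover have "ev (\<Sum>(k, l)\<in>Pairs. [:[:c (0, k, l):]:] * Bas 0 (0, k, l)) (\<sigma> m) (\<sigma> n) = 0"
    using 0(1) unfolding sum_Idx_0 by (simp only: ev_simps)
  ultimately show ?case using level0_ev[OF mn(2), of c 0] by (simp add: mn)
next
  case (Suc q c x)
  let ?S = "\<Sum>(k, l)\<in>Pairs. [:[:c (0, k, l):]:] * Bas (Suc q) (0, k, l)"
  let ?R = "\<Sum>x\<in>Idx q. [:[:(\<lambda>(i, k, l). c (Suc i, k, l)) x:]:] * Bas q x"
  have R: "(\<Sum>(i, k, l)\<in>Idx q. [:[:c (Suc i, k, l):]:] * Bas (Suc q) (Suc i, k, l)) = FF * ?R"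
    unfolding sum_distrib_left
    by (intro sum.cong) (auto simp: Bas_Suc mult_ac simp del: mult_pCons_left mult_pCons_right)
  have eq: "?S + FF * ?R = 0" using Suc.prems(1) unfolding sum_Idx_Suc R .
  have c0: "c (0, m, n) = 0" if "(m, n) \<in> Pairs" for m n
  proof -
    have mn: "m < a" "n < a" using that ra by (auto simp: Pairs_def)
    have "ev (HH m n) (\<sigma> m) (\<sigma> n) \<noteq> 0" using HH_ev[of m n m n] that by (simp add: Pairs_def)
    moreover have "ev (?S + FF * ?R) (\<sigma> m) (\<sigma> n) = 0" by (simp only: eq ev_simps)
    then have "ev ?S (\<sigma> m) (\<sigma> n) = 0" by (simp only: ev_simps FF_zero[OF mn(1)]) simp
    ultimately show ?thesis using level0_ev[OF that, of c "Suc q"] GG_nonzero[OF mn] by simp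
  qed
  then have "?S = 0" by (intro sum.neutral) auto
  moreover have "FF \<noteq> 0" by (simp add: FF_def sline_eq svar_def uvar_def)
  ultimately have "?R = 0" using eq by simp
  then have "(\<lambda>(i, k, l). c (Suc i, k, l)) y = 0" if "y \<in> Idx q" for y using Suc.IH that by blast
  then show ?case using Suc.prems(2) c0
    by (cases x; cases "fst x") (fastforce simp: Idx_eq)+
qed

end

section \<open>Linear functionals\<close>

text \<open>Functionals live on the whole polynomial ring, so that killing the ideal can be stated
  without splitting its elements into homogeneous parts.\<close>

definition lfun :: "('k::field mpoly4 \<Rightarrow> 'k) \<Rightarrow> bool" where
  "lfun \<theta> \<longleftrightarrow> (\<forall>x y. \<theta> (x + y) = \<theta> x + \<theta> y) \<and> (\<forall>c x. \<theta> (const_poly c * x) = c * \<theta> x)"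

lemma lfun_add: "lfun \<theta> \<Longrightarrow> \<theta> (x + y) = \<theta> x + \<theta> y"
  and lfun_scale: "lfun \<theta> \<Longrightarrow> \<theta> (const_poly c * x) = c * \<theta> x"
  by (simp_all add: lfun_def)

lemma lfun_0: "lfun \<theta> \<Longrightarrow> \<theta> 0 = 0"
  using lfun_scale[of \<theta> 0 0] by simp

lemma lfun_diff: "lfun \<theta> \<Longrightarrow> \<theta> (x - y) = \<theta> x - \<theta> y"
  using lfun_add[of \<theta> "x - y" y] by simp

lemma lfun_sum: "lfun \<theta> \<Longrightarrow> \<theta> (sum f A) = (\<Sum>x\<in>A. \<theta> (f x))"
  by (induction A rule: infinite_finite_induct) (simp_all add: lfun_0 lfun_add)

lemma lfun_span_0:
  assumes "lfun \<theta>" "\<And>x. x \<in> S \<Longrightarrow> \<theta> x = 0" "x \<in> mp.span S"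
  shows "\<theta> x = 0"
  using assms(3)
proof (induction rule: mp.span_induct_alt)
  case base
  then show ?case using assms by (simp add: lfun_0)
next
  case (step c y z)
  then show ?case using assms by (simp add: lfun_add lfun_scale)
qed

text \<open>A basis of W together with x is independent, so a functional can be prescribed as 0 on
  the first and 1 on the second. Proofs of membership by contradiction start here.\<close>

lemma lfun_separate:
  assumes W: "mp.subspace W" and x: "x \<notin> W"
  obtains \<theta> where "lfun \<theta>" "\<And>y. y \<in> W \<Longrightarrow> \<theta> y = 0" "\<theta> x \<noteq> (0 :: 'k::field)"
proof -
  obtain B where B: "B \<subseteq> W" "mp.independent B" "W \<subseteq> mp.span B"
    using mp.maximal_independent_subset by blast
  have "mp.span B \<subseteq> W" using B W by (intro mp.span_minimal)
  then have "mp.independent (insert x B)" using B x by (intro mp.independent_insertI) auto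
  from mpf.linear_independent_extend[OF this, of "\<lambda>y. if y = x then 1 else 0"]
  obtain \<theta> :: "'k mpoly4 \<Rightarrow> 'k" where \<theta>: "Vector_Spaces.linear mscale (*) \<theta>"
    "\<forall>y\<in>insert x B. \<theta> y = (if y = x then 1 else 0)" by blast
  interpret Vector_Spaces.linear "mscale :: 'k \<Rightarrow> 'k mpoly4 \<Rightarrow> 'k mpoly4" "(*)" \<theta> by (rule \<theta>(1))
  have l: "lfun \<theta>" by (simp add: lfun_def add scale)
  moreover have "\<theta> y = 0" if "y \<in> W" for y
  proof (rule lfun_span_0[OF l])
    show "y \<in> mp.span B" using B that by auto
    fix b assume b: "b \<in> B"
    then have "b \<noteq> x" using B x by auto
    then show "\<theta> b = 0" using \<theta>(2) b by simp
  qed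
  moreover have "\<theta> x \<noteq> 0" using \<theta>(2) by simp
  ultimately show ?thesis using that by blast
qed

text \<open>A Gram-Schmidt argument: candidates are projected onto the common kernel of the earlier
  functionals, where the new functional cannot vanish identically by independence.\<close>

lemma dual_elements:
  assumes "finite J" and S: "mp.subspace S" and l: "\<And>j. j \<in> J \<Longrightarrow> lfun (\<theta> j)"
    and ind: "\<And>c. (\<And>x. x \<in> S \<Longrightarrow> (\<Sum>j\<in>J. c j * \<theta> j x) = (0::'k::field)) \<Longrightarrow> \<forall>j\<in>J. c j = 0"
  shows "\<exists>x. \<forall>j\<in>J. x j \<in> S \<and> (\<forall>i\<in>J. \<theta> i (x j) = (if i = j then 1 else 0))"
  using assms(1) l ind
proof (induction J rule: finite_induct)
  case (insert j J)
  have "\<exists>x. \<forall>j\<in>J. x j \<in> S \<and> (\<forall>i\<in>J. \<theta> i (x j) = (if i = j then 1 else 0))"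
  proof (rule insert.IH)
    fix c assume c: "\<And>x. x \<in> S \<Longrightarrow> (\<Sum>j\<in>J. c j * \<theta> j x) = 0"
    have "\<forall>i\<in>insert j J. (c(j := 0)) i = 0"
    proof (rule insert.prems(2))
      fix x assume "x \<in> S"
      have "(\<Sum>i\<in>J. (c(j := 0)) i * \<theta> i x) = (\<Sum>j\<in>J. c j * \<theta> j x)"
        using insert.hyps by (intro sum.cong) auto
      then show "(\<Sum>i\<in>insert j J. (c(j := 0)) i * \<theta> i x) = 0"
        using c[OF \<open>x \<in> S\<close>] insert.hyps by simp
    qed
    then show "\<forall>j\<in>J. c j = 0" using insert.hyps(2) by (metis fun_upd_apply insertCI)
  qed (simp add: insert.prems(1))
  then obtain x where x: "\<And>j. j \<in> J \<Longrightarrow> x j \<in> S"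
    "\<And>i j. i \<in> J \<Longrightarrow> j \<in> J \<Longrightarrow> \<theta> i (x j) = (if i = j then 1 else 0)" by blast
  \<comment> \<open>The projection that removes the components seen by the functionals in
    \<open>J\<close>.\<close>
  define pr where "pr = (\<lambda>y. y - (\<Sum>i\<in>J. const_poly (\<theta> i y) * x i))"
  have prS: "pr y \<in> S" if "y \<in> S" for y
    unfolding pr_def by (intro mp.subspace_diff mp.subspace_sum mp.subspace_scale S that x)
  have pr0: "\<theta> i (pr y) = 0" if "i \<in> J" for i y
  proof -
    have "\<theta> i (pr y) = \<theta> i y - (\<Sum>i'\<in>J. \<theta> i' y * \<theta> i (x i'))"
      using insert.prems(1)[of i] that by (simp add: pr_def lfun_diff lfun_sum lfun_scale)
    also have "(\<Sum>i'\<in>J. \<theta> i' y * \<theta> i (x i')) = (\<Sum>i'\<in>J. if i' = i then \<theta> i y else 0)"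
      using x that by (intro sum.cong) auto
    also have "\<dots> = \<theta> i y" using insert.hyps that by simp
    finally show ?thesis by simp
  qed
  have lj: "lfun (\<theta> j)" using insert.prems by simp
  have "\<exists>y\<in>S. \<theta> j (pr y) \<noteq> 0"
  proof (rule ccontr)
    assume "\<not> ?thesis"
    then have *: "\<theta> j (pr y) = 0" if "y \<in> S" for y using that by blast
    \<comment> \<open>Vanishing on all projections would express the new functional through the
      earlier ones on S.\<close>
    define c where "c = (\<lambda>i. if i = j then 1 else - \<theta> j (x i))"
    have "\<forall>i\<in>insert j J. c i = 0"
    proof (rule insert.prems(2))
      fix y assume "y \<in> S"
      have "(\<Sum>i\<in>J. c i * \<theta> i y) = - (\<Sum>i\<in>J. \<theta> i y * \<theta> j (x i))"
        unfolding sum_negf[symmetric] using insert.hyps by (intro sum.cong) (auto simp: c_def)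
      moreover have "\<theta> j (pr y) = \<theta> j y - (\<Sum>i\<in>J. \<theta> i y * \<theta> j (x i))"
        using lj by (simp add: pr_def lfun_diff lfun_sum lfun_scale)
      ultimately show "(\<Sum>i\<in>insert j J. c i * \<theta> i y) = 0"
        using *[OF \<open>y \<in> S\<close>] insert.hyps by (simp add: c_def)
    qed
    then show False by (simp add: c_def)
  qed
  then obtain y where y: "y \<in> S" "\<theta> j (pr y) \<noteq> 0" by blast
  define z where "z = const_poly (1 / \<theta> j (pr y)) * pr y"
  have zS: "z \<in> S" unfolding z_def by (intro mp.subspace_scale S prS y)
  have zj: "\<theta> j z = 1" using lj y by (simp add: z_def lfun_scale)
  have zi: "\<theta> i z = 0" if "i \<in> J" for i
    using insert.prems(1)[of i] that pr0 by (simp add: z_def lfun_scale)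
  define x' where "x' = (\<lambda>i. if i = j then z else x i - const_poly (\<theta> j (x i)) * z)"
  have "\<forall>j'\<in>insert j J. x' j' \<in> S \<and> (\<forall>i\<in>insert j J. \<theta> i (x' j') = (if i = j' then 1 else 0))"
  proof (intro ballI conjI)
    fix j' assume j': "j' \<in> insert j J"
    show "x' j' \<in> S" unfolding x'_def using j' zS x
      by (auto intro!: mp.subspace_diff mp.subspace_scale S)
    fix i assume i: "i \<in> insert j J"
    have "lfun (\<theta> i)" using insert.prems(1) i by blast
    then show "\<theta> i (x' j') = (if i = j' then 1 else 0)"
      using i j' insert(2) zj zi x by (auto simp: x'_def lfun_diff lfun_scale)
  qed
  then show ?case by blast
qed simp

section \<open>Functionals given by iterated derivatives\<close>

abbreviation dders :: "('k::field ^ 4) list \<Rightarrow> 'k mpoly4 \<Rightarrow> 'k mpoly4" where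
  "dders \<equiv> foldr dderiv"

text \<open>The apolarity pairing with the product of the planes in \<open>us\<close>: on the power
  of \<open>lin_form p\<close> of matching degree it is, up to a factorial, the value of this
  product at p.\<close>

definition dfun :: "('k::field ^ 4) list \<Rightarrow> 'k mpoly4 \<Rightarrow> 'k" where
  "dfun us f = const_coeff (dders us f)"

lemma dders_add: "dders us (f + g) = dders us f + dders us g"
  by (induction us) (simp_all add: dderiv_add)

lemma dders_scale: "dders us (const_poly c * f) = const_poly c * dders us f"
  by (induction us) (simp_all add: dderiv_scale)

lemma lfun_dfun: "lfun (dfun us)"
  by (simp add: lfun_def dfun_def dders_add dders_scale)

lemma dderiv_lin_form_power:
  "dderiv u (lin_form p ^ n) = const_poly (of_nat n * dotp u p) * lin_form p ^ (n - 1)"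
proof (induction n)
  case (Suc n)
  then show ?case
    by (cases n) (simp_all add: dderiv_mult dderiv_lin_form algebra_simps)
qed simp

text \<open>A derivative along a plane through p does not touch powers of \<open>lin_form p\<close>;
  only the other planes can lower the exponent, each by at most one.\<close>

lemma dders_power_mult:
  "\<exists>h. dders us (lin_form p ^ n * g) = lin_form p ^ (n - length (filter (\<lambda>u. dotp u p \<noteq> 0) us)) * h"
proof (induction us)
  case (Cons u us)
  let ?k = "n - length (filter (\<lambda>u. dotp u p \<noteq> 0) us)"
  obtain h where h: "dders us (lin_form p ^ n * g) = lin_form p ^ ?k * h" using Cons by blast
  have *: "dders (u # us) (lin_form p ^ n * g) =
      const_poly (of_nat ?k * dotp u p) * lin_form p ^ (?k - 1) * h + lin_form p ^ ?k * dderiv u h"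
    by (simp add: h dderiv_mult dderiv_lin_form_power del: const_poly_mult)
  show ?case
  proof (cases "dotp u p = 0")
    case True
    then show ?thesis using * by auto
  next
    case False
    have "dders (u # us) (lin_form p ^ n * g) = lin_form p ^ (?k - 1) *
       (const_poly (of_nat ?k * dotp u p) * h + lin_form p ^ (if ?k = 0 then 0 else 1) * dderiv u h)"
      unfolding * by (cases ?k) (simp_all add: algebra_simps)
    moreover have "?k - 1 = n - length (filter (\<lambda>u. dotp u p \<noteq> 0) (u # us))" using False by simp
    ultimately show ?thesis by metis
  qed
qed auto

lemma const_coeff_power [simp]: "const_coeff (f ^ n) = const_coeff f ^ n"
  by (induction n) simp_all

text \<open>Since some power of \<open>lin_form p\<close> survives, the constant coefficient
  vanishes. Counting the planes that avoid p is the means by which the explicit functionals are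
  shown to kill the ideal or the multiples of \<open>al\<close>.\<close>

lemma dfun_power_mult_eq_0:
  assumes "length (filter (\<lambda>u. dotp u p \<noteq> 0) us) < n"
  shows "dfun us (lin_form p ^ n * g) = 0"
proof -
  obtain h where "dders us (lin_form p ^ n * g) = lin_form p ^ (n - length (filter (\<lambda>u. dotp u p \<noteq> 0) us)) * h"
    using dders_power_mult by blast
  then show ?thesis using assms by (simp add: dfun_def)
qed

lemma dders_power:
  "dders us (lin_form (p :: 'k::field_char_0 ^ 4) ^ (k + length us)) =
   const_poly (fact (k + length us) / fact k * prod_list (map (\<lambda>u. dotp u p) us)) * lin_form p ^ k"
proof (induction us arbitrary: k)
  case (Cons u us)
  have "dders (u # us) (lin_form p ^ (k + length (u # us))) =
    dderiv u (dders us (lin_form p ^ (Suc k + length us)))" by simp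
  also have "\<dots> = const_poly (fact (Suc k + length us) / fact (Suc k) * prod_list (map (\<lambda>u. dotp u p) us)
      * (of_nat (Suc k) * dotp u p)) * lin_form p ^ k"
    unfolding Cons dderiv_scale dderiv_lin_form_power diff_Suc_1 by (simp only: const_poly_mult mult.assoc)
  also have "fact (Suc k + length us) / fact (Suc k) * prod_list (map (\<lambda>u. dotp u p) us) * (of_nat (Suc k) * dotp u p)
    = fact (k + length (u # us)) / fact k * prod_list (map (\<lambda>u. dotp u p) (u # us))"
    by (simp add: field_simps del: of_nat_Suc fact_Suc) (simp add: fact_Suc mult_ac)
  finally show ?case .
qed simp

lemma dfun_power:
  "dfun us (lin_form (p :: 'k::field_char_0 ^ 4) ^ length us) = fact (length us) * prod_list (map (\<lambda>u. dotp u p) us)"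
  using dders_power[of us p 0] by (simp add: dfun_def del: const_poly_mult)

lemma homog_finite_span: "\<exists>T. finite T \<and> homog n \<subseteq> mp.span T"
proof (induction n)
  case 0
  have "homog 0 \<subseteq> mp.span {1 :: 'a mpoly4}"
  proof
    fix f :: "'a mpoly4" assume "f \<in> homog 0"
    then obtain c where "f = const_poly c * 1" using homog_0_const by (metis mult.right_neutral)
    then show "f \<in> mp.span {1}" by (metis insertI1 mp.span_base mp.span_scale)
  qed
  then show ?case by blast
next
  case (Suc n)
  then obtain T :: "'a mpoly4 set" where T: "finite T" "homog n \<subseteq> mp.span T" by blast
  let ?T = "(\<lambda>(i, g). var_poly i * g) ` (UNIV \<times> T)"
  have "var_poly i * g \<in> mp.span ?T" if "g \<in> mp.span T" for i g
    using that
  proof (induction rule: mp.span_induct_alt)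
    case (step c x y)
    have "var_poly i * x \<in> mp.span ?T" using step(1) by (intro mp.span_base) force
    then have "const_poly c * (var_poly i * x) + var_poly i * y \<in> mp.span ?T"
      using step by (intro mp.span_add mp.span_scale)
    then show ?case by (simp add: algebra_simps)
  qed (simp add: mp.span_zero)
  then have "{var_poly i * g |i g. g \<in> homog n} \<subseteq> mp.span ?T" using T by auto
  then have "homog (Suc n) \<subseteq> mp.span ?T"
    using homog_Suc_span mp.span_minimal[OF _ mp.subspace_span] by blast
  then show ?case by (intro exI[of _ ?T]) (use T in auto)
qed

lemma diff_power_factor:
  fixes x y :: "'a::comm_ring_1"
  shows "x ^ n - y ^ n = (x - y) * (\<Sum>i<n. y ^ (n - Suc i) * x ^ i)"
  by (rule power_diff_sumr2)

section \<open>Functionals as polynomials on the quadric\<close>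

lemma degree_coeff_svar_power: "degree (coeff (svar x ^ p) i) = 0"
proof (induction p arbitrary: i)
  case (Suc p)
  have "coeff (svar x ^ Suc p) i = Polynomial.smult (- x) (coeff (svar x ^ p) i) + coeff (pCons 0 (svar x ^ p)) i"
    by (simp add: svar_def)
  moreover have "degree (coeff (pCons 0 (svar x ^ p)) i) = 0"
    using Suc by (cases i) simp_all
  ultimately have "degree (coeff (svar x ^ Suc p) i) \<le> 0"
    by (simp only:) (intro degree_add_le order_trans[OF degree_smult_le], use Suc in auto)
  then show ?case by simp
qed (simp add: coeff_1)

lemma bdeg_svar_uvar:
  assumes "p \<le> n" "m \<le> n"
  shows "bdeg (svar x ^ p * uvar y ^ m) (Suc n)"
proof -
  have u: "uvar y ^ m = [:[:- y, 1:] ^ m:]" by (simp add: uvar_def poly_const_pow)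
  have "degree (svar x ^ p * uvar y ^ m) \<le> p"
  proof -
    have "degree (svar x ^ p) \<le> p"
      using degree_power_le[of "svar x" p] by (simp add: svar_def)
    then show ?thesis using degree_mult_le[of "svar x ^ p" "uvar y ^ m"] by (simp add: u)
  qed
  moreover have "degree (coeff (svar x ^ p * uvar y ^ m) i) \<le> m" for i
  proof -
    have "coeff (svar x ^ p * uvar y ^ m) i = [:- y, 1:] ^ m * coeff (svar x ^ p) i"
      by (simp add: u mult.commute)
    moreover have "degree ([:- y, 1:] ^ m * coeff (svar x ^ p) i) \<le> m"
      using degree_mult_le[of "[:- y, 1:] ^ m" "coeff (svar x ^ p) i"] degree_coeff_svar_power[of x p i]
        degree_power_le[of "[:- y, 1:]" m] by simp
    ultimately show ?thesis by simp
  qed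
  ultimately show ?thesis using assms by (auto simp: bdeg_Suc intro: order_trans)
qed

text \<open>A Taylor expansion at (x, y): the terms with the power t - m of P have order at least m
  at that point. If the functional kills those with m < q, only terms of order at least q
  remain.\<close>

lemma expand_power:
  fixes \<theta> :: "'k::field_char_0 mpoly4 \<Rightarrow> 'k"
  assumes \<theta>: "lfun \<theta>"
  shows "\<exists>T. (\<forall>s u. ev T s u =
        \<theta> ((P + const_poly (s - x) * v1 + const_poly (u - y) * (v2 + const_poly (s - x) * w)) ^ t)) \<and>
      bdeg T (Suc t) \<and> (\<forall>q. (\<forall>m<q. \<forall>g. \<theta> (P ^ (t - m) * g) = 0) \<longrightarrow> T \<in> ptpow x y q)"
proof -
  \<comment> \<open>Among the m factors different from P, j are \<open>v1\<close>, l are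
    \<open>w\<close> and the remaining m - j - l are \<open>v2\<close>.\<close>
  define C where "C = (\<lambda>m j l. of_nat (t choose m) * of_nat (m choose j) * of_nat (m - j choose l) :: 'k)"
  define M where "M = (\<lambda>m j l. P ^ (t - m) * (v1 ^ j * v2 ^ (m - j - l) * w ^ l))"
  define T where "T = (\<Sum>m\<le>t. \<Sum>j\<le>m. \<Sum>l\<le>m - j.
      [:[:C m j l * \<theta> (M m j l):]:] * (svar x ^ (j + l) * uvar y ^ (m - j)))"
  have "ev T s u = \<theta> ((P + const_poly (s - x) * v1 + const_poly (u - y) * (v2 + const_poly (s - x) * w)) ^ t)"
    for s u
  proof -
    define S U where "S = const_poly (s - x)" and "U = const_poly (u - y)"
    have "(P + S * v1 + U * (v2 + S * w)) ^ t = ((S * v1 + U * (S * w + v2)) + P) ^ t"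
      by (simp add: algebra_simps)
    also have "\<dots> = (\<Sum>m\<le>t. of_nat (t choose m) * (\<Sum>j\<le>m. of_nat (m choose j) * (S * v1) ^ j *
        (U ^ (m - j) * (\<Sum>l\<le>m - j. of_nat (m - j choose l) * (S * w) ^ l * v2 ^ (m - j - l)))) * P ^ (t - m))"
      by (simp only: binomial_ring power_mult_distrib[of U])
    also have "\<dots> = (\<Sum>m\<le>t. \<Sum>j\<le>m. \<Sum>l\<le>m - j.
        const_poly (C m j l * ((s - x) ^ (j + l) * (u - y) ^ (m - j))) * M m j l)"
      unfolding sum_distrib_left sum_distrib_right
      by (intro sum.cong refl)
        (simp add: C_def M_def S_def U_def power_mult_distrib power_add mult_ac
          del: const_poly_diff)
    finally have "\<theta> ((P + S * v1 + U * (v2 + S * w)) ^ t) = (\<Sum>m\<le>t. \<Sum>j\<le>m. \<Sum>l\<le>m - j.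
        C m j l * ((s - x) ^ (j + l) * (u - y) ^ (m - j)) * \<theta> (M m j l))"
      by (simp only: lfun_sum[OF \<theta>] lfun_scale[OF \<theta>])
    also have "\<dots> = ev T s u"
      unfolding T_def ev_sum ev_simps by (intro sum.cong refl) simp
    finally show ?thesis by (simp add: S_def U_def)
  qed
  moreover have "bdeg T (Suc t)"
    unfolding T_def by (intro bdeg_sum bdeg_const_mult bdeg_svar_uvar) auto
  moreover have "T \<in> ptpow x y q" if z: "\<forall>m<q. \<forall>g. \<theta> (P ^ (t - m) * g) = 0" for q
    unfolding T_def
  proof (intro idpow_sum)
    fix m j l assume "m \<in> {..t}" "j \<in> {..m}" "l \<in> {..m - j}"
    show "[:[:C m j l * \<theta> (M m j l):]:] * (svar x ^ (j + l) * uvar y ^ (m - j)) \<in> ptpow x y q"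
    proof (cases "m < q")
      case True
      then have "\<theta> (M m j l) = 0" using z by (simp add: M_def)
      then show ?thesis by simp
    next
      case False
      then show ?thesis using \<open>j \<in> {..m}\<close> by (intro idpow_mult idpow_power_mult) auto
    qed
  qed
  ultimately show ?thesis by blast
qed

text \<open>Each value e of the sum comes only from the two roots of a quadratic. Over a field that
  is not closed this replaces the choice of s and u with arbitrary sum and product.\<close>

lemma infinite_sum_const_prod:
  fixes c :: "'k::field_char_0"
  shows "infinite ((\<lambda>s. s + c / s) ` (UNIV - {0}))"
proof
  assume fin: "finite ((\<lambda>s. s + c / s) ` (UNIV - {0}))"
  have "UNIV - {0} \<subseteq> (\<Union>e\<in>(\<lambda>s. s + c / s) ` (UNIV - {0}). {s. poly [:c, - e, 1:] s = 0})"
  proof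
    fix s :: 'k assume "s \<in> UNIV - {0}"
    then have "poly [:c, - (s + c / s), 1:] s = 0" by (simp add: algebra_simps)
    with \<open>s \<in> UNIV - {0}\<close>
    show "s \<in> (\<Union>e\<in>(\<lambda>s. s + c / s) ` (UNIV - {0}). {s. poly [:c, - e, 1:] s = 0})" by blast
  qed
  moreover have "finite (\<Union>e\<in>(\<lambda>s. s + c / s) ` (UNIV - {0}). {s. poly [:c, - e, 1:] s = 0})"
    by (intro finite_UN_I fin poly_roots_finite) simp
  ultimately have "finite (UNIV - {0::'k})" using finite_subset by blast
  then show False using infinite_UNIV_char_0[where 'a = 'k] by simp
qed

text \<open>Algebraic independence of the elementary symmetric polynomials, stated for values: fix a
  nonzero product c, let the sum vary, and then let c vary.\<close>

lemma sum_prod_independent: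
  fixes h :: "nat \<Rightarrow> nat \<Rightarrow> 'k::field_char_0"
  assumes "\<And>s u. (\<Sum>l\<le>n. \<Sum>j\<le>n. h j l * (s + u) ^ j * (s * u) ^ l) = 0" "j \<le> n" "l \<le> n"
  shows "h j l = 0"
proof -
  have *: "(\<Sum>l\<le>n. h j l * c ^ l) = 0" if "c \<noteq> 0" "j \<le> n" for c j
  proof -
    define p where "p = (\<Sum>j\<le>n. monom (\<Sum>l\<le>n. h j l * c ^ l) j)"
    have "p = 0"
    proof (rule poly_eq_0_infinite[OF infinite_sum_const_prod])
      fix e assume "e \<in> (\<lambda>s. s + c / s) ` (UNIV - {0})"
      then obtain s where s: "s \<noteq> 0" "e = s + c / s" by blast
      have "poly p e = (\<Sum>j\<le>n. \<Sum>l\<le>n. h j l * e ^ j * c ^ l)"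
        by (simp add: p_def poly_sum poly_monom sum_distrib_left sum_distrib_right mult_ac)
      also have "\<dots> = (\<Sum>l\<le>n. \<Sum>j\<le>n. h j l * e ^ j * c ^ l)" by (rule sum.swap)
      also have "\<dots> = 0" using assms(1)[of s "c / s"] s by simp
      finally show "poly p e = 0" .
    qed
    then have "coeff p j = 0" by simp
    moreover have "coeff p j = (\<Sum>j'\<le>n. if j' = j then (\<Sum>l\<le>n. h j l * c ^ l) else 0)"
      unfolding p_def coeff_sum coeff_monom by (intro sum.cong) auto
    ultimately show ?thesis using that by simp
  qed
  define p where "p = (\<Sum>l\<le>n. monom (h j l) l)"
  have "p = 0"
  proof (rule poly_eq_0_infinite[of "UNIV - {0}"])
    show "infinite (UNIV - {0 :: 'k})" using infinite_UNIV_char_0[where 'a = 'k] by simp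
    fix c :: 'k assume "c \<in> UNIV - {0}"
    then show "poly p c = 0" using *[of c j] assms by (simp add: p_def poly_sum poly_monom)
  qed
  then have "coeff p l = 0" by simp
  moreover have "coeff p l = (\<Sum>l'\<le>n. if l' = l then h j l else 0)"
    unfolding p_def coeff_sum coeff_monom by (intro sum.cong) auto
  ultimately show ?thesis using assms by simp
qed

definition gpt :: "'k::field ^ 4 \<Rightarrow> 'k ^ 4 \<Rightarrow> 'k ^ 4 \<Rightarrow> 'k ^ 4 \<Rightarrow> 'k \<Rightarrow> 'k \<Rightarrow> 'k ^ 4" where
  "gpt e00 e01 e10 e11 s u = e00 + u *s e01 + s *s e10 + (s * u) *s e11"

text \<open>\<open>dual\<close> and \<open>spanning\<close> say that the four vectors form a basis.
  \<open>gens\<close> bounds the ideal from below; \<open>kill\<close> is the dual way to bound it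
  from above by the ideal generated by the powers at the grid.\<close>

locale grid_algebra = grid_nodes \<sigma> \<upsilon> a r + mpoly4_ideal I
  for \<sigma> \<upsilon> :: "nat \<Rightarrow> 'k::field_char_0" and a r :: nat and I :: "'k mpoly4 set" +
  fixes e00 e01 e10 e11 :: "'k ^ 4" and q d :: nat
  assumes q1: "q \<ge> 1" and d_eq: "d = (a - 1) * q + r" and r_less: "r < a - 1"
    and dual: "\<And>A B C D. \<exists>u. dotp u e00 = A \<and> dotp u e01 = B \<and> dotp u e10 = C \<and> dotp u e11 = D"
    and spanning: "\<And>x. \<exists>A B C D. x = A *s e00 + B *s e01 + C *s e10 + D *s e11"
    and gens: "\<And>i j. i < a \<Longrightarrow> j < a \<Longrightarrow> lin_form (gpt e00 e01 e10 e11 (\<sigma> i) (\<upsilon> j)) ^ d \<in> I"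
    and kill: "\<And>\<theta> x. lfun \<theta> \<Longrightarrow>
       (\<And>i j g. i < a \<Longrightarrow> j < a \<Longrightarrow> \<theta> (lin_form (gpt e00 e01 e10 e11 (\<sigma> i) (\<upsilon> j)) ^ d * g) = (0::'k)) \<Longrightarrow>
       x \<in> I \<Longrightarrow> \<theta> x = 0"
begin

abbreviation "L \<equiv> \<lambda>s u. lin_form (gpt e00 e01 e10 e11 s u)"

definition tt :: nat where "tt = d + q - 1"
definition al :: "'k mpoly4" where "al = lin_form (e01 - e10)"

lemma Suc_tt: "Suc tt = a * q + r"
proof -
  have "a * q = (a - 1) * q + q" using r_less by (cases a) auto
  then show ?thesis unfolding tt_def using q1 d_eq by linarith
qed

lemma tt_pos: "tt \<ge> 1"
proof -
  have "a \<ge> 2" using r_less by linarith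
  then have "a * q \<ge> 2 * 1" using q1 by (intro mult_le_mono)
  then show ?thesis using Suc_tt by linarith
qed

lemma L_expand: "L s u = lin_form e00 + const_poly u * lin_form e01 + const_poly s * lin_form e10
    + const_poly (s * u) * lin_form e11"
  by (simp only: gpt_def lin_form_add lin_form_scale)

lemma L_center: "L s u = L x y + const_poly (s - x) * lin_form (e10 + y *s e11)
   + const_poly (u - y) * (lin_form (e01 + x *s e11) + const_poly (s - x) * lin_form e11)"
  by (simp add: L_expand lin_form_add lin_form_scale algebra_simps)

text \<open>The points (s, u) and (u, s) lie on a line through the centre of projection, so
  \<open>L\<close> is symmetric modulo \<open>al\<close>.\<close>

lemma L_swap: "L s u - L u s = const_poly (u - s) * al"
  by (simp add: L_expand al_def lin_form_minus algebra_simps)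

lemma homog_L: "L s u ^ n \<in> homog n"
  by (rule homog_lin_form_power)

lemma homog_mix: "f \<in> homog 1 \<Longrightarrow> g \<in> homog 1 \<Longrightarrow> (\<Sum>i<n. g ^ (n - Suc i) * f ^ i) \<in> homog (n - 1)"
proof (intro homog_sum)
  fix i assume "f \<in> homog 1" "g \<in> homog 1" "i \<in> {..<n}"
  then show "g ^ (n - Suc i) * f ^ i \<in> homog (n - 1)"
    using homog_mult[OF homog_power[of g 1 "n - Suc i"] homog_power[of f 1 i]] by simp
qed

lemma power_cong_al:
  assumes \<theta>: "lfun \<theta>" "\<And>g. g \<in> homog (n - 1) \<Longrightarrow> \<theta> (al * g) = 0"
    and fg: "f \<in> homog 1" "g \<in> homog 1" "f - g = const_poly c * al"
  shows "\<theta> (f ^ n) = \<theta> (g ^ n)"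
proof -
  have "f ^ n - g ^ n = const_poly c * (al * (\<Sum>i<n. g ^ (n - Suc i) * f ^ i))"
    using diff_power_factor[of f n g] fg(3) by (simp add: mult_ac)
  then have "\<theta> (f ^ n - g ^ n) = 0" using \<theta> homog_mix[OF fg(1,2), of n] by (simp only: lfun_scale) simp
  then show ?thesis using \<theta>(1) by (simp add: lfun_diff)
qed

text \<open>The expansion of the powers of \<open>L\<close> around each grid point gives the
  vanishing order there; the exponent \<open>tt\<close> exceeds d by exactly q - 1.\<close>

lemma functional_poly:
  assumes \<theta>: "lfun \<theta>" and I0: "\<And>x. x \<in> I \<Longrightarrow> \<theta> x = 0"
  obtains T where "\<And>s u. ev T s u = \<theta> (L s u ^ tt)" "bdeg T (a * q + r)" "ords q T"
proof -
  have ex: "\<exists>T. (\<forall>s u. ev T s u = \<theta> (L s u ^ tt)) \<and> bdeg T (Suc tt) \<and>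
      (\<forall>q. (\<forall>m<q. \<forall>g. \<theta> (L x y ^ (tt - m) * g) = 0) \<longrightarrow> T \<in> ptpow x y q)" for x y
    using expand_power[OF \<theta>, of "L x y" x "lin_form (e10 + y *s e11)" y
        "lin_form (e01 + x *s e11)" "lin_form e11" tt] unfolding L_center[symmetric] .
  then obtain T where T: "\<And>s u. ev T s u = \<theta> (L s u ^ tt)" "bdeg T (Suc tt)" by blast
  have "ords q T" unfolding ords_def
  proof (intro allI impI)
    fix i j assume ij: "i < a" "j < a"
    obtain T' where T': "\<And>s u. ev T' s u = \<theta> (L s u ^ tt)"
      "(\<forall>m<q. \<forall>g. \<theta> (L (\<sigma> i) (\<upsilon> j) ^ (tt - m) * g) = 0) \<longrightarrow> T' \<in> ptpow (\<sigma> i) (\<upsilon> j) q"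
      using ex[of "\<sigma> i" "\<upsilon> j"] by blast
    have "T' = T" by (rule ev_ext) (simp add: T T')
    \<comment> \<open>As m is at most q - 1, the exponent is still at least d and the product lies
      in the ideal.\<close>
    moreover have "\<theta> (L (\<sigma> i) (\<upsilon> j) ^ (tt - m) * g) = 0" if "m < q" for m g
    proof (rule I0)
      have "tt - m - d + d = tt - m" using that by (simp add: tt_def)
      then have "L (\<sigma> i) (\<upsilon> j) ^ (tt - m) = L (\<sigma> i) (\<upsilon> j) ^ (tt - m - d) * L (\<sigma> i) (\<upsilon> j) ^ d"
        by (simp flip: power_add)
      then have "L (\<sigma> i) (\<upsilon> j) ^ (tt - m) * g = (L (\<sigma> i) (\<upsilon> j) ^ (tt - m - d) * g) * L (\<sigma> i) (\<upsilon> j) ^ d"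
        by (simp only: mult_ac)
      then show "L (\<sigma> i) (\<upsilon> j) ^ (tt - m) * g \<in> I"
        using mult_mem[OF gens[OF ij]] by (simp only:)
    qed
    ultimately show "T \<in> ptpow (\<sigma> i) (\<upsilon> j) q" using T'(2) by blast
  qed
  with T show ?thesis unfolding Suc_tt by (rule that)
qed

text \<open>Modulo \<open>al\<close> the forms of \<open>e01\<close> and \<open>e10\<close> agree,
  so the coordinate ring of the plane is generated by the other three.\<close>

lemma homog_span_L:
  assumes "f \<in> homog (Suc n)"
  shows "f \<in> mp.span ({lin_form e00 ^ i * lin_form e10 ^ j * lin_form e11 ^ l |i j l. i + j + l = Suc n}
     \<union> {al * g |g. g \<in> homog n})"
  using assms
proof (induction n arbitrary: f)
  let ?S = "\<lambda>n. {lin_form e00 ^ i * lin_form e10 ^ j * lin_form e11 ^ l |i j l. i + j + l = Suc n}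
     \<union> {al * g |g. g \<in> homog n}"
  have lin: "lin_form v * g \<in> mp.span S"
    if "lin_form e00 * g \<in> mp.span S" "lin_form e10 * g \<in> mp.span S" "lin_form e11 * g \<in> mp.span S"
      "al * g \<in> mp.span S" for v g S
  proof -
    obtain A B C D where "v = A *s e00 + B *s e01 + C *s e10 + D *s e11" using spanning by blast
    then have "lin_form v * g = const_poly A * (lin_form e00 * g) + const_poly B * (al * g)
      + const_poly (B + C) * (lin_form e10 * g) + const_poly D * (lin_form e11 * g)"
      by (simp add: lin_form_add lin_form_scale al_def lin_form_minus algebra_simps)
    then show ?thesis using that by (simp only:) (intro mp.span_add mp.span_scale)
  qed
  {
    case 0
    have "g \<in> mp.span (?S 0)" if g: "g \<in> {var_poly i * g |i g. g \<in> homog 0}" for g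
    proof -
      obtain i h where h: "g = var_poly i * h" "h \<in> homog 0" using g by blast
      obtain c where "h = const_poly c" using homog_0_const[OF h(2)] by blast
      with h have g: "g = lin_form (axis i 1) * const_poly c" by (simp add: lin_form_axis)
      have mon: "lin_form e00 ^ i * lin_form e10 ^ j * lin_form e11 ^ l \<in> mp.span (?S 0)"
        if "i + j + l = Suc 0" for i j l
        using that by (intro mp.span_base) blast
      have "lin_form (axis i 1) * 1 \<in> mp.span (?S 0)"
      proof (rule lin)
        show "lin_form e00 * 1 \<in> mp.span (?S 0)" using mon[of 1 0 0] by simp
        show "lin_form e10 * 1 \<in> mp.span (?S 0)" using mon[of 0 1 0] by simp
        show "lin_form e11 * 1 \<in> mp.span (?S 0)" using mon[of 0 0 1] by simp
        have "(1 :: 'k mpoly4) \<in> homog 0" using homog_const[of "1::'k"] by simp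
        then show "al * 1 \<in> mp.span (?S 0)" by (intro mp.span_base) blast
      qed
      then show ?thesis using mp.span_scale[of "lin_form (axis i 1)" _ c] by (simp add: g mult.commute)
    qed
    then show ?case using homog_Suc_span[of f 0] 0 mp.span_minimal[OF _ mp.subspace_span] by blast
  next
    case (Suc n)
    have mult_lin: "lin_form v * h \<in> mp.span (?S (Suc n))" if hS: "h \<in> ?S n" for v h
    proof (cases "h \<in> {al * g |g. g \<in> homog n}")
      case True
      then obtain g where g: "h = al * g" "g \<in> homog n" by blast
      have "lin_form v * g \<in> homog (Suc n)" using homog_mult[OF homog_lin_form g(2)] by simp
      then have "al * (lin_form v * g) \<in> mp.span (?S (Suc n))" by (intro mp.span_base) blast
      then show ?thesis by (simp add: g mult_ac)
    next
      case False
      then obtain i j l where h: "h = lin_form e00 ^ i * lin_form e10 ^ j * lin_form e11 ^ l" "i + j + l = Suc n"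
        using hS by blast
      show ?thesis
      proof (rule lin)
        show "lin_form e00 * h \<in> mp.span (?S (Suc n))" unfolding h
          by (intro mp.span_base UnI1 CollectI exI[of _ "Suc i"] exI[of _ j] exI[of _ l]) (use h in \<open>auto simp: mult_ac\<close>)
        show "lin_form e10 * h \<in> mp.span (?S (Suc n))" unfolding h
          by (intro mp.span_base UnI1 CollectI exI[of _ i] exI[of _ "Suc j"] exI[of _ l]) (use h in \<open>auto simp: mult_ac\<close>)
        show "lin_form e11 * h \<in> mp.span (?S (Suc n))" unfolding h
          by (intro mp.span_base UnI1 CollectI exI[of _ i] exI[of _ j] exI[of _ "Suc l"]) (use h in \<open>auto simp: mult_ac\<close>)
        have "lin_form e00 ^ i * lin_form e10 ^ j * lin_form e11 ^ l \<in> homog (i + j + l)"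
          by (intro homog_mult homog_lin_form_power)
        then show "al * h \<in> mp.span (?S (Suc n))" using h by (intro mp.span_base) auto
      qed
    qed
    have step': "lin_form v * h \<in> mp.span (?S (Suc n))" if "h \<in> mp.span (?S n)" for v h
      using that
    proof (induction rule: mp.span_induct_alt)
      case (step c x y)
      have "const_poly c * (lin_form v * x) + lin_form v * y \<in> mp.span (?S (Suc n))"
        by (rule mp.span_add[OF mp.span_scale[OF mult_lin[OF step(1)]] step(2)])
      then show ?case by (simp add: algebra_simps)
    qed (simp add: mp.span_zero)
    have "{var_poly i * g |i g. g \<in> homog (Suc n)} \<subseteq> mp.span (?S (Suc n))"
      using step' Suc.IH by (auto simp flip: lin_form_axis)
    then show ?case using homog_Suc_span[OF Suc.prems] mp.span_minimal[OF _ mp.subspace_span] by blast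
  }
qed

text \<open>Modulo \<open>al\<close>, L(s, u) is e00 + (s + u) e10 + su e11. Its powers produce
  every monomial as the coefficient of a product of elementary symmetric polynomials, with a
  multinomial factor that is nonzero in characteristic zero.\<close>

lemma functional_zero:
  assumes \<theta>: "lfun \<theta>" and al0: "\<And>g. g \<in> homog (tt - 1) \<Longrightarrow> \<theta> (al * g) = 0"
    and L0: "\<And>s u. \<theta> (L s u ^ tt) = 0" and f: "f \<in> homog tt"
  shows "\<theta> f = 0"
proof -
  let ?b0 = "lin_form e00" and ?b1 = "lin_form e10" and ?b2 = "lin_form e11"
  \<comment> \<open>The value 0 outside the triangle j + l <= \<open>tt\<close> allows summation
    over a square, as \<open>sum_prod_independent\<close> expects.\<close>
  define M where "M = (\<lambda>j l. if j + l \<le> tt then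
     of_nat (tt choose (j + l)) * of_nat (j + l choose j) * \<theta> (?b0 ^ (tt - (j + l)) * ?b1 ^ j * ?b2 ^ l) else 0)"
  have "M j l = 0" if "j \<le> tt" "l \<le> tt" for j l
  proof (rule sum_prod_independent[OF _ that])
    fix s u :: 'k
    define e1 e2 where "e1 = s + u" and "e2 = s * u"
    let ?g = "(const_poly e1 * ?b1 + const_poly e2 * ?b2) + ?b0"
    have "?g = lin_form (e1 *s e10 + e2 *s e11 + e00)" by (simp only: lin_form_add lin_form_scale)
    then have "?g \<in> homog 1" using homog_lin_form by simp
    then have "\<theta> (?g ^ tt) = \<theta> (L s u ^ tt)"
      \<comment> \<open>Replacing \<open>e01\<close> by \<open>e10\<close> in \<open>L s u\<close>
        removes u times \<open>al\<close>, whence the constant \<open>- u\<close>.\<close>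
      by (intro power_cong_al[OF \<theta> al0, where c = "- u"] homog_lin_form)
         (simp_all add: L_expand al_def lin_form_minus algebra_simps e1_def e2_def)
    moreover have "?g ^ tt = (\<Sum>m\<le>tt. \<Sum>j\<le>m. const_poly (of_nat (tt choose m) * of_nat (m choose j) * e1 ^ j * e2 ^ (m - j))
        * (?b0 ^ (tt - m) * ?b1 ^ j * ?b2 ^ (m - j)))"
      unfolding binomial_ring sum_distrib_left sum_distrib_right
      by (intro sum.cong refl) (simp add: power_mult_distrib mult_ac)
    ultimately have "0 = (\<Sum>m\<le>tt. \<Sum>j\<le>m. of_nat (tt choose m) * of_nat (m choose j) * e1 ^ j * e2 ^ (m - j)
        * \<theta> (?b0 ^ (tt - m) * ?b1 ^ j * ?b2 ^ (m - j)))"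
      using L0[of s u] by (simp only: lfun_sum[OF \<theta>] lfun_scale[OF \<theta>])
    also have "\<dots> = (\<Sum>m\<le>tt. \<Sum>j\<le>m. M j (m - j) * e1 ^ j * e2 ^ (m - j))"
      by (intro sum.cong refl) (simp add: M_def)
    also have "\<dots> = (\<Sum>(j, l)\<in>{(j, l). j + l \<le> tt}. M j l * e1 ^ j * e2 ^ l)"
      by (rule sum.triangle_reindex_eq[symmetric])
    also have "\<dots> = (\<Sum>(j, l)\<in>{..tt} \<times> {..tt}. M j l * e1 ^ j * e2 ^ l)"
      by (rule sum.mono_neutral_left) (auto simp: M_def split: if_splits)
    also have "\<dots> = (\<Sum>j\<le>tt. \<Sum>l\<le>tt. M j l * e1 ^ j * e2 ^ l)"
      by (simp add: sum.cartesian_product)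
    also have "\<dots> = (\<Sum>l\<le>tt. \<Sum>j\<le>tt. M j l * e1 ^ j * e2 ^ l)" by (rule sum.swap)
    finally show "(\<Sum>l\<le>tt. \<Sum>j\<le>tt. M j l * (s + u) ^ j * (s * u) ^ l) = 0"
      by (simp add: e1_def e2_def)
  qed
  then have z: "\<theta> (?b0 ^ i * ?b1 ^ j * ?b2 ^ l) = 0" if "i + j + l = tt" for i j l
  proof -
    have "tt - (j + l) = i" "j + l \<le> tt" "j \<le> tt" "l \<le> tt" using that by auto
    then show ?thesis using \<open>\<And>j l. j \<le> tt \<Longrightarrow> l \<le> tt \<Longrightarrow> M j l = 0\<close>[of j l] by (simp add: M_def)
  qed
  obtain n where n: "tt = Suc n" using tt_pos by (cases tt) auto
  have "f \<in> homog (Suc n)" using f n by simp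
  from \<theta> _ homog_span_L[OF this] show ?thesis
  proof (rule lfun_span_0)
    fix x assume "x \<in> {lin_form e00 ^ i * lin_form e10 ^ j * lin_form e11 ^ l |i j l. i + j + l = Suc n}
     \<union> {al * g |g. g \<in> homog n}"
    then show "\<theta> x = 0"
    proof
      assume "x \<in> {lin_form e00 ^ i * lin_form e10 ^ j * lin_form e11 ^ l |i j l. i + j + l = Suc n}"
      then show ?thesis using z unfolding n by blast
    next
      assume "x \<in> {al * g |g. g \<in> homog n}"
      then show ?thesis using al0 n by auto
    qed
  qed
qed

end

section \<open>The dimension of the cokernel\<close>

context grid_algebra
begin

definition dv :: "'k \<Rightarrow> 'k \<Rightarrow> 'k \<Rightarrow> 'k \<Rightarrow> 'k ^ 4" where
  "dv A B C D = (SOME u. dotp u e00 = A \<and> dotp u e01 = B \<and> dotp u e10 = C \<and> dotp u e11 = D)"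

lemma dv_dotp: "dotp (dv A B C D) e00 = A" "dotp (dv A B C D) e01 = B"
    "dotp (dv A B C D) e10 = C" "dotp (dv A B C D) e11 = D"
  using someI_ex[OF dual[of A B C D]] by (simp_all add: dv_def)

lemma dotp_add: "dotp u (x + y) = dotp u x + dotp u y"
  by (simp add: dotp_def algebra_simps sum.distrib)

lemma dotp_diff: "dotp u (x - y) = dotp u x - dotp u y"
  by (simp add: dotp_def algebra_simps sum_subtractf)

lemma dotp_scale: "dotp u (c *s x) = c * dotp u x"
  by (simp add: dotp_def sum_distrib_left mult_ac)

lemma dotp_dv_gpt: "dotp (dv A B C D) (gpt e00 e01 e10 e11 s u) = ev (biform A B C D) s u"
  by (simp add: gpt_def dotp_add dotp_scale dv_dotp)

text \<open>The planes of \<open>sline\<close> and \<open>schord\<close> in the ambient space. By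
  \<open>dotp_al\<close> they pass through the centre, which is why functionals built from them kill
  all multiples of \<open>al\<close>.\<close>

definition ldual :: "'k \<Rightarrow> 'k ^ 4" where "ldual c = dv (c\<^sup>2) (- c) (- c) 1"
definition cdual :: "'k \<Rightarrow> 'k \<Rightarrow> 'k ^ 4" where "cdual c c' = dv (2 * c * c') (- (c + c')) (- (c + c')) 2"

lemma dotp_ldual [simp]: "dotp (ldual c) (gpt e00 e01 e10 e11 s u) = (s - c) * (u - c)"
  unfolding ldual_def dotp_dv_gpt sline_def[symmetric] by simp

lemma dotp_cdual: "dotp (cdual c c') (gpt e00 e01 e10 e11 s u) = ev (schord c c') s u"
  unfolding cdual_def dotp_dv_gpt schord_def[symmetric] ..

lemma dotp_al [simp]: "dotp (ldual c) (e01 - e10) = 0" "dotp (cdual c c') (e01 - e10) = 0"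
  by (simp_all add: ldual_def cdual_def dotp_diff dv_dotp)

text \<open>The factors of the n-th power of \<open>FF\<close> or \<open>GG\<close>, as a list of
  planes along which to differentiate.\<close>

definition blk :: "(nat \<Rightarrow> 'k) \<Rightarrow> nat \<Rightarrow> ('k ^ 4) list" where
  "blk \<rho> n = concat (replicate n (map (\<lambda>k. ldual (\<rho> k)) [0..<a]))"

definition hlist :: "nat \<Rightarrow> nat \<Rightarrow> ('k ^ 4) list" where
  "hlist k l = map (\<lambda>m. ldual (\<sigma> m)) (filter (\<lambda>m. m \<noteq> k \<and> m \<noteq> l) [0..<r])
    @ (if k = l then [] else [cdual (\<sigma> k) (\<sigma> l)])"

definition blist :: "nat \<times> nat \<times> nat \<Rightarrow> ('k ^ 4) list" where
  "blist = (\<lambda>(i, k, l). blk \<sigma> i @ blk \<upsilon> (q - i) @ hlist k l)"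

lemma length_blk: "length (blk \<rho> n) = n * a"
  by (induction n) (simp_all add: blk_def)

lemma prod_blk: "prod_list (map (\<lambda>u. dotp u (gpt e00 e01 e10 e11 s u')) (blk \<rho> n))
    = (\<Prod>k<a. (s - \<rho> k) * (u' - \<rho> k)) ^ n"
  by (induction n)
    (simp_all add: blk_def comp_def atLeast0LessThan flip: prod.distinct_set_conv_list)

lemma length_hlist:
  assumes "k \<le> l" "l < r"
  shows "length (hlist k l) = r - 1"
proof -
  have "length (filter (\<lambda>m. m \<noteq> k \<and> m \<noteq> l) [0..<r]) = card ({..<r} - {k, l})"
    unfolding distinct_card[OF distinct_filter[OF distinct_upt], symmetric]
    by (intro arg_cong[where f = card]) auto
  also have "\<dots> = r - card {k, l}" using assms by (subst card_Diff_subset) auto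
  finally show ?thesis using assms by (auto simp: hlist_def)
qed

lemma prod_hlist: "prod_list (map (\<lambda>u. dotp u (gpt e00 e01 e10 e11 s u')) (hlist k l)) = ev (HH k l) s u'"
proof -
  have "prod_list (map (\<lambda>m. (s - \<sigma> m) * (u' - \<sigma> m)) (filter (\<lambda>m. m \<noteq> k \<and> m \<noteq> l) [0..<r]))
    = (\<Prod>m\<in>set (filter (\<lambda>m. m \<noteq> k \<and> m \<noteq> l) [0..<r]). (s - \<sigma> m) * (u' - \<sigma> m))"
    by (rule prod.distinct_set_conv_list[symmetric]) simp
  also have "set (filter (\<lambda>m. m \<noteq> k \<and> m \<noteq> l) [0..<r]) = {..<r} - {k, l}" by auto
  finally show ?thesis by (simp add: hlist_def HH_def comp_def dotp_cdual)
qed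

lemma prod_blist:
  assumes "x \<in> Idx q"
  shows "prod_list (map (\<lambda>u. dotp u (gpt e00 e01 e10 e11 s u')) (blist x)) = ev (Bas q x) s u'"
  by (cases x) (simp add: blist_def Bas_def prod_blk prod_hlist FF_def GG_def)

lemma length_blist:
  assumes "x \<in> Idx q"
  shows "length (blist x) = tt"
proof -
  obtain i k l where x: "x = (i, k, l)" "i \<le> q" "k \<le> l" "l < r" using assms by (auto simp: Idx_def)
  have "i * a + (q - i) * a = a * q"
    using x by (metis add_mult_distrib le_add_diff_inverse mult.commute)
  then have "Suc (length (blist x)) = a * q + r"
    using x by (simp add: blist_def length_blk length_hlist)
  then show ?thesis using Suc_tt by simp
qed

text \<open>Each of the n copies contains the plane of node k, which passes through p.\<close>

lemma filter_blk:
  assumes "dotp (ldual (\<rho> k)) p = 0" "k < a"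
  shows "length (filter (\<lambda>u. dotp u p \<noteq> 0) (blk \<rho> n)) \<le> n * (a - 1)"
proof (induction n)
  case (Suc n)
  let ?l = "map (\<lambda>k. ldual (\<rho> k)) [0..<a]"
  have "length (filter (\<lambda>u. dotp u p \<noteq> 0) ?l) < length ?l"
    by (rule length_filter_less[of "ldual (\<rho> k)"]) (use assms in auto)
  then have "length (filter (\<lambda>u. dotp u p \<noteq> 0) ?l) \<le> a - 1" by simp
  with Suc show ?case by (simp add: blk_def)
qed (simp add: blk_def)

text \<open>A grid point lies on a plane of every copy of \<open>FF\<close> and of every copy of
  \<open>GG\<close>, so at most (a - 1) q + (r - 1) = d - 1 planes of the list avoid it.\<close>

lemma dfun_blist_I:
  assumes "x \<in> Idx q" "y \<in> I"
  shows "dfun (blist x) y = 0"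
proof (rule kill[OF lfun_dfun _ assms(2)])
  fix i j g assume ij: "i < a" "j < a"
  obtain i' k l where x: "x = (i', k, l)" "i' \<le> q" "k \<le> l" "l < r" using assms(1) by (auto simp: Idx_def)
  let ?p = "gpt e00 e01 e10 e11 (\<sigma> i) (\<upsilon> j)"
  have "length (filter (\<lambda>u. dotp u ?p \<noteq> 0) (blk \<sigma> i')) \<le> i' * (a - 1)"
    by (rule filter_blk[of _ i]) (use ij in auto)
  moreover have "length (filter (\<lambda>u. dotp u ?p \<noteq> 0) (blk \<upsilon> (q - i'))) \<le> (q - i') * (a - 1)"
    by (rule filter_blk[of _ j]) (use ij in auto)
  moreover have "length (filter (\<lambda>u. dotp u ?p \<noteq> 0) (hlist k l)) \<le> r - 1"
    using length_filter_le length_hlist[OF x(3,4)] by metis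
  moreover have "i' * (a - 1) + (q - i') * (a - 1) = (a - 1) * q"
    using x by (metis add_mult_distrib le_add_diff_inverse mult.commute)
  moreover have "length (filter (\<lambda>u. dotp u ?p \<noteq> 0) (blist x)) =
      length (filter (\<lambda>u. dotp u ?p \<noteq> 0) (blk \<sigma> i')) +
      length (filter (\<lambda>u. dotp u ?p \<noteq> 0) (blk \<upsilon> (q - i'))) +
      length (filter (\<lambda>u. dotp u ?p \<noteq> 0) (hlist k l))"
    by (simp add: blist_def x)
  ultimately have "length (filter (\<lambda>u. dotp u ?p \<noteq> 0) (blist x)) < d"
    using x(4) unfolding d_eq by linarith
  then show "dfun (blist x) (lin_form ?p ^ d * g) = 0" by (rule dfun_power_mult_eq_0)
qed

lemma dfun_blist_al: "dfun (blist x) (al * g) = 0"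
proof -
  have "dotp u (e01 - e10) = 0" if "u \<in> set (blist x)" for u
    using that by (cases x) (auto simp: blist_def blk_def hlist_def split: if_splits)
  then have "filter (\<lambda>u. dotp u (e01 - e10) \<noteq> 0) (blist x) = []" by (simp add: filter_empty_conv)
  then show ?thesis using dfun_power_mult_eq_0[of "e01 - e10" "blist x" 1 g] by (simp add: al_def)
qed

lemma dfun_blist_L:
  assumes "x \<in> Idx q"
  shows "dfun (blist x) (L s u ^ tt) = fact tt * ev (Bas q x) s u"
  using dfun_power[of "blist x"] by (simp add: length_blist[OF assms] prod_blist[OF assms])

section \<open>Exactness of the explicit functionals on the cokernel\<close>

definition WW :: "'k mpoly4 set" where
  "WW = {x. \<exists>g\<in>homog (tt - 1). x - al * g \<in> I}"

lemma I_in_WW: "x \<in> I \<Longrightarrow> x \<in> WW"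
  unfolding WW_def by (intro CollectI bexI[of _ 0]) simp_all

lemma al_in_WW: "g \<in> homog (tt - 1) \<Longrightarrow> al * g \<in> WW"
  unfolding WW_def by (intro CollectI bexI[of _ g]) (simp_all add: zero_mem)

lemma subspace_WW: "mp.subspace WW"
proof (rule mp.subspaceI)
  show "0 \<in> WW" by (rule I_in_WW[OF zero_mem])
  fix x y assume "x \<in> WW" "y \<in> WW"
  then obtain g h where gh: "g \<in> homog (tt - 1)" "x - al * g \<in> I" "h \<in> homog (tt - 1)" "y - al * h \<in> I"
    by (auto simp: WW_def)
  have "x + y - al * (g + h) = (x - al * g) + (y - al * h)" by (simp add: algebra_simps)
  then have "x + y - al * (g + h) \<in> I" using add_mem[OF gh(2,4)] by (simp only:)
  then show "x + y \<in> WW" using homog_add gh unfolding WW_def by blast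
next
  fix c x assume "x \<in> WW"
  then obtain g where g: "g \<in> homog (tt - 1)" "x - al * g \<in> I" by (auto simp: WW_def)
  have "const_poly c * x - al * (const_poly c * g) = const_poly c * (x - al * g)" by (simp add: algebra_simps)
  then have "const_poly c * x - al * (const_poly c * g) \<in> I" using mult_mem[OF g(2)] by simp
  then show "const_poly c * x \<in> WW" using homog_scale[OF g(1)] unfolding WW_def by blast
qed

lemma dfun_blist_WW:
  assumes "x \<in> Idx q" "y \<in> WW"
  shows "dfun (blist x) y = 0"
proof -
  obtain g where "y - al * g \<in> I" using assms by (auto simp: WW_def)
  then have "dfun (blist x) (y - al * g) = 0" using dfun_blist_I assms by blast
  then show ?thesis using dfun_blist_al[of x g] lfun_diff[OF lfun_dfun, of "blist x" y "al * g"] by simp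
qed

text \<open>The upper bound for the cokernel: a functional vanishing on \<open>WW\<close> has its
  polynomial in \<open>VV\<close>, so by \<open>VV_span\<close> it is a combination of the explicit
  functionals on forms of degree \<open>tt\<close>.\<close>

lemma WW_detect:
  assumes y: "y \<in> homog tt" and z: "\<And>x. x \<in> Idx q \<Longrightarrow> dfun (blist x) y = 0"
  shows "y \<in> WW"
proof (rule ccontr)
  assume "y \<notin> WW"
  then obtain \<theta> where \<theta>: "lfun \<theta>" "\<And>x. x \<in> WW \<Longrightarrow> \<theta> x = 0" "\<theta> y \<noteq> 0"
    using lfun_separate[OF subspace_WW] by blast
  have I0: "\<theta> x = 0" if "x \<in> I" for x
    by (rule \<theta>(2)[OF I_in_WW[OF that]])
  have al0: "\<theta> (al * g) = 0" if "g \<in> homog (tt - 1)" for g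
    by (rule \<theta>(2)[OF al_in_WW[OF that]])
  obtain T where T: "\<And>s u. ev T s u = \<theta> (L s u ^ tt)" "bdeg T (a * q + r)" "ords q T"
    using functional_poly[OF \<theta>(1) I0] by blast
  have "\<theta> (L s u ^ tt) = \<theta> (L u s ^ tt)" for s u
    by (rule power_cong_al[OF \<theta>(1) al0, where c = "u - s"]) (simp_all only: L_swap homog_lin_form)
  then have "swap T = T" by (intro swap_eqI) (simp add: T)
  with T have "VV (a * q + r) q T" by (simp add: VV_def)
  then obtain c where c: "T = (\<Sum>x\<in>Idx q. [:[:c x:]:] * Bas q x)" using VV_span by blast
  \<comment> \<open>The difference to the predicted combination; the factorial compensates the one
    in \<open>dfun_blist_L\<close>. It vanishes on powers of \<open>L\<close> and on multiples of
    \<open>al\<close>.\<close>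
  define \<phi> where "\<phi> = (\<lambda>z. \<theta> z - (\<Sum>x\<in>Idx q. c x / fact tt * dfun (blist x) z))"
  have l: "lfun \<phi>"
    unfolding lfun_def \<phi>_def lfun_add[OF \<theta>(1)] lfun_add[OF lfun_dfun]
      lfun_scale[OF \<theta>(1)] lfun_scale[OF lfun_dfun]
    by (simp add: algebra_simps sum.distrib sum_distrib_left)
  have "\<phi> y = 0"
  proof (rule functional_zero[OF l _ _ y])
    show "\<phi> (al * g) = 0" if "g \<in> homog (tt - 1)" for g
      using al0[OF that] by (simp add: \<phi>_def dfun_blist_al)
    fix s u
    have "(\<Sum>x\<in>Idx q. c x / fact tt * dfun (blist x) (L s u ^ tt)) = (\<Sum>x\<in>Idx q. c x * ev (Bas q x) s u)"
      by (intro sum.cong refl) (simp add: dfun_blist_L)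
    also have "\<dots> = ev T s u" unfolding c ev_sum ev_simps by simp
    finally show "\<phi> (L s u ^ tt) = 0" by (simp add: \<phi>_def T)
  qed
  then have "\<theta> y = 0" using z by (simp add: \<phi>_def)
  with \<theta>(3) show False by simp
qed

text \<open>The lower bound for the cokernel: on powers of \<open>L\<close> a relation among the
  functionals becomes a relation among the polynomials \<open>Bas\<close>.\<close>

lemma dfun_independent:
  assumes "\<And>y. y \<in> homog tt \<Longrightarrow> (\<Sum>x\<in>Idx q. c x * dfun (blist x) y) = 0"
  shows "\<forall>x\<in>Idx q. c x = 0"
proof -
  have "(\<Sum>x\<in>Idx q. [:[:c x:]:] * Bas q x) = 0"
  proof (rule ev_ext)
    fix s u
    have "0 = (\<Sum>x\<in>Idx q. c x * dfun (blist x) (L s u ^ tt))"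
      using assms[OF homog_L] by simp
    also have "\<dots> = fact tt * (\<Sum>x\<in>Idx q. c x * ev (Bas q x) s u)"
      unfolding sum_distrib_left by (intro sum.cong refl) (simp add: dfun_blist_L)
    finally show "ev (\<Sum>x\<in>Idx q. [:[:c x:]:] * Bas q x) s u = ev 0 s u"
      unfolding ev_sum ev_simps by simp
  qed
  then show ?thesis using Bas_independent by blast
qed

lemma quot_basis_coker:
  obtains B where "quot_basis (homog tt) WW B" "card B = card (Idx q)"
proof -
  have "\<exists>x. \<forall>j\<in>Idx q. x j \<in> homog tt \<and> (\<forall>i\<in>Idx q. dfun (blist i) (x j) = (if i = j then 1 else 0))"
    by (rule dual_elements[OF finite_Idx subspace_homog lfun_dfun]) (rule dfun_independent)
  then obtain x where x: "\<And>j. j \<in> Idx q \<Longrightarrow> x j \<in> homog tt"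
    "\<And>i j. i \<in> Idx q \<Longrightarrow> j \<in> Idx q \<Longrightarrow> dfun (blist i) (x j) = (if i = j then 1 else 0)" by blast
  have inj: "inj_on x (Idx q)"
  proof (rule inj_onI)
    fix i j assume "i \<in> Idx q" "j \<in> Idx q" "x i = x j"
    then show "i = j" using x(2)[of i i] x(2)[of i j] by (auto split: if_splits)
  qed
  have val: "dfun (blist i) (\<Sum>b\<in>x ` Idx q. const_poly (c b) * b) = c (x i)" if i: "i \<in> Idx q" for c i
  proof -
    have "dfun (blist i) (\<Sum>b\<in>x ` Idx q. const_poly (c b) * b)
      = (\<Sum>j\<in>Idx q. c (x j) * dfun (blist i) (x j))"
      by (simp add: sum.reindex[OF inj] lfun_sum[OF lfun_dfun] lfun_scale[OF lfun_dfun])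
    also have "\<dots> = (\<Sum>j\<in>Idx q. if j = i then c (x i) else 0)"
      using x(2) i by (intro sum.cong) auto
    finally show ?thesis using i finite_Idx by simp
  qed
  have "quot_basis (homog tt) WW (x ` Idx q)"
    unfolding quot_basis_def
  proof (intro conjI ballI allI impI)
    show "finite (x ` Idx q)" "x ` Idx q \<subseteq> homog tt" using finite_Idx x(1) by auto
    fix y :: "'k mpoly4" assume y: "y \<in> homog tt"
    define c where "c = (\<lambda>b. dfun (blist (the_inv_into (Idx q) x b)) y)"
    have ci: "c (x i) = dfun (blist i) y" if "i \<in> Idx q" for i
      using that by (simp add: c_def the_inv_into_f_f[OF inj])
    have "y - (\<Sum>b\<in>x ` Idx q. const_poly (c b) * b) \<in> WW"
    proof (rule WW_detect)
      show "y - (\<Sum>b\<in>x ` Idx q. const_poly (c b) * b) \<in> homog tt"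
        by (intro mp.subspace_diff subspace_homog y mp.subspace_sum mp.subspace_scale) (use x in auto)
    qed (simp add: lfun_diff[OF lfun_dfun] val ci)
    then show "\<exists>c. y - (\<Sum>b\<in>x ` Idx q. const_poly (c b) * b) \<in> WW" by blast
  next
    fix c b assume "(\<Sum>b\<in>x ` Idx q. const_poly (c b) * b) \<in> WW" "b \<in> x ` Idx q"
    then show "c b = 0" using dfun_blist_WW val by fastforce
  qed
  then show ?thesis using that card_image[OF inj] by blast
qed

lemma dim_coker:
  "vectorspace.dim class_ring (mult_coker I al (tt - 1) tt) = (q + 1) * ((r + 1) choose 2)"
proof -
  obtain B where B: "quot_basis (homog tt) WW B" "card B = card (Idx q)" using quot_basis_coker .
  show ?thesis
    using module_image.dim_eq[OF module_image_coker[of al "tt - 1" tt]] B card_Idx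
    unfolding WW_def by simp
qed

end

section \<open>An element of the kernel\<close>

text \<open>Lagrange interpolation; the weights are the values at x of the Lagrange polynomials of
  J.\<close>

lemma interpolation_relation:
  fixes \<sigma> :: "nat \<Rightarrow> 'k::field"
  assumes "finite J" "inj_on \<sigma> J"
  shows "\<exists>c. \<forall>p. (\<forall>j\<ge>card J. coeff p j = 0) \<longrightarrow> poly p x = (\<Sum>j\<in>J. c j * poly p (\<sigma> j))"
proof -
  define Lg where "Lg = (\<lambda>j. \<Prod>i\<in>J - {j}. Polynomial.smult (1 / (\<sigma> j - \<sigma> i)) [:- \<sigma> i, 1:])"
  have Lg_ev: "poly (Lg j) (\<sigma> i) = (if i = j then 1 else 0)" if "i \<in> J" "j \<in> J" for i j
  proof (cases "i = j")
    case True
    have "poly (Lg j) (\<sigma> j) = 1" unfolding Lg_def poly_prod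
      using assms that by (intro prod.neutral) (auto simp: inj_on_def simp flip: diff_divide_distrib)
    then show ?thesis using True by simp
  next
    case False
    then have "poly (Lg j) (\<sigma> i) = 0" unfolding Lg_def poly_prod
      using assms that by (intro prod_zero) (auto intro!: bexI[of _ i])
    then show ?thesis using False by simp
  qed
  have "poly p x = (\<Sum>j\<in>J. poly (Lg j) x * poly p (\<sigma> j))" if p: "\<forall>j\<ge>card J. coeff p j = 0" for p
  proof -
    define D where "D = p - (\<Sum>j\<in>J. Polynomial.smult (poly p (\<sigma> j)) (Lg j))"
    have "D = 0"
    proof (rule poly_eq_0_many_roots[of J \<sigma> "\<lambda>_. 1"])
      fix i assume i: "i \<in> J"
      have "(\<Sum>j\<in>J. poly p (\<sigma> j) * poly (Lg j) (\<sigma> i)) = (\<Sum>j\<in>J. if j = i then poly p (\<sigma> i) else 0)"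
        using Lg_ev i by (intro sum.cong) auto
      then have "poly D (\<sigma> i) = 0" using i assms by (simp add: D_def poly_sum)
      then show "[:- \<sigma> i, 1:] ^ 1 dvd D" by (simp add: poly_eq_0_iff_dvd)
    next
      fix m :: nat assume m: "(\<Sum>i\<in>J. 1) \<le> m"
      have "coeff (Lg j) m = 0" if j: "j \<in> J" for j
      proof (rule coeff_eq_0)
        have "degree (Lg j) \<le> (\<Sum>i\<in>J - {j}. degree (Polynomial.smult (1 / (\<sigma> j - \<sigma> i)) [:- \<sigma> i, 1:]))"
          unfolding Lg_def by (rule order_trans[OF degree_prod_sum_le]) (use assms in \<open>simp_all add: comp_def\<close>)
        also have "\<dots> \<le> (\<Sum>i\<in>J - {j}. 1)"
          by (intro sum_mono order_trans[OF degree_smult_le]) simp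
        also have "\<dots> = card J - 1" using j assms by simp
        also have "\<dots> < m"
        proof -
          have "card J \<le> m" using m by simp
          moreover have "card J > 0" using j assms by (auto simp: card_gt_0_iff)
          ultimately show ?thesis by linarith
        qed
        finally show "degree (Lg j) < m" .
      qed
      then show "coeff D m = 0" using p m by (simp add: D_def coeff_sum)
    qed (use assms in auto)
    then have "poly p x - poly (\<Sum>j\<in>J. Polynomial.smult (poly p (\<sigma> j)) (Lg j)) x = poly 0 x"
      unfolding D_def poly_diff[symmetric] by (rule arg_cong)
    then show ?thesis by (simp add: poly_sum mult.commute)
  qed
  then show ?thesis by (intro exI[of _ "\<lambda>j. poly (Lg j) x"] allI impI)
qed

lemma dders_append: "dders (us @ vs) f = dders us (dders vs f)"
  by simp

lemma dders_0: "dders us 0 = 0"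
  by (induction us) simp_all

text \<open>All derivatives of a polynomial in the two forms are again polynomials in them, and u
  annihilates every such polynomial, wherever it stands in the list.\<close>

lemma dders_both_vanish:
  assumes "u \<in> set us" "dotp u p = 0" "dotp u p' = 0"
  shows "dders us (lin_form p ^ x * lin_form p' ^ y) = 0"
proof -
  let ?S = "mp.span {lin_form p ^ x * lin_form p' ^ y |x y. True}"
  have mon: "lin_form p ^ x * lin_form p' ^ y \<in> ?S" for x y
    by (intro mp.span_base) blast
  have dmon: "dderiv u (lin_form p ^ x * lin_form p' ^ y) =
     const_poly (of_nat x * dotp u p) * (lin_form p ^ (x - 1) * lin_form p' ^ y) +
     const_poly (of_nat y * dotp u p') * (lin_form p ^ x * lin_form p' ^ (y - 1))" for u x y
    by (simp add: dderiv_mult dderiv_lin_form_power mult_ac)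
  have der: "dderiv u f \<in> ?S \<and> (dotp u p = 0 \<longrightarrow> dotp u p' = 0 \<longrightarrow> dderiv u f = 0)" if "f \<in> ?S" for u f
    using that
  proof (induction rule: mp.span_induct_alt)
    case (step c f g)
    then obtain x y where f: "f = lin_form p ^ x * lin_form p' ^ y" by blast
    have "dderiv u f \<in> ?S" unfolding f dmon by (intro mp.span_add mp.span_scale mon)
    then have "dderiv u (const_poly c * f + g) \<in> ?S"
      using step unfolding dderiv_add dderiv_scale by (intro mp.span_add mp.span_scale) auto
    moreover have "dderiv u f = 0" if "dotp u p = 0" "dotp u p' = 0"
      unfolding f dmon using that by simp
    ultimately show ?case using step by (auto simp: dderiv_add dderiv_scale)
  qed (simp add: mp.span_zero)
  have ders: "dders us f \<in> ?S" if "f \<in> ?S" for us f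
    using that
  proof (induction us)
    case (Cons v us)
    then show ?case using der[of "dders us f" v] by (simp only: foldr.simps comp_apply)
  qed simp
  obtain vs ws where us: "us = vs @ u # ws" using split_list[OF assms(1)] by blast
  have "dderiv u (dders ws (lin_form p ^ x * lin_form p' ^ y)) = 0"
    using der[OF ders[OF mon]] assms by blast
  then show ?thesis by (simp add: us dders_0)
qed

text \<open>N is the falling factorial x (x - 1) ... (x - k + 1); all that matters later is that it
  is a natural number and when it is positive.\<close>

lemma dders_replicate:
  assumes "dderiv u g = 0" "dotp u p = \<beta>"
  shows "\<exists>N::nat. dders (replicate k u) (lin_form p ^ x * g) = const_poly (of_nat N * \<beta> ^ k) * (lin_form p ^ (x - k) * g)
     \<and> (N > 0 \<longleftrightarrow> k \<le> x)"
proof (induction k)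
  case (Suc k)
  then obtain N where N: "dders (replicate k u) (lin_form p ^ x * g) = const_poly (of_nat N * \<beta> ^ k) * (lin_form p ^ (x - k) * g)"
    "N > 0 \<longleftrightarrow> k \<le> x" by blast
  have "dders (replicate (Suc k) u) (lin_form p ^ x * g)
    = const_poly (of_nat N * \<beta> ^ k) * (const_poly (of_nat (x - k) * \<beta>) * lin_form p ^ (x - k - 1) * g)"
    by (simp only: replicate_Suc foldr.simps comp_apply N dderiv_scale dderiv_mult[of u _ g] assms
        dderiv_lin_form_power mult_zero_right add_0_right)
  also have "\<dots> = const_poly (of_nat (N * (x - k)) * \<beta> ^ Suc k) * (lin_form p ^ (x - Suc k) * g)"
    by (simp add: mult_ac)
  finally have "dders (replicate (Suc k) u) (lin_form p ^ x * g) = const_poly (of_nat (N * (x - k)) * \<beta> ^ Suc k) * (lin_form p ^ (x - Suc k) * g)" .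
  moreover have "N * (x - k) > 0 \<longleftrightarrow> Suc k \<le> x" using N(2) by auto
  ultimately show ?case by (intro exI[of _ "N * (x - k)"] conjI)
qed (intro exI[of _ 1], simp)

text \<open>Every plane of the list contains the difference of the two points, so the functional
  cannot distinguish their linear forms.\<close>

lemma dfun_equal_points:
  fixes p p' :: "'k::field_char_0 ^ 4"
  assumes eq: "\<And>u. u \<in> set us \<Longrightarrow> dotp u p = dotp u p'" and len: "length us = x + y"
  shows "dfun us (lin_form p ^ x * lin_form p' ^ y) = fact (length us) * prod_list (map (\<lambda>u. dotp u p) us)"
proof -
  have dz: "dotp u (p - p') = 0" if "u \<in> set us" for u
    using eq[OF that] by (simp add: dotp_def algebra_simps sum_subtractf)
  have "filter (\<lambda>u. dotp u (p - p') \<noteq> 0) us = []" using dz by (simp add: filter_empty_conv)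
  then have z: "dfun us (lin_form (p - p') * g) = 0" for g
    using dfun_power_mult_eq_0[of "p - p'" us 1 g] by simp
  have "dfun us (lin_form p' ^ y * g) = dfun us (lin_form p ^ y * g)" for g
  proof -
    have "lin_form p ^ y * g - lin_form p' ^ y * g = lin_form (p - p') * ((\<Sum>i<y. lin_form p' ^ (y - Suc i) * lin_form p ^ i) * g)"
      unfolding left_diff_distrib[symmetric] diff_power_factor lin_form_minus by (simp only: mult.assoc)
    then show ?thesis using z lfun_diff[OF lfun_dfun, of us "lin_form p ^ y * g" "lin_form p' ^ y * g"] by simp
  qed
  from this[of "lin_form p ^ x"]
  have "dfun us (lin_form p ^ x * lin_form p' ^ y) = dfun us (lin_form p ^ length us)"
    by (simp add: len power_add mult.commute)
  then show ?thesis using dfun_power by simp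
qed

context grid_algebra
begin

definition gam :: "nat \<Rightarrow> 'k" where "gam i = (\<Prod>k<a. \<sigma> i - \<upsilon> k)"

lemma gam_nonzero: "i < a \<Longrightarrow> gam i \<noteq> 0"
  using ne by (auto simp: gam_def)

text \<open>The elements \<open>\<Sum> c\<^sub>j \<gamma>\<^sub>j\<^sup>-\<^sup>q L(\<sigma>\<^sub>i, \<sigma>\<^sub>j)\<^sup>t\<close> supported on one line of the first ruling lie in the ideal:
  a functional killing it takes the form \<open>g(u)\<^sup>q e(u)\<close> along the line, with \<open>e\<close> of degree less than \<open>r\<close>.\<close>
lemma line_relation:
  assumes \<theta>: "lfun \<theta>" and I0: "\<And>x. x \<in> I \<Longrightarrow> \<theta> x = 0" and i: "i < a" and S: "S \<subseteq> {..<a}"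
    and c: "\<And>p. (\<forall>j\<ge>r. coeff p j = 0) \<Longrightarrow> (\<Sum>j\<in>S. c j * poly p (\<sigma> j)) = 0"
  shows "(\<Sum>j\<in>S. c j / gam j ^ q * \<theta> (L (\<sigma> i) (\<sigma> j) ^ tt)) = 0"
proof -
  obtain T where T: "\<And>s u. ev T s u = \<theta> (L s u ^ tt)" "bdeg T (a * q + r)" "ords q T"
    using functional_poly[OF \<theta> I0] by blast
  define p where "p = poly T [:\<sigma> i:]"
  have pu: "poly p u = \<theta> (L (\<sigma> i) u ^ tt)" for u using T(1) by (simp add: p_def ev_def)
  have pz: "coeff p j = 0" if "a * q + r \<le> j" for j
    unfolding p_def by (rule bdeg_poly_const[OF T(2) that])
  have "(\<Prod>k<a. [:- \<upsilon> k, 1:] ^ q) dvd p"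
    by (rule prod_powers_dvd) (use inj_v T(3) i in \<open>auto simp: p_def ords_def intro: poly_idpow_root\<close>)
  then obtain e where e: "p = (\<Prod>k<a. [:- \<upsilon> k, 1:] ^ q) * e" by blast
  have "coeff e j = 0" if "r \<le> j" for j
  proof (rule ccontr)
    assume "coeff e j \<noteq> 0"
    then have e0: "e \<noteq> 0" and "j \<le> degree e" by (auto intro: le_degree)
    have "degree (\<Prod>k<a. [:- \<upsilon> k, 1:] ^ q) = (\<Sum>k<a. degree ([:- \<upsilon> k, 1:] ^ q))"
      by (rule degree_prod_eq_sum_degree) simp
    also have "\<dots> = a * q" by (simp add: degree_power_eq)
    finally have "degree p = a * q + degree e" unfolding e using e0 by (subst degree_mult_eq) auto
    then have "coeff p (degree p) = 0" using pz \<open>j \<le> degree e\<close> that by simp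
    then have "p = 0" by (simp add: leading_coeff_0_iff)
    then show False using e e0 by simp
  qed
  then have "(\<Sum>j\<in>S. c j * poly e (\<sigma> j)) = 0" using c by blast
  moreover have "c j / gam j ^ q * \<theta> (L (\<sigma> i) (\<sigma> j) ^ tt) = c j * poly e (\<sigma> j)" if "j \<in> S" for j
  proof -
    have "\<theta> (L (\<sigma> i) (\<sigma> j) ^ tt) = gam j ^ q * poly e (\<sigma> j)"
      unfolding pu[symmetric] e by (simp add: poly_prod gam_def prod_power_distrib)
    then show ?thesis using gam_nonzero[of j] S that by auto
  qed
  ultimately show ?thesis by simp
qed

text \<open>A weight annihilating all polynomials of degree less than r needs r + 1 nodes. The two
  sets share the first r nodes, so (r, r + 1) is the only pair in \<open>S1\<close> times
  \<open>S2\<close> avoiding those nodes; r < a - 1 makes room for both last nodes.\<close>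

definition S1 :: "nat set" where "S1 = insert r {..<r}"
definition S2 :: "nat set" where "S2 = insert (Suc r) {..<r}"

lemma S12: "S1 \<subseteq> {..<a}" "S2 \<subseteq> {..<a}" "finite S1" "finite S2"
  using r_less by (auto simp: S1_def S2_def)

text \<open>The value at node n is interpolated from the first r nodes; the difference is the
  relation, normalised at n.\<close>

lemma weights_exist:
  assumes "n \<ge> r"
  shows "\<exists>c. c n = 1 \<and> (\<forall>p. (\<forall>j\<ge>r. coeff p j = 0) \<longrightarrow> (\<Sum>j\<in>insert n {..<r}. c j * poly p (\<sigma> j)) = 0)"
proof -
  have "inj_on \<sigma> {..<r}" using inj_s ra by (auto simp: inj_on_def)
  then obtain c where c: "\<And>p. (\<forall>j\<ge>r. coeff p j = 0) \<Longrightarrow> poly p (\<sigma> n) = (\<Sum>j<r. c j * poly p (\<sigma> j))"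
    using interpolation_relation[of "{..<r}" \<sigma> "\<sigma> n"] by auto
  define c' where "c' = (\<lambda>j. if j = n then 1 else - c j)"
  have "(\<Sum>j\<in>insert n {..<r}. c' j * poly p (\<sigma> j)) = 0" if "\<forall>j\<ge>r. coeff p j = 0" for p
  proof -
    have "(\<Sum>j<r. c' j * poly p (\<sigma> j)) = - (\<Sum>j<r. c j * poly p (\<sigma> j))"
      unfolding sum_negf[symmetric] using assms by (intro sum.cong) (auto simp: c'_def)
    then show ?thesis using c[OF that] assms by (simp add: c'_def)
  qed
  then show ?thesis by (intro exI[of _ c']) (simp add: c'_def)
qed

text \<open>The planes dual to \<open>h1\<close> and \<open>h2\<close> contain the lines \<open>s = \<sigma>\<^sub>r\<close> and \<open>s = \<sigma>\<^sub>r\<^sub>+\<^sub>1\<close>; each of them vanishes at exactly one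
  of the points \<open>(\<sigma>\<^sub>r, \<sigma>\<^sub>r\<^sub>+\<^sub>1)\<close> and \<open>(\<sigma>\<^sub>r\<^sub>+\<^sub>1, \<sigma>\<^sub>r)\<close>, whereas the planes in \<open>As\<close> take equal values there.\<close>
definition h1 :: "'k ^ 4" where
  "h1 = dv (\<sigma> r * \<sigma> (Suc r)) (- \<sigma> r) (- \<sigma> (Suc r)) 1"
definition h2 :: "'k ^ 4" where
  "h2 = dv (\<sigma> r * \<sigma> (Suc r)) (- \<sigma> (Suc r)) (- \<sigma> r) 1"

lemma dotp_h: "dotp h1 (gpt e00 e01 e10 e11 s u) = (s - \<sigma> r) * (u - \<sigma> (Suc r))"
    "dotp h2 (gpt e00 e01 e10 e11 s u) = (s - \<sigma> (Suc r)) * (u - \<sigma> r)"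
  by (simp_all add: h1_def h2_def dotp_dv_gpt algebra_simps)

definition K0 :: "('k ^ 4) list" where
  "K0 = map (\<lambda>k. ldual (\<sigma> k)) (filter (\<lambda>k. k \<noteq> r \<and> k \<noteq> Suc r) [0..<a])"

text \<open>\<open>K0\<close> omits the nodes r and r + 1, so its planes avoid the two points that
  must survive. Besides q copies of it and the list \<open>Hs\<close>, r planes are missing to reach
  degree \<open>tt - 1\<close>; \<open>ldual (\<upsilon> 0)\<close> fills the gap and by
  \<open>ne\<close> also avoids both points.\<close>

definition As :: "('k ^ 4) list" where
  "As = concat (replicate q K0) @ replicate r (ldual (\<upsilon> 0))"

definition Hs :: "('k ^ 4) list" where
  "Hs = replicate (q - 1) h1 @ replicate (q - 1) h2"

lemma length_K0: "length K0 = a - 2"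
proof -
  have "length K0 = card ({..<a} - {r, Suc r})"
    unfolding K0_def length_map distinct_card[OF distinct_filter[OF distinct_upt], symmetric]
    by (intro arg_cong[where f = card]) auto
  also have "\<dots> = a - card {r, Suc r}" using r_less by (subst card_Diff_subset) auto
  finally show ?thesis by simp
qed

lemma length_concat_replicate: "length (concat (replicate n xs)) = n * length xs"
  by (induction n) simp_all

lemma length_As: "length As = q * (a - 2) + r"
  by (simp add: As_def length_concat_replicate length_K0)

lemma tt_split: "tt - 1 = (q - 1) + (q - 1) + (q * (a - 2) + r)"
proof -
  define b where "b = a - 2"
  then have b: "a = b + 2" using r_less by simp
  obtain p where p: "q = Suc p" using q1 by (cases q) auto
  show ?thesis using Suc_tt by (simp add: b p algebra_simps)
qed

text \<open>Here d = q (a - 2) + q + r. On a line of node r or r + 1 a whole block of q - 1 planes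
  in \<open>Hs\<close> passes through the grid point, leaving at most d - 1. At any other grid point
  each copy of \<open>K0\<close> loses a plane, leaving at most d - 2.\<close>

lemma dfun_AH_I:
  assumes "y \<in> I"
  shows "dfun (As @ Hs) y = 0"
proof (rule kill[OF lfun_dfun _ assms])
  fix i j g assume ij: "i < a" "j < a"
  let ?p = "gpt e00 e01 e10 e11 (\<sigma> i) (\<upsilon> j)"
  let ?n = "\<lambda>us. length (filter (\<lambda>u. dotp u ?p \<noteq> 0) us)"
  have rep: "?n (concat (replicate n us)) = n * ?n us" for n us
    by (induction n) simp_all
  have eq: "?n (As @ Hs) = q * ?n K0 + ?n (replicate r (ldual (\<upsilon> 0))) + ?n (replicate (q - 1) h1) + ?n (replicate (q - 1) h2)"
    by (simp add: As_def Hs_def rep)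
  have le: "?n (replicate m u) \<le> m" for m u by (metis length_filter_le length_replicate)
  have K0le: "?n K0 \<le> a - 2" using length_filter_le length_K0 by metis
  have da: "d = q * (a - 2) + q + r"
  proof -
    have "a - 1 = (a - 2) + 1" using r_less by simp
    then show ?thesis using d_eq by (simp add: algebra_simps)
  qed
  have "?n (As @ Hs) < d"
  proof (cases "i = r \<or> i = Suc r")
    case True
    then have "?n (replicate (q - 1) h1) = 0 \<or> ?n (replicate (q - 1) h2) = 0"
      by (auto simp: dotp_h)
    moreover have "q * ?n K0 \<le> q * (a - 2)" using K0le by simp
    ultimately show ?thesis
      using le[of r "ldual (\<upsilon> 0)"] le[of "q - 1" h1] le[of "q - 1" h2] q1 unfolding eq da by linarith
  next
    case False
    have "?n K0 < length K0"
      by (rule length_filter_less[of "ldual (\<sigma> i)"]) (use False ij in \<open>auto simp: K0_def\<close>)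
    then have "?n K0 + 1 \<le> a - 2" by (simp add: length_K0)
    then have "q * (?n K0 + 1) \<le> q * (a - 2)" by (intro mult_le_mono) auto
    then have "q * ?n K0 + q \<le> q * (a - 2)" by simp
    then show ?thesis
      using le[of r "ldual (\<upsilon> 0)"] le[of "q - 1" h1] le[of "q - 1" h2] q1 unfolding eq da by linarith
  qed
  then show "dfun (As @ Hs) (lin_form ?p ^ d * g) = 0" by (rule dfun_power_mult_eq_0)
qed

text \<open>The cofactor of L(\<open>\<sigma> i\<close>, \<open>\<sigma> j\<close>) -
  L(\<open>\<sigma> j\<close>, \<open>\<sigma> i\<close>) in the difference of the
  \<open>tt\<close>-th powers.\<close>

definition Mix :: "nat \<Rightarrow> nat \<Rightarrow> 'k mpoly4" where
  "Mix i j = (\<Sum>m<tt. L (\<sigma> j) (\<sigma> i) ^ (tt - Suc m) * L (\<sigma> i) (\<sigma> j) ^ m)"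

text \<open>Any other pair involves a node k < r, and the plane of k, which occurs in
  \<open>K0\<close>, contains both (\<open>\<sigma> i\<close>, \<open>\<sigma> j\<close>) and its
  mirror image.\<close>

lemma dfun_AH_Mix_0:
  assumes "i \<in> S1" "j \<in> S2" "(i, j) \<noteq> (r, Suc r)"
  shows "dfun (As @ Hs) (Mix i j) = 0"
proof -
  have "\<exists>k<a. k \<noteq> r \<and> k \<noteq> Suc r \<and> (k = i \<or> k = j)"
  proof (cases "i < r")
    case True
    then show ?thesis using ra by (intro exI[of _ i]) auto
  next
    case False
    then have "j < r" using assms by (auto simp: S1_def S2_def)
    then show ?thesis using ra by (intro exI[of _ j]) auto
  qed
  then obtain k where k: "k < a" "k \<noteq> r" "k \<noteq> Suc r" "k = i \<or> k = j" by blast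
  then have "ldual (\<sigma> k) \<in> set (As @ Hs)" using q1 by (auto simp: As_def K0_def)
  then have "dders (As @ Hs) (L (\<sigma> j) (\<sigma> i) ^ x * L (\<sigma> i) (\<sigma> j) ^ y) = 0" for x y
    by (rule dders_both_vanish) (use k in auto)
  then show ?thesis unfolding Mix_def lfun_sum[OF lfun_dfun] by (simp add: dfun_def)
qed

text \<open>\<open>h1\<close> differentiates only the powers at the mirror point and
  \<open>h2\<close> only those at the point itself, while \<open>As\<close> does not distinguish
  them. So all summands are natural multiples of one nonzero constant and cannot cancel in
  characteristic zero.\<close>

lemma dfun_AH_Mix: "dfun (As @ Hs) (Mix r (Suc r)) \<noteq> 0"
proof -
  let ?p = "gpt e00 e01 e10 e11 (\<sigma> r) (\<sigma> (Suc r))" and ?p' = "gpt e00 e01 e10 e11 (\<sigma> (Suc r)) (\<sigma> r)"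
  define \<delta> where "\<delta> = (\<sigma> r - \<sigma> (Suc r)) * (\<sigma> (Suc r) - \<sigma> r)"
  have lt: "r < a" "Suc r < a" using r_less by auto
  have \<delta>: "\<delta> \<noteq> 0" using s_eq_iff[OF lt] by (auto simp: \<delta>_def)
  have hp: "dotp h1 ?p = 0" "dotp h1 ?p' = \<delta>" "dotp h2 ?p = \<delta>" "dotp h2 ?p' = 0"
    by (simp_all add: dotp_h \<delta>_def mult.commute)
  \<comment> \<open>The common constant: q - 1 contributions from each of \<open>h1\<close> and
    \<open>h2\<close>, times the value of \<open>As\<close> on a power.\<close>
  define C where "C = \<delta> ^ (q - 1) * \<delta> ^ (q - 1) * (fact (length As) * prod_list (map (\<lambda>u. dotp u ?p') As))"
  have As_eq: "dotp u ?p' = dotp u ?p" and As_nz: "dotp u ?p' \<noteq> 0" if u: "u \<in> set As" for u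
  proof -
    have "u = ldual (\<upsilon> 0) \<or> (\<exists>k<a. k \<noteq> r \<and> k \<noteq> Suc r \<and> u = ldual (\<sigma> k))"
      using u by (auto simp: As_def K0_def split: if_splits)
    then obtain c where c: "u = ldual c" "c = \<upsilon> 0 \<or> (\<exists>k<a. k \<noteq> r \<and> k \<noteq> Suc r \<and> c = \<sigma> k)"
      by blast
    then show "dotp u ?p' = dotp u ?p" by (simp add: mult.commute)
    have "\<sigma> r \<noteq> c" "\<sigma> (Suc r) \<noteq> c" using c(2) ne[of _ 0] lt s_eq_iff by auto
    then show "dotp u ?p' \<noteq> 0" by (simp add: c(1))
  qed
  have "prod_list (map (\<lambda>u. dotp u ?p') As) \<noteq> 0" using As_nz by (auto simp: prod_list_zero_iff)
  then have C0: "C \<noteq> 0" using \<delta> by (simp add: C_def)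
  have val: "\<exists>N::nat. dfun (As @ Hs) (lin_form ?p' ^ x * lin_form ?p ^ y) = of_nat N * C \<and>
      (q - 1 \<le> x \<longrightarrow> q - 1 \<le> y \<longrightarrow> N > 0)" if xy: "x + y = tt - 1" for x y
  proof -
    have "dderiv h2 (lin_form ?p' ^ x) = 0" by (simp add: dderiv_lin_form_power hp)
    from dders_replicate[OF this hp(3), of "q - 1" y]
    obtain N2 :: nat where N2: "dders (replicate (q - 1) h2) (lin_form ?p ^ y * lin_form ?p' ^ x)
      = const_poly (of_nat N2 * \<delta> ^ (q - 1)) * (lin_form ?p ^ (y - (q - 1)) * lin_form ?p' ^ x)"
      "N2 > 0 \<longleftrightarrow> q - 1 \<le> y" by blast
    have "dderiv h1 (lin_form ?p ^ (y - (q - 1))) = 0" by (simp add: dderiv_lin_form_power hp)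
    from dders_replicate[OF this hp(2), of "q - 1" x]
    obtain N1 :: nat where N1: "dders (replicate (q - 1) h1) (lin_form ?p' ^ x * lin_form ?p ^ (y - (q - 1)))
      = const_poly (of_nat N1 * \<delta> ^ (q - 1)) * (lin_form ?p' ^ (x - (q - 1)) * lin_form ?p ^ (y - (q - 1)))"
      "N1 > 0 \<longleftrightarrow> q - 1 \<le> x" by blast
    have "dders Hs (lin_form ?p' ^ x * lin_form ?p ^ y) =
      dders (replicate (q - 1) h1) (dders (replicate (q - 1) h2) (lin_form ?p ^ y * lin_form ?p' ^ x))"
      by (simp add: Hs_def mult.commute)
    also have "\<dots> = const_poly (of_nat N2 * \<delta> ^ (q - 1)) * (const_poly (of_nat N1 * \<delta> ^ (q - 1)) *
      (lin_form ?p' ^ (x - (q - 1)) * lin_form ?p ^ (y - (q - 1))))"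
      unfolding N2 dders_scale N1(1)[symmetric] by (simp only: mult.commute)
    finally have Hs: "dfun (As @ Hs) (lin_form ?p' ^ x * lin_form ?p ^ y) = of_nat N2 * \<delta> ^ (q - 1) *
      (of_nat N1 * \<delta> ^ (q - 1) * dfun As (lin_form ?p' ^ (x - (q - 1)) * lin_form ?p ^ (y - (q - 1))))"
      by (simp only: dfun_def dders_append dders_scale const_coeff_simps)
    show ?thesis
    proof (cases "q - 1 \<le> x \<and> q - 1 \<le> y")
      case True
      have "dfun As (lin_form ?p' ^ (x - (q - 1)) * lin_form ?p ^ (y - (q - 1)))
        = fact (length As) * prod_list (map (\<lambda>u. dotp u ?p') As)"
        by (rule dfun_equal_points[OF As_eq]) (use True xy tt_split length_As in auto)
      then have "dfun (As @ Hs) (lin_form ?p' ^ x * lin_form ?p ^ y) = of_nat (N1 * N2) * C"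
        unfolding Hs by (simp add: C_def mult_ac)
      then show ?thesis using True N1(2) N2(2) by (intro exI[of _ "N1 * N2"]) simp
    next
      case False
      then have "N1 = 0 \<or> N2 = 0" using N1(2) N2(2) by auto
      then show ?thesis using False Hs by (intro exI[of _ 0]) auto
    qed
  qed
  have "\<forall>m<tt. \<exists>N::nat. dfun (As @ Hs) (lin_form ?p' ^ (tt - Suc m) * lin_form ?p ^ m) = of_nat N * C \<and>
      (q - 1 \<le> tt - Suc m \<longrightarrow> q - 1 \<le> m \<longrightarrow> N > 0)"
    using val by (simp add: le_Suc_eq)
  then obtain N :: "nat \<Rightarrow> nat" where N: "\<And>m. m < tt \<Longrightarrow> dfun (As @ Hs) (lin_form ?p' ^ (tt - Suc m) * lin_form ?p ^ m) = of_nat (N m) * C"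
    "\<And>m. m < tt \<Longrightarrow> q - 1 \<le> tt - Suc m \<Longrightarrow> q - 1 \<le> m \<Longrightarrow> N m > 0"
    by metis
  have "dfun (As @ Hs) (Mix r (Suc r)) = (\<Sum>m<tt. of_nat (N m) * C)"
    unfolding Mix_def lfun_sum[OF lfun_dfun] by (intro sum.cong refl) (simp add: N)
  also have "\<dots> = of_nat (\<Sum>m<tt. N m) * C" by (simp add: sum_distrib_right)
  finally have eq: "dfun (As @ Hs) (Mix r (Suc r)) = of_nat (\<Sum>m<tt. N m) * C" .
  \<comment> \<open>At m = q - 1 both exponents are at least q - 1, so this summand survives the
    derivatives in \<open>Hs\<close>.\<close>
  have "q - 1 < tt" "q - 1 \<le> tt - Suc (q - 1)" using tt_split tt_pos by linarith+
  then have "N (q - 1) > 0" using N(2) by simp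
  then have "(\<Sum>m<tt. N m) \<noteq> 0" using \<open>q - 1 < tt\<close> by auto
  then show ?thesis unfolding eq using C0 by (simp del: of_nat_sum)
qed

text \<open>\<open>al\<close> times Y is a weighted sum of differences of mirror powers. Each half
  lies in the ideal by \<open>line_relation\<close>, and on Y the functional of
  \<open>As @ Hs\<close> sees only the pair (r, r + 1).\<close>

theorem kernel_element: "\<exists>Y\<in>homog (tt - 1). Y \<notin> I \<and> al * Y \<in> I"
proof -
  obtain v where v: "v r = 1"
    "\<And>p. (\<forall>j\<ge>r. coeff p j = 0) \<Longrightarrow> (\<Sum>j\<in>S1. v j * poly p (\<sigma> j)) = 0"
    using weights_exist[of r] unfolding S1_def by auto
  obtain w where w: "w (Suc r) = 1"
    "\<And>p. (\<forall>j\<ge>r. coeff p j = 0) \<Longrightarrow> (\<Sum>j\<in>S2. w j * poly p (\<sigma> j)) = 0"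
    using weights_exist[of "Suc r"] unfolding S2_def by auto
  define \<kappa> where "\<kappa> = (\<lambda>i j. v i / gam i ^ q * (w j / gam j ^ q))"
  \<comment> \<open>By \<open>L_swap\<close> the factor \<open>\<sigma> j - \<sigma> i\<close> turns
    \<open>al\<close> into the difference of the two linear forms.\<close>
  define Y where "Y = (\<Sum>i\<in>S1. \<Sum>j\<in>S2. const_poly (\<kappa> i j * (\<sigma> j - \<sigma> i)) * Mix i j)"
  have "al * Y = (\<Sum>i\<in>S1. \<Sum>j\<in>S2. const_poly (\<kappa> i j) * (L (\<sigma> i) (\<sigma> j) ^ tt - L (\<sigma> j) (\<sigma> i) ^ tt))"
    unfolding Y_def sum_distrib_left
  proof (intro sum.cong refl)
    fix i j
    have "L (\<sigma> i) (\<sigma> j) ^ tt - L (\<sigma> j) (\<sigma> i) ^ tt = const_poly (\<sigma> j - \<sigma> i) * al * Mix i j"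
      unfolding Mix_def L_swap[symmetric] by (rule diff_power_factor)
    then show "al * (const_poly (\<kappa> i j * (\<sigma> j - \<sigma> i)) * Mix i j)
      = const_poly (\<kappa> i j) * (L (\<sigma> i) (\<sigma> j) ^ tt - L (\<sigma> j) (\<sigma> i) ^ tt)"
      by (simp only: const_poly_mult mult_ac)
  qed
  note alY = this
  have alI: "al * Y \<in> I"
  proof (rule ccontr)
    assume "al * Y \<notin> I"
    then obtain \<theta> where \<theta>: "lfun \<theta>" "\<And>x. x \<in> I \<Longrightarrow> \<theta> x = 0" "\<theta> (al * Y) \<noteq> 0"
      using lfun_separate[OF subspace_ideal] by blast
    have "(\<Sum>i\<in>S1. \<Sum>j\<in>S2. \<kappa> i j * \<theta> (L (\<sigma> i) (\<sigma> j) ^ tt)) =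
        (\<Sum>i\<in>S1. v i / gam i ^ q * (\<Sum>j\<in>S2. w j / gam j ^ q * \<theta> (L (\<sigma> i) (\<sigma> j) ^ tt)))"
      unfolding sum_distrib_left by (intro sum.cong refl) (simp add: \<kappa>_def)
    also have "\<dots> = 0"
      using S12 line_relation[OF \<theta>(1,2) _ S12(2) w(2)] by (intro sum.neutral) auto
    finally have 1: "(\<Sum>i\<in>S1. \<Sum>j\<in>S2. \<kappa> i j * \<theta> (L (\<sigma> i) (\<sigma> j) ^ tt)) = 0" .
    \<comment> \<open>In the mirrored half j selects the line, so the relation along it is the one
      with weights v over \<open>S1\<close>.\<close>
    have "(\<Sum>i\<in>S1. \<Sum>j\<in>S2. \<kappa> i j * \<theta> (L (\<sigma> j) (\<sigma> i) ^ tt)) =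
        (\<Sum>j\<in>S2. \<Sum>i\<in>S1. \<kappa> i j * \<theta> (L (\<sigma> j) (\<sigma> i) ^ tt))" by (rule sum.swap)
    also have "\<dots> = (\<Sum>j\<in>S2. w j / gam j ^ q * (\<Sum>i\<in>S1. v i / gam i ^ q * \<theta> (L (\<sigma> j) (\<sigma> i) ^ tt)))"
      unfolding sum_distrib_left by (intro sum.cong refl) (simp add: \<kappa>_def mult_ac)
    also have "\<dots> = 0"
      using S12 line_relation[OF \<theta>(1,2) _ S12(1) v(2)] by (intro sum.neutral) auto
    finally have 2: "(\<Sum>i\<in>S1. \<Sum>j\<in>S2. \<kappa> i j * \<theta> (L (\<sigma> j) (\<sigma> i) ^ tt)) = 0" .
    have "\<theta> (al * Y) = (\<Sum>i\<in>S1. \<Sum>j\<in>S2. \<kappa> i j * \<theta> (L (\<sigma> i) (\<sigma> j) ^ tt))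
      - (\<Sum>i\<in>S1. \<Sum>j\<in>S2. \<kappa> i j * \<theta> (L (\<sigma> j) (\<sigma> i) ^ tt))"
      unfolding alY lfun_sum[OF \<theta>(1)] lfun_scale[OF \<theta>(1)] lfun_diff[OF \<theta>(1)]
      by (simp only: right_diff_distrib sum_subtractf)
    then show False using \<theta>(3) 1 2 by simp
  qed
  have "dfun (As @ Hs) Y = (\<Sum>i\<in>S1. \<Sum>j\<in>S2. \<kappa> i j * (\<sigma> j - \<sigma> i) * dfun (As @ Hs) (Mix i j))"
    unfolding Y_def lfun_sum[OF lfun_dfun] lfun_scale[OF lfun_dfun] ..
  also have "\<dots> = (\<Sum>i\<in>S1. \<Sum>j\<in>S2. if i = r \<and> j = Suc r then \<kappa> i j * (\<sigma> j - \<sigma> i) * dfun (As @ Hs) (Mix i j) else 0)"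
    by (intro sum.cong refl) (auto simp: dfun_AH_Mix_0)
  also have "\<dots> = (\<Sum>(i, j)\<in>S1 \<times> S2. if (i, j) = (r, Suc r) then \<kappa> i j * (\<sigma> j - \<sigma> i) * dfun (As @ Hs) (Mix i j) else 0)"
    by (simp add: sum.cartesian_product)
  also have "\<dots> = (\<Sum>x\<in>S1 \<times> S2. if x = (r, Suc r) then \<kappa> r (Suc r) * (\<sigma> (Suc r) - \<sigma> r) * dfun (As @ Hs) (Mix r (Suc r)) else 0)"
    by (intro sum.cong) (auto split: if_splits)
  also have "\<dots> = \<kappa> r (Suc r) * (\<sigma> (Suc r) - \<sigma> r) * dfun (As @ Hs) (Mix r (Suc r))"
    using S12 by (subst sum.delta) (auto simp: S1_def S2_def)
  finally have val: "dfun (As @ Hs) Y = \<kappa> r (Suc r) * (\<sigma> (Suc r) - \<sigma> r) * dfun (As @ Hs) (Mix r (Suc r))" .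
  have "r < a" "Suc r < a" using r_less by auto
  then have "dfun (As @ Hs) Y \<noteq> 0"
    using gam_nonzero[of r] gam_nonzero[of "Suc r"] v(1) w(1) s_eq_iff[of r "Suc r"] dfun_AH_Mix
    by (auto simp: \<kappa>_def val)
  then have "Y \<notin> I" using dfun_AH_I by blast
  moreover have "Y \<in> homog (tt - 1)"
    unfolding Y_def Mix_def by (intro homog_sum homog_scale homog_mix homog_lin_form)
  ultimately show ?thesis using alI by blast
qed

end

section \<open>Coordinates on the quadric\<close>

definition frame :: "'k::field ^ 4 \<Rightarrow> 'k ^ 4 \<Rightarrow> 'k ^ 4 \<Rightarrow> 'k ^ 4 \<Rightarrow> bool" where
  "frame E00 E01 E10 E11 \<longleftrightarrow> (\<forall>c0 c1 c2 c3. c0 *s E00 + c1 *s E01 + c2 *s E10 + c3 *s E11 = 0 \<longrightarrow>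
     c0 = 0 \<and> c1 = 0 \<and> c2 = 0 \<and> c3 = 0)"

lemma frame_eqD:
  assumes "frame E00 E01 E10 E11"
    "a0 *s E00 + a1 *s E01 + a2 *s E10 + a3 *s E11 = b0 *s E00 + b1 *s E01 + b2 *s E10 + b3 *s E11"
  shows "a0 = b0 \<and> a1 = b1 \<and> a2 = b2 \<and> a3 = b3"
proof -
  have "(a0 - b0) *s E00 + (a1 - b1) *s E01 + (a2 - b2) *s E10 + (a3 - b3) *s E11 = 0"
    using assms(2) by (simp add: Finite_Cartesian_Product.vec_eq_iff algebra_simps)
  then have "a0 - b0 = 0 \<and> a1 - b1 = 0 \<and> a2 - b2 = 0 \<and> a3 - b3 = 0"
    using assms(1) unfolding frame_def by blast
  then show ?thesis by simp
qed

lemma frame_inverse: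
  fixes E00 E01 E10 E11 :: "'k::field ^ 4"
  assumes "frame E00 E01 E10 E11"
  shows "\<exists>A B C D. x = A *s E00 + B *s E01 + C *s E10 + D *s E11"
    and "\<exists>u. dotp u E00 = A \<and> dotp u E01 = B \<and> dotp u E10 = C \<and> dotp u E11 = D"
proof -
  \<comment> \<open>In the index type 4 equals 0; the numbering 1, 2, 3, 4 follows
    \<open>sum_4\<close> and \<open>forall_4\<close>.\<close>
  define E :: "4 \<Rightarrow> 'k ^ 4" where "E = (\<lambda>j. if j = 1 then E00 else if j = 2 then E01 else if j = 3 then E10 else E11)"
  have E: "E 1 = E00" "E 2 = E01" "E 3 = E10" "E 4 = E11" by (simp_all add: E_def)
  define M :: "'k ^ 4 ^ 4" where "M = (\<chi> i j. vec_nth (E j) i)"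
  have col: "column j M = E j" for j by (simp add: column_def M_def vec_eq_iff)
  have "\<exists>N. N ** M = Finite_Cartesian_Product.mat 1"
    unfolding matrix_left_invertible_independent_columns
  proof (intro allI impI)
    fix c :: "4 \<Rightarrow> 'k" and i
    assume "(\<Sum>i\<in>UNIV. c i *s column i M) = 0"
    then have "c 1 *s E00 + c 2 *s E01 + c 3 *s E10 + c 4 *s E11 = 0" by (simp add: sum_4 col E)
    then have "c 1 = 0 \<and> c 2 = 0 \<and> c 3 = 0 \<and> c 4 = 0" using assms unfolding frame_def by blast
    then have "\<forall>i. c i = 0" by (simp add: forall_4)
    then show "c i = 0" by blast
  qed
  then obtain N where NM: "N ** M = Finite_Cartesian_Product.mat 1" by blast
  then have MN: "M ** N = Finite_Cartesian_Product.mat 1" by (simp add: matrix_left_right_inverse)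
  have Mv: "M *v y = y $ 1 *s E00 + y $ 2 *s E01 + y $ 3 *s E10 + y $ 4 *s E11" for y
    by (intro Finite_Cartesian_Product.vec_eq_iff[THEN iffD2] allI) (simp add: matrix_vector_mult_def M_def sum_4 E mult.commute)
  have "x = M *v (N *v x)" by (simp add: matrix_vector_mul_assoc MN)
  also have "\<dots> = (N *v x) $ 1 *s E00 + (N *v x) $ 2 *s E01 + (N *v x) $ 3 *s E10 + (N *v x) $ 4 *s E11"
    unfolding Mv ..
  finally show "\<exists>A B C D. x = A *s E00 + B *s E01 + C *s E10 + D *s E11" by blast
  define val where "val = (\<lambda>j::4. if j = 1 then A else if j = 2 then B else if j = 3 then C else D)"
  define u where "u = (\<chi> i. \<Sum>j\<in>UNIV. val j * vec_nth (vec_nth N j) i)"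
  have "dotp u (E j) = val j" for j
  proof -
    have "dotp u (E j) = (\<Sum>i\<in>UNIV. \<Sum>j'\<in>UNIV. val j' * (N $ j' $ i * M $ i $ j))"
      by (simp add: dotp_def u_def M_def sum_distrib_right mult.assoc)
    also have "\<dots> = (\<Sum>j'\<in>UNIV. val j' * (\<Sum>i\<in>UNIV. N $ j' $ i * M $ i $ j))"
      unfolding sum_distrib_left by (rule sum.swap)
    also have "\<dots> = (\<Sum>j'\<in>UNIV. val j' * (N ** M) $ j' $ j)" by (simp add: matrix_matrix_mult_def)
    also have "\<dots> = (\<Sum>j'\<in>UNIV. if j' = j then val j' else 0)" unfolding NM
      by (intro sum.cong) (auto simp: Finite_Cartesian_Product.mat_def)
    finally show ?thesis by simp
  qed
  from this[of 1] this[of 2] this[of 3] this[of 4]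
  have "dotp u E00 = A \<and> dotp u E01 = B \<and> dotp u E10 = C \<and> dotp u E11 = D"
    by (simp add: E val_def)
  then show "\<exists>u. dotp u E00 = A \<and> dotp u E01 = B \<and> dotp u E10 = C \<and> dotp u E11 = D" by blast
qed

section \<open>Tensor coordinates from the lines of a grid\<close>

definition tens :: "'k::field ^ 4 \<Rightarrow> 'k ^ 4 \<Rightarrow> 'k ^ 4 \<Rightarrow> 'k ^ 4 \<Rightarrow> 'k \<Rightarrow> 'k \<Rightarrow> 'k \<Rightarrow> 'k \<Rightarrow> 'k ^ 4" where
  "tens E00 E01 E10 E11 x0 x1 y0 y1 =
     (x0 * y0) *s E00 + (x0 * y1) *s E01 + (x1 * y0) *s E10 + (x1 * y1) *s E11"

lemma tens_nonzero:
  assumes "frame E00 E01 E10 E11" "x0 \<noteq> 0 \<or> x1 \<noteq> 0" "y0 \<noteq> 0 \<or> y1 \<noteq> 0"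
  shows "tens E00 E01 E10 E11 x0 x1 y0 y1 \<noteq> 0"
proof
  assume "tens E00 E01 E10 E11 x0 x1 y0 y1 = 0"
  then have "x0 * y0 = 0 \<and> x0 * y1 = 0 \<and> x1 * y0 = 0 \<and> x1 * y1 = 0"
    using assms(1) unfolding frame_def tens_def by blast
  then show False using assms by auto
qed

lemma subspace_combination:
  "vec.subspace A \<Longrightarrow> p \<in> A \<Longrightarrow> q \<in> A \<Longrightarrow> c *s p + d *s q \<in> A"
  by (intro vec.subspace_add vec.subspace_scale)

lemma plane_generated:
  assumes A: "vec.subspace A" "vec.dim A = 2" and B: "vec.subspace B" "B \<inter> B' = {0}"
    and p: "p \<in> A" "p \<in> B" "p \<noteq> 0" and p': "p' \<in> A" "p' \<in> B'" "p' \<noteq> 0"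
    and x: "x \<in> A"
  shows "\<exists>c d. x = c *s p + d *s (p' :: 'k::field ^ 4)"
proof -
  have p'_span: "p' \<notin> vec.span {p}"
  proof
    assume "p' \<in> vec.span {p}"
    then have "p' \<in> B" using B p vec.span_minimal[of "{p}" B] by auto
    then show False using B p' by blast
  qed
  moreover have "vec.independent {p}" using p(3) by (simp only: vec.dependent_single not_False_eq_True)
  ultimately have ind: "vec.independent {p', p}" by (rule vec.independent_insertI)
  have "p' \<noteq> p" using p'_span vec.span_base[of p "{p}"] by auto
  then have "A \<subseteq> vec.span {p', p}"
    using vec.card_ge_dim_independent[OF _ ind, of A] p p' A by simp
  then have "x \<in> vec.span {p', p}" using x by blast
  then obtain d where "x - d *s p' \<in> vec.span {p}" using vec.span_breakdown_eq by blast
  then obtain c where "x - d *s p' = c *s p" using vec.span_singleton[of p] by auto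
  then have "x = c *s p + d *s p'" by (simp add: algebra_simps)
  then show ?thesis by blast
qed

lemma dim1_obtain:
  assumes "vec.subspace A" "vec.dim A = 1"
  obtains p where "p \<in> A" "p \<noteq> 0" "A = vec.span {p :: 'k::field ^ 4}"
proof -
  obtain B where B: "B \<subseteq> A" "vec.independent B" "A \<subseteq> vec.span B" "card B = vec.dim A"
    using vec.basis_exists by blast
  then obtain p where p: "B = {p}" using assms card_1_singletonE by metis
  then have "p \<noteq> 0" using B vec.dependent_zero by blast
  moreover have "A = vec.span {p}" using B p vec.span_minimal[of B A] assms by auto
  ultimately show ?thesis using that B p by blast
qed

lemma dim1_eq_span:
  assumes "vec.subspace A" "vec.dim A = 1" "t \<in> A" "t \<noteq> 0"
  shows "A = vec.span {t :: 'k::field ^ 4}"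
proof -
  have "A \<subseteq> vec.span {t}"
    using vec.card_ge_dim_independent[of "{t}" A] assms by (simp add: vec.dependent_single)
  moreover have "vec.span {t} \<subseteq> A" using vec.span_minimal[of "{t}" A] assms by auto
  ultimately show ?thesis by blast
qed

text \<open>The incidences of the grid lines; three lines in each family fix coordinates in which
  every line is given by a constant factor of a tensor.\<close>

locale line_grid =
  fixes S T :: "('k::field ^ 4) set set"
  assumes line_S: "\<And>L. L \<in> S \<Longrightarrow> vec.subspace L \<and> vec.dim L = 2"
    and line_T: "\<And>M. M \<in> T \<Longrightarrow> vec.subspace M \<and> vec.dim M = 2"
    and skew_S: "\<And>L L'. L \<in> S \<Longrightarrow> L' \<in> S \<Longrightarrow> L \<noteq> L' \<Longrightarrow> L \<inter> L' = {0}"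
    and skew_T: "\<And>M M'. M \<in> T \<Longrightarrow> M' \<in> T \<Longrightarrow> M \<noteq> M' \<Longrightarrow> M \<inter> M' = {0}"
    and meet: "\<And>L M. L \<in> S \<Longrightarrow> M \<in> T \<Longrightarrow> vec.dim (L \<inter> M) = 1"
    and three_S: "\<exists>L1 L2 L3. L1 \<in> S \<and> L2 \<in> S \<and> L3 \<in> S \<and> L1 \<noteq> L2 \<and> L1 \<noteq> L3 \<and> L2 \<noteq> L3"
    and three_T: "\<exists>M1 M2 M3. M1 \<in> T \<and> M2 \<in> T \<and> M3 \<in> T \<and> M1 \<noteq> M2 \<and> M1 \<noteq> M3 \<and> M2 \<noteq> M3"
begin

lemma meet_pt: "L \<in> S \<Longrightarrow> M \<in> T \<Longrightarrow> \<exists>p. p \<in> L \<and> p \<in> M \<and> p \<noteq> 0"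
  using dim1_obtain[of "L \<inter> M"] vec.subspace_inter line_S line_T meet by (metis IntE)

lemma gen_S:
  assumes "L \<in> S" "M \<in> T" "M' \<in> T" "M \<noteq> M'" "p \<in> L" "p \<in> M" "p \<noteq> 0" "p' \<in> L" "p' \<in> M'" "p' \<noteq> 0" "x \<in> L"
  shows "\<exists>c d. x = c *s p + d *s p'"
  using plane_generated[of L M M' p p' x] line_S line_T skew_T assms by blast

lemma gen_T:
  assumes "M \<in> T" "L \<in> S" "L' \<in> S" "L \<noteq> L'" "p \<in> L" "p \<in> M" "p \<noteq> 0" "p' \<in> L'" "p' \<in> M" "p' \<noteq> 0" "x \<in> M"
  shows "\<exists>c d. x = c *s p + d *s p'"
  using plane_generated[of M L L' p p' x] line_S line_T skew_S assms by blast

text \<open>Rescaling the points on \<open>L1\<close> and \<open>L2\<close> gives the three lines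
  the parameters (1, 0), (0, 1) and (1, 1).\<close>

lemma split_on_third:
  assumes M: "M \<in> T" and L: "L1 \<in> S" "L2 \<in> S" "L3 \<in> S" "L1 \<noteq> L2" "L1 \<noteq> L3" "L2 \<noteq> L3"
  shows "\<exists>p q. p \<in> L1 \<and> p \<in> M \<and> p \<noteq> 0 \<and> q \<in> L2 \<and> q \<in> M \<and> q \<noteq> 0 \<and> p + q \<in> L3"
proof -
  obtain p q r where pqr: "p \<in> L1" "p \<in> M" "p \<noteq> 0" "q \<in> L2" "q \<in> M" "q \<noteq> 0" "r \<in> L3" "r \<in> M" "r \<noteq> 0"
    using meet_pt M L by metis
  then obtain c d where r: "r = c *s p + d *s q"
    using gen_T[OF M L(1,2,4) pqr(1-6) pqr(8)] by blast
  have cp: "c *s p \<in> L1" "c *s p \<in> M" and dq: "d *s q \<in> L2" "d *s q \<in> M"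
    using pqr line_S line_T L M vec.subspace_scale by blast+
  have "c \<noteq> 0"
  proof
    assume "c = 0"
    then have "r \<in> L2" using r dq by simp
    then show False using pqr skew_S[OF L(2,3,6)] by blast
  qed
  moreover have "d \<noteq> 0"
  proof
    assume "d = 0"
    then have "r \<in> L1" using r cp by simp
    then show False using pqr skew_S[OF L(1,3,5)] by blast
  qed
  ultimately have "c *s p \<noteq> 0" "d *s q \<noteq> 0" using pqr by simp_all
  then show ?thesis using cp dq pqr r by blast
qed

text \<open>The basis consists of the four meeting points of \<open>L1\<close>, \<open>L2\<close>
  with \<open>M1\<close>, \<open>M2\<close>, scaled so that \<open>L3\<close> has parameter (1, 1).
  Any further line meets three lines of the other family in collinear points, which forces the
  parameters on them to agree.\<close>

theorem tensor_coordinates: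
  obtains E00 E01 E10 E11 where "frame E00 E01 E10 E11"
    "\<And>L. L \<in> S \<Longrightarrow> \<exists>x0 x1. (x0 \<noteq> 0 \<or> x1 \<noteq> 0) \<and> (\<forall>y0 y1. tens E00 E01 E10 E11 x0 x1 y0 y1 \<in> L)"
    "\<And>M. M \<in> T \<Longrightarrow> \<exists>y0 y1. (y0 \<noteq> 0 \<or> y1 \<noteq> 0) \<and> (\<forall>x0 x1. tens E00 E01 E10 E11 x0 x1 y0 y1 \<in> M)"
proof -
  obtain L1 L2 L3 where L: "L1 \<in> S" "L2 \<in> S" "L3 \<in> S" "L1 \<noteq> L2" "L1 \<noteq> L3" "L2 \<noteq> L3"
    using three_S by blast
  obtain M1 M2 M3 where M: "M1 \<in> T" "M2 \<in> T" "M3 \<in> T" "M1 \<noteq> M2" "M1 \<noteq> M3" "M2 \<noteq> M3"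
    using three_T by blast
  obtain E00 E10 where E0: "E00 \<in> L1" "E00 \<in> M1" "E00 \<noteq> 0" "E10 \<in> L2" "E10 \<in> M1" "E10 \<noteq> 0" "E00 + E10 \<in> L3"
    using split_on_third[OF M(1) L] by blast
  obtain E01 E11 where E1: "E01 \<in> L1" "E01 \<in> M2" "E01 \<noteq> 0" "E11 \<in> L2" "E11 \<in> M2" "E11 \<noteq> 0" "E01 + E11 \<in> L3"
    using split_on_third[OF M(2) L] by blast
  note sS = line_S[THEN conjunct1] and sT = line_T[THEN conjunct1]
  have fr: "frame E00 E01 E10 E11" unfolding frame_def
  proof (intro allI impI)
    fix c0 c1 c2 c3
    assume z: "c0 *s E00 + c1 *s E01 + c2 *s E10 + c3 *s E11 = 0"
    \<comment> \<open>Independence in two stages: skewness of \<open>L1\<close> and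
      \<open>L2\<close> separates the pairs, skewness of \<open>M1\<close> and \<open>M2\<close>
      separates the two vectors of each pair.\<close>
    have a: "c0 *s E00 + c1 *s E01 \<in> L1" by (rule subspace_combination[OF sS[OF L(1)] E0(1) E1(1)])
    have b: "(- c2) *s E10 + (- c3) *s E11 \<in> L2" by (rule subspace_combination[OF sS[OF L(2)] E0(4) E1(4)])
    have "c0 *s E00 + c1 *s E01 = (- c2) *s E10 + (- c3) *s E11"
      using z by (simp add: Finite_Cartesian_Product.vec_eq_iff algebra_simps eq_neg_iff_add_eq_0)
    then have "c0 *s E00 + c1 *s E01 \<in> L1 \<inter> L2" using a b by simp
    then have 1: "c0 *s E00 + c1 *s E01 = 0" using skew_S[OF L(1,2,4)] by blast
    then have 2: "c2 *s E10 + c3 *s E11 = 0" using z by (simp add: add.assoc)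
    have "c0 *s E00 = (- c1) *s E01" using 1 by (simp add: Finite_Cartesian_Product.vec_eq_iff eq_neg_iff_add_eq_0)
    then have "c0 *s E00 \<in> M1 \<inter> M2"
      using vec.subspace_scale[OF sT[OF M(1)] E0(2), of c0] vec.subspace_scale[OF sT[OF M(2)] E1(2), of "- c1"] by simp
    then have "c0 *s E00 = 0" using skew_T[OF M(1,2,4)] by blast
    moreover have "c2 *s E10 = (- c3) *s E11" using 2 by (simp add: Finite_Cartesian_Product.vec_eq_iff eq_neg_iff_add_eq_0)
    then have "c2 *s E10 \<in> M1 \<inter> M2"
      using vec.subspace_scale[OF sT[OF M(1)] E0(5), of c2] vec.subspace_scale[OF sT[OF M(2)] E1(5), of "- c3"] by simp
    then have "c2 *s E10 = 0" using skew_T[OF M(1,2,4)] by blast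
    ultimately show "c0 = 0 \<and> c1 = 0 \<and> c2 = 0 \<and> c3 = 0" using 1 2 E0 E1 by auto
  qed
  have nz: "E00 + E10 \<noteq> 0" "E01 + E11 \<noteq> 0"
    using fr[unfolded frame_def, rule_format, of 1 0 1 0] fr[unfolded frame_def, rule_format, of 0 1 0 1] by auto
  have in3: "E00 + E10 \<in> M1" "E01 + E11 \<in> M2"
    using vec.subspace_add sT M E0 E1 by blast+
  \<comment> \<open>The point on \<open>L3\<close> is a combination of those on \<open>L1\<close>
    and \<open>L2\<close>; comparing coefficients shows that both have the ratio e : f.\<close>
  have claimM: "\<exists>a b. (a *s E00 + b *s E01 \<in> M) \<and> (a *s E10 + b *s E11 \<in> M) \<and> (a \<noteq> 0 \<or> b \<noteq> 0)" if M': "M \<in> T" for M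
  proof -
    obtain m1 m2 m3 where m: "m1 \<in> L1" "m1 \<in> M" "m1 \<noteq> 0" "m2 \<in> L2" "m2 \<in> M" "m2 \<noteq> 0" "m3 \<in> L3" "m3 \<in> M" "m3 \<noteq> 0"
      using meet_pt M' L by metis
    obtain a b where m1: "m1 = a *s E00 + b *s E01"
      using gen_S[OF L(1) M(1,2,4) E0(1-3) E1(1-3) m(1)] by blast
    obtain a' b' where m2: "m2 = a' *s E10 + b' *s E11"
      using gen_S[OF L(2) M(1,2,4) E0(4-6) E1(4-6) m(4)] by blast
    obtain e f where m3: "m3 = e *s (E00 + E10) + f *s (E01 + E11)"
      using gen_S[OF L(3) M(1,2,4) E0(7) in3(1) nz(1) E1(7) in3(2) nz(2) m(7)] by blast
    obtain g h where "m3 = g *s m1 + h *s m2"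
      using gen_T[OF M' L(1,2,4) m(1-6) m(8)] by blast
    then have "e *s E00 + f *s E01 + e *s E10 + f *s E11
      = (g * a) *s E00 + (g * b) *s E01 + (h * a') *s E10 + (h * b') *s E11"
      unfolding m1 m2 m3 by (simp add: Finite_Cartesian_Product.vec_eq_iff algebra_simps)
    then have eq: "e = g * a" "f = g * b" "e = h * a'" "f = h * b'" using frame_eqD[OF fr] by blast+
    have h: "e \<noteq> 0 \<or> f \<noteq> 0" using m(9) m3 by auto
    have "g *s m1 = e *s E00 + f *s E01" "h *s m2 = e *s E10 + f *s E11"
      unfolding m1 m2 using eq by (simp_all add: vec_eq_iff algebra_simps)
    moreover have "g *s m1 \<in> M" "h *s m2 \<in> M" using vec.subspace_scale[OF sT[OF M']] m by blast+
    ultimately show ?thesis using h by metis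
  qed
  have claimM': "\<exists>y0 y1. (y0 \<noteq> 0 \<or> y1 \<noteq> 0) \<and> (\<forall>x0 x1. tens E00 E01 E10 E11 x0 x1 y0 y1 \<in> M)" if M': "M \<in> T" for M
  proof -
    obtain y0 y1 where y: "y0 *s E00 + y1 *s E01 \<in> M" "y0 *s E10 + y1 *s E11 \<in> M" "y0 \<noteq> 0 \<or> y1 \<noteq> 0"
      using claimM[OF M'] by blast
    have "tens E00 E01 E10 E11 x0 x1 y0 y1 \<in> M" for x0 x1
    proof -
      have "tens E00 E01 E10 E11 x0 x1 y0 y1 = x0 *s (y0 *s E00 + y1 *s E01) + x1 *s (y0 *s E10 + y1 *s E11)"
        by (simp add: tens_def vec_eq_iff algebra_simps)
      then show ?thesis using subspace_combination[OF sT[OF M'] y(1,2)] by simp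
    qed
    then show ?thesis using y(3) by blast
  qed
  obtain a b where ab: "a *s E00 + b *s E01 \<in> M3" "a *s E10 + b *s E11 \<in> M3" "a \<noteq> 0 \<or> b \<noteq> 0"
    using claimM[OF M(3)] by blast
  have abL: "a *s E00 + b *s E01 \<in> L1" "a *s E10 + b *s E11 \<in> L2"
    by (rule subspace_combination[OF sS[OF L(1)] E0(1) E1(1)], rule subspace_combination[OF sS[OF L(2)] E0(4) E1(4)])
  have abnz: "a *s E00 + b *s E01 \<noteq> 0" "a *s E10 + b *s E11 \<noteq> 0"
  proof -
    have 1: "a = 0 \<and> b = 0" if "a *s E00 + b *s E01 + 0 *s E10 + 0 *s E11 = 0"
      using fr that unfolding frame_def by blast
    have 2: "a = 0 \<and> b = 0" if "0 *s E00 + 0 *s E01 + a *s E10 + b *s E11 = 0"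
      using fr that unfolding frame_def by blast
    show "a *s E00 + b *s E01 \<noteq> 0" using 1 ab(3) by auto
    show "a *s E10 + b *s E11 \<noteq> 0" using 2 ab(3) by auto
  qed
  \<comment> \<open>\<open>M3\<close> is skew to \<open>M1\<close> and \<open>M2\<close>, so both
    coordinates of its parameter are nonzero and may be divided by below.\<close>
  have a0: "a \<noteq> 0"
  proof
    assume "a = 0"
    then have "a *s E00 + b *s E01 \<in> M2" using vec.subspace_scale[OF sT[OF M(2)] E1(2)] by simp
    then show False using skew_T[OF M(2,3,6)] ab(1) abnz(1) by blast
  qed
  have b0: "b \<noteq> 0"
  proof
    assume "b = 0"
    then have "a *s E00 + b *s E01 \<in> M1" using vec.subspace_scale[OF sT[OF M(1)] E0(2)] by simp
    then show False using skew_T[OF M(1,3,5)] ab(1) abnz(1) by blast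
  qed
  \<comment> \<open>The same comparison with the families exchanged; \<open>M3\<close> replaces
    \<open>L3\<close>, with parameter (a, b) instead of (1, 1).\<close>
  have claimL: "\<exists>x0 x1. (x0 \<noteq> 0 \<or> x1 \<noteq> 0) \<and> (\<forall>y0 y1. tens E00 E01 E10 E11 x0 x1 y0 y1 \<in> L)" if L': "L \<in> S" for L
  proof -
    obtain r s w where m: "r \<in> L" "r \<in> M1" "r \<noteq> 0" "s \<in> L" "s \<in> M2" "s \<noteq> 0" "w \<in> L" "w \<in> M3" "w \<noteq> 0"
      using meet_pt M L' by metis
    obtain x0 x1 where r: "r = x0 *s E00 + x1 *s E10"
      using gen_T[OF M(1) L(1,2,4) E0(1-6) m(2)] by blast
    obtain x0' x1' where s: "s = x0' *s E01 + x1' *s E11"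
      using gen_T[OF M(2) L(1,2,4) E1(1-6) m(5)] by blast
    obtain g h where w: "w = g *s (a *s E00 + b *s E01) + h *s (a *s E10 + b *s E11)"
      using gen_T[OF M(3) L(1,2,4) abL(1) ab(1) abnz(1) abL(2) ab(2) abnz(2) m(8)] by blast
    obtain c d where "w = c *s r + d *s s"
      using gen_S[OF L' M(1,2,4) m(1-7)] by blast
    then have "(g * a) *s E00 + (g * b) *s E01 + (h * a) *s E10 + (h * b) *s E11
      = (c * x0) *s E00 + (d * x0') *s E01 + (c * x1) *s E10 + (d * x1') *s E11"
      unfolding r s w by (simp add: Finite_Cartesian_Product.vec_eq_iff algebra_simps)
    then have eq: "g * a = c * x0" "g * b = d * x0'" "h * a = c * x1" "h * b = d * x1'"
      using frame_eqD[OF fr] by blast+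
    have gh: "g \<noteq> 0 \<or> h \<noteq> 0" using m(9) w by auto
    have "g = c / a * x0" "h = c / a * x1" using eq a0 by (simp_all add: field_simps)
    then have "g *s E00 + h *s E10 = (c / a) *s r"
      unfolding r by (simp only:) (simp add: Finite_Cartesian_Product.vec_eq_iff algebra_simps)
    then have 1: "g *s E00 + h *s E10 \<in> L" using vec.subspace_scale[OF sS[OF L'] m(1)] by simp
    have "g = d / b * x0'" "h = d / b * x1'" using eq b0 by (simp_all add: field_simps)
    then have "g *s E01 + h *s E11 = (d / b) *s s"
      unfolding s by (simp only:) (simp add: Finite_Cartesian_Product.vec_eq_iff algebra_simps)
    then have 2: "g *s E01 + h *s E11 \<in> L" using vec.subspace_scale[OF sS[OF L'] m(4)] by simp
    have "tens E00 E01 E10 E11 g h y0 y1 \<in> L" for y0 y1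
    proof -
      have "tens E00 E01 E10 E11 g h y0 y1 = y0 *s (g *s E00 + h *s E10) + y1 *s (g *s E01 + h *s E11)"
        by (simp add: tens_def vec_eq_iff algebra_simps)
      then show ?thesis using subspace_combination[OF sS[OF L'] 1 2] by simp
    qed
    then show ?thesis using gh by blast
  qed
  show ?thesis using that fr claimL claimM' by blast
qed

lemma meet_eq_span:
  assumes "frame E00 E01 E10 E11" "L \<in> S" "M \<in> T" "x0 \<noteq> 0 \<or> x1 \<noteq> 0" "y0 \<noteq> 0 \<or> y1 \<noteq> 0"
    "\<And>y0 y1. tens E00 E01 E10 E11 x0 x1 y0 y1 \<in> L" "\<And>x0 x1. tens E00 E01 E10 E11 x0 x1 y0 y1 \<in> M"
  shows "L \<inter> M = vec.span {tens E00 E01 E10 E11 x0 x1 y0 y1}"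
proof (rule dim1_eq_span)
  show "vec.subspace (L \<inter> M)" using line_S line_T assms vec.subspace_inter by blast
  show "tens E00 E01 E10 E11 x0 x1 y0 y1 \<noteq> 0" by (rule tens_nonzero[OF assms(1,4,5)])
qed (use assms meet in auto)

end

section \<open>General linear forms and the main theorem\<close>

lemma eval_poly_on_line:
  "\<exists>p. \<forall>t. poly p t = eval_poly (\<alpha> + t *s (\<beta> - \<alpha>)) (f :: 'k::field mpoly4)"
proof (induction f rule: mpoly4_induct)
  case (single m c)
  have "poly (Polynomial.smult c (\<Prod>i\<in>UNIV. [:vec_nth \<alpha> i, vec_nth \<beta> i - vec_nth \<alpha> i:] ^ Poly_Mapping.lookup m i)) t
    = eval_poly (\<alpha> + t *s (\<beta> - \<alpha>)) (Poly_Mapping.single m c)" for t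
    by (simp add: eval_poly_single poly_prod)
  then show ?case by blast
next
  case (add f g)
  then obtain p p' where "\<forall>t. poly p t = eval_poly (\<alpha> + t *s (\<beta> - \<alpha>)) f"
    "\<forall>t. poly p' t = eval_poly (\<alpha> + t *s (\<beta> - \<alpha>)) g" by blast
  then have "\<forall>t. poly (p + p') t = eval_poly (\<alpha> + t *s (\<beta> - \<alpha>)) (f + g)" by simp
  then show ?case by blast
qed

text \<open>Affine space is irreducible: on the line through the two points both restrictions are
  nonzero polynomials in one variable, and so is their product.\<close>

lemma eval_poly_common_nonzero:
  fixes f g :: "'k::field_char_0 mpoly4"
  assumes "eval_poly \<alpha> f \<noteq> 0" "eval_poly \<beta> g \<noteq> 0"
  shows "\<exists>\<gamma>. eval_poly \<gamma> f \<noteq> 0 \<and> eval_poly \<gamma> g \<noteq> 0"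
proof -
  obtain p p' where p: "\<And>t. poly p t = eval_poly (\<alpha> + t *s (\<beta> - \<alpha>)) f"
    "\<And>t. poly p' t = eval_poly (\<alpha> + t *s (\<beta> - \<alpha>)) g"
    using eval_poly_on_line by blast
  have "poly p 0 \<noteq> 0" "poly p' 1 \<noteq> 0" using assms by (simp_all add: p)
  then have "p * p' \<noteq> 0" by auto
  then have "\<exists>t. poly (p * p') t \<noteq> 0"
    using poly_eq_0_infinite[of UNIV "p * p'"] infinite_UNIV_char_0[where 'a = 'k] by auto
  then obtain t where "poly p t \<noteq> 0" "poly p' t \<noteq> 0" by auto
  then show ?thesis unfolding p by blast
qed

lemma eval_poly_prod_nonzero:
  fixes f :: "'i \<Rightarrow> 'k::field_char_0 mpoly4"
  assumes "finite A" "\<And>i. i \<in> A \<Longrightarrow> \<exists>\<alpha>. eval_poly \<alpha> (f i) \<noteq> 0"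
  shows "\<exists>\<alpha>. \<forall>i\<in>A. eval_poly \<alpha> (f i) \<noteq> 0"
proof -
  have "\<exists>\<alpha>. eval_poly \<alpha> (\<Prod>i\<in>A. f i) \<noteq> 0"
    using assms
  proof (induction A rule: finite_induct)
    case (insert x A)
    then obtain \<alpha> \<beta> where "eval_poly \<alpha> (f x) \<noteq> 0" "eval_poly \<beta> (\<Prod>i\<in>A. f i) \<noteq> 0" by blast
    then obtain \<gamma> where "eval_poly \<gamma> (f x) \<noteq> 0" "eval_poly \<gamma> (\<Prod>i\<in>A. f i) \<noteq> 0"
      using eval_poly_common_nonzero by blast
    then show ?case using insert.hyps by (intro exI[of _ \<gamma>]) simp
  qed (intro exI[of _ 0], simp)
  then obtain \<alpha> where \<alpha>: "eval_poly \<alpha> (\<Prod>i\<in>A. f i) \<noteq> 0" by blast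
  have "eval_poly \<alpha> (f i) \<noteq> 0" if "i \<in> A" for i
    using \<alpha> prod.remove[OF assms(1) that, of f] by auto
  then show ?thesis by blast
qed

lemma avoid_roots:
  fixes u v :: "'i \<Rightarrow> 'k::field_char_0"
  assumes "finite A" "\<And>i. i \<in> A \<Longrightarrow> u i \<noteq> 0 \<or> v i \<noteq> 0"
  shows "\<exists>\<mu>. \<forall>i\<in>A. u i + \<mu> * v i \<noteq> 0"
proof -
  have "finite (\<Union>i\<in>A. {\<mu>. poly [:u i, v i:] \<mu> = 0})"
    using assms by (intro finite_UN_I poly_roots_finite) auto
  then obtain \<mu> where "\<mu> \<notin> (\<Union>i\<in>A. {\<mu>. poly [:u i, v i:] \<mu> = 0})"
    using ex_new_if_finite[OF infinite_UNIV_char_0] by blast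
  then show ?thesis by (intro exI[of _ \<mu>]) auto
qed

text \<open>The second factor of the tensor product is changed so that \<open>\<alpha>\<close> becomes antisymmetric; then
  a common shear of both factors, which fixes antisymmetric tensors, moves all points off infinity.\<close>
lemma normal_form:
  fixes E00 E01 E10 E11 :: "'k::field_char_0 ^ 4" and x0 x1 y0 y1 :: "nat \<Rightarrow> 'k"
  assumes fr: "frame E00 E01 E10 E11"
    and xnz: "\<And>i. i < a \<Longrightarrow> x0 i \<noteq> 0 \<or> x1 i \<noteq> 0" and ynz: "\<And>i. i < a \<Longrightarrow> y0 i \<noteq> 0 \<or> y1 i \<noteq> 0"
    and xd: "\<And>i j. i < a \<Longrightarrow> j < a \<Longrightarrow> i \<noteq> j \<Longrightarrow> x0 i * x1 j \<noteq> x1 i * x0 j"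
    and yd: "\<And>i j. i < a \<Longrightarrow> j < a \<Longrightarrow> i \<noteq> j \<Longrightarrow> y0 i * y1 j \<noteq> y1 i * y0 j"
    and al: "\<alpha> = a00 *s E00 + a01 *s E01 + a10 *s E10 + a11 *s E11"
    and det: "a00 * a11 - a10 * a01 \<noteq> 0"
    and gen: "\<And>i j. i < a \<Longrightarrow> j < a \<Longrightarrow>
       y0 j * (x1 i * a01 - x0 i * a11) - y1 j * (x1 i * a00 - x0 i * a10) \<noteq> 0"
  shows "\<exists>e00 e01 e10 e11 \<sigma> \<upsilon>. frame e00 e01 e10 e11 \<and> e01 - e10 = \<alpha> \<and>
     inj_on \<sigma> {..<a} \<and> inj_on \<upsilon> {..<a} \<and> (\<forall>i<a. \<forall>j<a. \<sigma> i \<noteq> \<upsilon> j) \<and>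
     (\<forall>i<a. \<forall>j<a. \<exists>c. c \<noteq> 0 \<and>
        gpt e00 e01 e10 e11 (\<sigma> i) (\<upsilon> j) = c *s tens E00 E01 E10 E11 (x0 i) (x1 i) (y0 j) (y1 j))"
proof -
  define D where "D = a00 * a11 - a10 * a01"
  have D: "D \<noteq> 0" using det by (simp add: D_def)
  \<comment> \<open>Cramer's rule: the coordinates of the second factor in the basis (- a10, - a11),
    (a00, a01), in which \<open>\<alpha>\<close> becomes antisymmetric. The determinant D is nonzero
    because \<open>\<alpha>\<close> is off the quadric.\<close>
  define z0 z1 where "z0 = (\<lambda>j. (y0 j * a01 - a00 * y1 j) / D)" and "z1 = (\<lambda>j. (a11 * y0 j - a10 * y1 j) / D)"
  have Dz: "D * z0 j = y0 j * a01 - a00 * y1 j" "D * z1 j = a11 * y0 j - a10 * y1 j" for j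
    using D by (simp_all add: z0_def z1_def)
  have y: "y0 j = - z0 j * a10 + z1 j * a00" "y1 j = - z0 j * a11 + z1 j * a01" for j
  proof -
    have "D * (- z0 j * a10 + z1 j * a00) = - (D * z0 j) * a10 + (D * z1 j) * a00" by (simp add: algebra_simps)
    also have "\<dots> = D * y0 j" unfolding Dz by (simp add: D_def algebra_simps)
    finally show "y0 j = - z0 j * a10 + z1 j * a00" using D by simp
    have "D * (- z0 j * a11 + z1 j * a01) = - (D * z0 j) * a11 + (D * z1 j) * a01" by (simp add: algebra_simps)
    also have "\<dots> = D * y1 j" unfolding Dz by (simp add: D_def algebra_simps)
    finally show "y1 j = - z0 j * a11 + z1 j * a01" using D by simp
  qed
  have znz: "z0 j \<noteq> 0 \<or> z1 j \<noteq> 0" if "j < a" for j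
    using ynz[OF that] y[of j] by auto
  \<comment> \<open>Both families of points are collected, so that a single shear parameter
    \<open>\<mu>\<close> serves them all.\<close>
  define u v :: "nat \<times> bool \<Rightarrow> 'k" where "u = (\<lambda>(i, s). if s then x0 i else z0 i)"
    and "v = (\<lambda>(i, s). if s then x1 i else z1 i)"
  have "u p \<noteq> 0 \<or> v p \<noteq> 0" if "p \<in> {..<a} \<times> UNIV" for p
    using that xnz znz by (cases p) (auto simp: u_def v_def)
  then obtain \<mu> where \<mu>: "\<forall>p\<in>{..<a} \<times> UNIV. u p + \<mu> * v p \<noteq> 0"
    using avoid_roots[of "{..<a} \<times> UNIV" u v] by auto
  have Xnz: "x0 i + \<mu> * x1 i \<noteq> 0" and Znz: "z0 i + \<mu> * z1 i \<noteq> 0" if "i < a" for i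
    using \<mu>[rule_format, of "(i, True)"] \<mu>[rule_format, of "(i, False)"] that by (simp_all add: u_def v_def)
  define \<sigma> \<upsilon> where "\<sigma> = (\<lambda>i. x1 i / (x0 i + \<mu> * x1 i))" and "\<upsilon> = (\<lambda>j. z1 j / (z0 j + \<mu> * z1 j))"
  \<comment> \<open>The tensors of the new bases after the shear, which replaces the second basis
    vector of each factor by itself minus \<open>\<mu>\<close> times the first.\<close>
  define e00 where "e00 = (- a10) *s E00 + (- a11) *s E01"
  define e01 where "e01 = (a00 *s E00 + a01 *s E01) - \<mu> *s e00"
  define e10 where "e10 = ((- a10) *s E10 + (- a11) *s E11) - \<mu> *s e00"
  define e11 where "e11 = (a00 *s E10 + a01 *s E11) - \<mu> *s (e10 + e01 + \<mu> *s e00)"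
  have "frame e00 e01 e10 e11" unfolding frame_def
  proof (intro allI impI)
    fix c0 c1 c2 c3
    assume z: "c0 *s e00 + c1 *s e01 + c2 *s e10 + c3 *s e11 = 0"
    define d0 d1 d2 where "d0 = c0 - \<mu> * c1 - \<mu> * c2 + \<mu> * \<mu> * c3" and "d1 = c1 - \<mu> * c3" and "d2 = c2 - \<mu> * c3"
    have "c0 *s e00 + c1 *s e01 + c2 *s e10 + c3 *s e11 =
       (- d0 * a10 + d1 * a00) *s E00 + (- d0 * a11 + d1 * a01) *s E01 +
       (- d2 * a10 + c3 * a00) *s E10 + (- d2 * a11 + c3 * a01) *s E11"
      by (simp add: e00_def e01_def e10_def e11_def d0_def d1_def d2_def
          Finite_Cartesian_Product.vec_eq_iff algebra_simps)
    with z have eqs: "- d0 * a10 + d1 * a00 = 0" "- d0 * a11 + d1 * a01 = 0"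
      "- d2 * a10 + c3 * a00 = 0" "- d2 * a11 + c3 * a01 = 0"
      using fr unfolding frame_def by metis+
    have "d0 * D = (- d0 * a10 + d1 * a00) * a01 - (- d0 * a11 + d1 * a01) * a00"
      "d1 * D = (- d0 * a10 + d1 * a00) * a11 - (- d0 * a11 + d1 * a01) * a10"
      "d2 * D = (- d2 * a10 + c3 * a00) * a01 - (- d2 * a11 + c3 * a01) * a00"
      "c3 * D = (- d2 * a10 + c3 * a00) * a11 - (- d2 * a11 + c3 * a01) * a10"
      by (simp_all add: D_def algebra_simps)
    then have "d0 = 0" "d1 = 0" "d2 = 0" "c3 = 0" unfolding eqs using D by simp_all
    then show "c0 = 0 \<and> c1 = 0 \<and> c2 = 0 \<and> c3 = 0" by (simp add: d0_def d1_def d2_def)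
  qed
  moreover have "e01 - e10 = \<alpha>"
    by (simp add: e01_def e10_def al Finite_Cartesian_Product.vec_eq_iff algebra_simps)
  moreover have "inj_on \<sigma> {..<a}"
  proof (rule inj_onI, rule ccontr)
    fix i j assume ij: "i \<in> {..<a}" "j \<in> {..<a}" "\<sigma> i = \<sigma> j" "i \<noteq> j"
    then have "x1 i * (x0 j + \<mu> * x1 j) = x1 j * (x0 i + \<mu> * x1 i)"
      using Xnz by (simp add: \<sigma>_def frac_eq_eq)
    then have "x0 i * x1 j = x1 i * x0 j" by (simp add: algebra_simps)
    then show False using xd ij by auto
  qed
  moreover have "inj_on \<upsilon> {..<a}"
  proof (rule inj_onI, rule ccontr)
    fix i j assume ij: "i \<in> {..<a}" "j \<in> {..<a}" "\<upsilon> i = \<upsilon> j" "i \<noteq> j"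
    then have "z1 i * (z0 j + \<mu> * z1 j) = z1 j * (z0 i + \<mu> * z1 i)"
      using Znz by (simp add: \<upsilon>_def frac_eq_eq)
    then have "z0 i * z1 j - z1 i * z0 j = 0" by (simp add: algebra_simps)
    moreover have "y0 i * y1 j - y1 i * y0 j = (z0 i * z1 j - z1 i * z0 j) * (a00 * a11 - a10 * a01)"
      unfolding y by (simp add: algebra_simps)
    ultimately show False using yd ij by auto
  qed
  moreover have "\<sigma> i \<noteq> \<upsilon> j" if ij: "i < a" "j < a" for i j
  proof
    assume "\<sigma> i = \<upsilon> j"
    then have "x1 i * (z0 j + \<mu> * z1 j) = z1 j * (x0 i + \<mu> * x1 i)"
      using Xnz[OF ij(1)] Znz[OF ij(2)] by (simp add: \<sigma>_def \<upsilon>_def frac_eq_eq)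
    then have "x1 i * (D * z0 j) - x0 i * (D * z1 j) = 0" by (simp add: algebra_simps)
    \<comment> \<open>Up to the factor D, the expression in \<open>gen\<close> is x1 z0 - x0 z1, the
      difference of the two parameters.\<close>
    then show False using gen[OF ij] unfolding Dz by (simp add: algebra_simps)
  qed
  moreover have "\<exists>c. c \<noteq> 0 \<and> gpt e00 e01 e10 e11 (\<sigma> i) (\<upsilon> j) = c *s tens E00 E01 E10 E11 (x0 i) (x1 i) (y0 j) (y1 j)"
    if ij: "i < a" "j < a" for i j
  proof -
    define X Z where "X = x0 i + \<mu> * x1 i" and "Z = z0 j + \<mu> * z1 j"
    have XZ: "X \<noteq> 0" "Z \<noteq> 0" using Xnz Znz ij by (simp_all add: X_def Z_def)
    have s: "X * \<sigma> i = x1 i" and u: "Z * \<upsilon> j = z1 j" using XZ by (simp_all add: \<sigma>_def \<upsilon>_def X_def Z_def)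
    have "(X * Z) *s gpt e00 e01 e10 e11 (\<sigma> i) (\<upsilon> j) =
      (X * Z) *s e00 + (X * (Z * \<upsilon> j)) *s e01 + ((X * \<sigma> i) * Z) *s e10 + ((X * \<sigma> i) * (Z * \<upsilon> j)) *s e11"
      by (simp add: gpt_def Finite_Cartesian_Product.vec_eq_iff algebra_simps)
    also have "\<dots> = tens E00 E01 E10 E11 (x0 i) (x1 i) (y0 j) (y1 j)"
      unfolding s u unfolding X_def Z_def tens_def y e11_def e10_def e01_def e00_def
      by (simp add: Finite_Cartesian_Product.vec_eq_iff algebra_simps)
    finally have "tens E00 E01 E10 E11 (x0 i) (x1 i) (y0 j) (y1 j) = (X * Z) *s gpt e00 e01 e10 e11 (\<sigma> i) (\<upsilon> j)" ..
    then have "gpt e00 e01 e10 e11 (\<sigma> i) (\<upsilon> j) = (1 / (X * Z)) *s tens E00 E01 E10 E11 (x0 i) (x1 i) (y0 j) (y1 j)"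
      using XZ by (simp add: vector_smult_assoc)
    then show ?thesis using XZ by (intro exI[of _ "1 / (X * Z)"]) simp
  qed
  ultimately show ?thesis by blast
qed

section \<open>The power ideal seen by functionals\<close>

lemma mpoly4_ideal_power_ideal: "mpoly4_ideal (power_ideal X d)"
  unfolding mpoly4_ideal_def power_ideal_def by (rule ring.genideal_ideal[OF class_ring.ring_axioms]) simp

lemma power_ideal_gen: "\<alpha> \<noteq> 0 \<Longrightarrow> P \<in> X \<Longrightarrow> \<alpha> \<in> P \<Longrightarrow> lin_form \<alpha> ^ d \<in> power_ideal X d"
  unfolding power_ideal_def genideal_def by blast

text \<open>The polynomials all of whose multiples are killed form an ideal, and this ideal contains
  the generators.\<close>

lemma power_ideal_kill:
  assumes \<theta>: "lfun \<theta>" and z: "\<And>\<alpha> P g. \<alpha> \<noteq> 0 \<Longrightarrow> P \<in> X \<Longrightarrow> \<alpha> \<in> P \<Longrightarrow> \<theta> (lin_form \<alpha> ^ d * g) = 0"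
    and x: "x \<in> power_ideal X d"
  shows "\<theta> x = 0"
proof -
  let ?K = "{x. \<forall>g. \<theta> (x * g) = 0}"
  have "ideal ?K poly_ring"
  proof (rule idealI)
    show "ring poly_ring" by (rule class_ring.ring_axioms)
    show "subgroup ?K (add_monoid poly_ring)"
    proof
      fix x assume "x \<in> ?K"
      then have "- x \<in> ?K" using lfun_diff[OF \<theta>, of 0] lfun_0[OF \<theta>] by simp
      moreover have "inv\<^bsub>add_monoid poly_ring\<^esub> x = - x"
        unfolding a_inv_def[symmetric] by (simp add: class_ring_simps)
      ultimately show "inv\<^bsub>add_monoid poly_ring\<^esub> x \<in> ?K" by simp
    qed (auto simp: lfun_add[OF \<theta>] lfun_0[OF \<theta>] distrib_right)
  qed (auto simp: mult_ac)
  moreover have "{lin_form \<alpha> ^ d |\<alpha>. \<alpha> \<noteq> 0 \<and> (\<exists>P\<in>X. \<alpha> \<in> P)} \<subseteq> ?K" using z by auto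
  ultimately have "power_ideal X d \<subseteq> ?K" unfolding power_ideal_def genideal_def by blast
  then have "\<theta> (x * 1) = 0" using x by blast
  then show ?thesis by simp
qed

context grid_algebra
begin

lemma not_inj: "\<not> mult_inj I al (tt - 1)"
  using kernel_element mult_inj_iff by blast

lemma not_surj:
  assumes "r > 0"
  shows "\<not> mult_surj I al (tt - 1) tt"
proof
  assume surj: "mult_surj I al (tt - 1) tt"
  obtain B where B: "quot_basis (homog tt) WW B" "card B = card (Idx q)" using quot_basis_coker .
  have "card B \<noteq> 0" using B(2) card_Idx assms by simp
  then obtain b where b: "b \<in> B" by fastforce
  then have "b \<in> homog tt" using B(1) by (auto simp: quot_basis_def)
  then have "b \<in> WW" using mult_surjD[OF surj] by (auto simp: WW_def)
  then show False using quot_basis_notin[OF B(1) b] by blast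
qed

text \<open>Degree \<open>tt\<close> is spanned modulo the ideal by representatives of the cokernel
  and by \<open>al\<close> times a basis of degree \<open>tt - 1\<close>. With the kernel element Y
  in that basis, one product is lost.\<close>

lemma delta_hilb_less: "delta_hilb I tt < int ((q + 1) * ((r + 1) choose 2))"
proof -
  obtain Y where Y: "Y \<in> homog (tt - 1)" "Y \<notin> I" "al * Y \<in> I" using kernel_element by blast
  obtain F0 :: "'k mpoly4 set" where F0: "finite F0" "homog (tt - 1) \<subseteq> mp.span F0" using homog_finite_span by blast
  obtain F1 :: "'k mpoly4 set" where F1: "finite F1" "homog tt \<subseteq> mp.span F1" using homog_finite_span by blast
  obtain B0 where B0: "quot_basis (homog (tt - 1)) I B0" "Y \<in> B0"
    using quot_basis_extend[OF subspace_homog subspace_ideal F0 Y(1,2)] by blast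
  obtain B1 where B1: "quot_basis (homog tt) I B1"
    using quot_basis_exists[OF subspace_homog subspace_ideal F1] by blast
  obtain Bc where Bc: "quot_basis (homog tt) WW Bc" "card Bc = card (Idx q)" using quot_basis_coker .
  have fin: "finite B0" "finite Bc" and sub: "B0 \<subseteq> homog (tt - 1)" "Bc \<subseteq> homog tt"
    using B0 Bc by (auto simp: quot_basis_def)
  \<comment> \<open>Y is left out because \<open>al * Y\<close> already lies in the ideal.\<close>
  define C where "C = Bc \<union> (\<lambda>b. al * b) ` (B0 - {Y})"
  have finC: "finite C" using fin by (simp add: C_def)
  have Suc: "Suc (tt - 1) = tt" using tt_pos by simp
  have al_homog: "al * g \<in> homog tt" if "g \<in> homog (tt - 1)" for g
    using homog_mult[OF homog_lin_form that, of "e01 - e10"] Suc by (simp add: al_def)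
  have "card B1 \<le> card C"
  proof (rule quot_basis_card_le[OF subspace_homog subspace_ideal B1 finC])
    show "C \<subseteq> homog tt" using sub al_homog by (auto simp: C_def)
    fix x :: "'k mpoly4" assume x: "x \<in> homog tt"
    then obtain c where "x - (\<Sum>b\<in>Bc. const_poly (c b) * b) \<in> WW" using Bc by (auto simp: quot_basis_def)
    then obtain g where g: "g \<in> homog (tt - 1)" "x - (\<Sum>b\<in>Bc. const_poly (c b) * b) - al * g \<in> I"
      by (auto simp: WW_def)
    obtain e where e: "g - (\<Sum>b\<in>B0. const_poly (e b) * b) \<in> I" using B0 g(1) by (auto simp: quot_basis_def)
    define s1 s2 where "s1 = (\<Sum>b\<in>Bc. const_poly (c b) * b)" and "s2 = (\<Sum>b\<in>B0 - {Y}. const_poly (e b) * (al * b))"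
    have "(\<Sum>b\<in>B0. const_poly (e b) * b) = const_poly (e Y) * Y + (\<Sum>b\<in>B0 - {Y}. const_poly (e b) * b)"
      using sum.remove[OF fin(1) B0(2)] by simp
    then have "al * (\<Sum>b\<in>B0. const_poly (e b) * b) = const_poly (e Y) * (al * Y) + s2"
      by (simp add: s2_def algebra_simps sum_distrib_left)
    then have "x - (s1 + s2) = (x - s1 - al * g) + al * (g - (\<Sum>b\<in>B0. const_poly (e b) * b)) + const_poly (e Y) * (al * Y)"
      by (simp only: right_diff_distrib) simp
    moreover have "\<dots> \<in> I"
      by (intro add_mem mult_mem e Y(3) g(2)[folded s1_def])
    ultimately have I: "x - (s1 + s2) \<in> I" by (simp only:)
    have "s1 \<in> mp.span C" unfolding s1_def
      by (intro mp.span_sum mp.span_scale mp.span_base) (simp add: C_def)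
    moreover have "s2 \<in> mp.span C" unfolding s2_def
      by (intro mp.span_sum mp.span_scale mp.span_base) (auto simp: C_def)
    ultimately have "s1 + s2 \<in> mp.span C" by (rule mp.span_add)
    then obtain w where "s1 + s2 = (\<Sum>b\<in>C. const_poly (w b) * b)" using mp.span_finite[OF finC] by auto
    then show "\<exists>c. x - (\<Sum>b\<in>C. const_poly (c b) * b) \<in> I" using I by auto
  qed
  also have "card C \<le> card Bc + card ((\<lambda>b. al * b) ` (B0 - {Y}))" unfolding C_def by (rule card_Un_le)
  also have "card ((\<lambda>b. al * b) ` (B0 - {Y})) \<le> card (B0 - {Y})" using fin by (intro card_image_le) simp
  also have "card (B0 - {Y}) = card B0 - 1" using B0 fin by simp
  finally have "card B1 \<le> card (Idx q) + (card B0 - 1)" using Bc by simp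
  moreover have "card B0 > 0" using B0 fin card_gt_0_iff by blast
  moreover have "hilb I tt = card B1" "hilb I (tt - 1) = card B0"
    unfolding hilb_def by (rule module_image.dim_eq[OF module_image_component B1],
        rule module_image.dim_eq[OF module_image_component B0(1)])
  ultimately have "delta_hilb I tt < int (card (Idx q))" using tt_pos by (simp add: delta_hilb_def)
  then show ?thesis unfolding card_Idx .
qed

end

lemma three_elements:
  assumes "card S \<ge> 3"
  shows "\<exists>x y z. x \<in> S \<and> y \<in> S \<and> z \<in> S \<and> x \<noteq> y \<and> x \<noteq> z \<and> y \<noteq> z"
proof -
  obtain S' where "S' \<subseteq> S" "card S' = 3" using obtain_subset_with_card_n[OF assms] by metis
  then show ?thesis unfolding card_3_iff by blast
qed

lemma for_generalI:
  "eval_poly \<alpha> g \<noteq> 0 \<Longrightarrow> (\<And>\<beta>. eval_poly \<beta> g \<noteq> 0 \<Longrightarrow> P (lin_form \<beta>)) \<Longrightarrow> for_general_lin_form P"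
  unfolding for_general_lin_form_def zariski_open_def
  by (intro exI[of _ "{\<beta>. eval_poly \<beta> g \<noteq> 0}"] conjI exI[of _ "{g}"]) auto

text \<open>Generality means finitely many nonvanishing conditions: the form, seen as a point, lies
  off the quadric and off the tangent planes at the grid points. The product of these conditions is
  the polynomial g.\<close>

theorem grid_normal_form:
  fixes F :: "'k::field_char_0 mpoly4"
  assumes a: "a \<ge> 3" and grid: "is_grid F a X" and d: "d \<ge> a - 1" "d = (a - 1) * q + r" and r: "r < a - 1"
  shows "\<exists>g. (\<exists>\<alpha>0. eval_poly \<alpha>0 g \<noteq> 0) \<and>
    (\<forall>\<alpha>. eval_poly \<alpha> g \<noteq> 0 \<longrightarrow> (\<exists>\<sigma> \<upsilon> e00 e01 e10 e11.
       grid_algebra \<sigma> \<upsilon> a r (power_ideal X d) e00 e01 e10 e11 q d \<and> \<alpha> = e01 - e10))"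
proof -
  obtain \<A> \<B> S T where R: "rulings F \<A> \<B>" and S: "S \<subseteq> \<A>" "finite S" "card S = a"
    and T: "T \<subseteq> \<B>" "finite T" "card T = a" and X: "X = {L \<inter> M |L M. L \<in> S \<and> M \<in> T}"
    using grid unfolding is_grid_def by blast
  have R: "\<A> \<union> \<B> = lines_on F"
    "\<And>L L'. L \<in> \<A> \<Longrightarrow> L' \<in> \<A> \<Longrightarrow> L \<noteq> L' \<Longrightarrow> L \<inter> L' = {0}"
    "\<And>M M'. M \<in> \<B> \<Longrightarrow> M' \<in> \<B> \<Longrightarrow> M \<noteq> M' \<Longrightarrow> M \<inter> M' = {0}"
    "\<And>L M. L \<in> \<A> \<Longrightarrow> M \<in> \<B> \<Longrightarrow> vec.dim (L \<inter> M) = 1"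
    using R unfolding rulings_def by simp_all
  have lines: "vec.subspace L \<and> vec.dim L = 2" if "L \<in> S \<or> L \<in> T" for L
  proof -
    have "L \<in> lines_on F" unfolding R(1)[symmetric] using S(1) T(1) that by blast
    then show ?thesis by (simp add: lines_on_def)
  qed
  interpret line_grid S T
  proof
    show "\<exists>L1 L2 L3. L1 \<in> S \<and> L2 \<in> S \<and> L3 \<in> S \<and> L1 \<noteq> L2 \<and> L1 \<noteq> L3 \<and> L2 \<noteq> L3"
      "\<exists>L1 L2 L3. L1 \<in> T \<and> L2 \<in> T \<and> L3 \<in> T \<and> L1 \<noteq> L2 \<and> L1 \<noteq> L3 \<and> L2 \<noteq> L3"
      using three_elements[of S] three_elements[of T] S T a by auto
    show "vec.dim (L \<inter> M) = 1" if "L \<in> S" "M \<in> T" for L M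
      using R(4) that S(1) T(1) by blast
    show "L \<inter> L' = {0}" if "L \<in> S" "L' \<in> S" "L \<noteq> L'" for L L'
      using R(2) that S(1) by blast
    show "L \<inter> L' = {0}" if "L \<in> T" "L' \<in> T" "L \<noteq> L'" for L L'
      using R(3) that T(1) by blast
  qed (use lines in blast)+
  obtain E00 E01 E10 E11 where fr: "frame E00 E01 E10 E11"
    and cS: "\<And>L. L \<in> S \<Longrightarrow> \<exists>x0 x1. (x0 \<noteq> 0 \<or> x1 \<noteq> 0) \<and> (\<forall>y0 y1. tens E00 E01 E10 E11 x0 x1 y0 y1 \<in> L)"
    and cT: "\<And>M. M \<in> T \<Longrightarrow> \<exists>y0 y1. (y0 \<noteq> 0 \<or> y1 \<noteq> 0) \<and> (\<forall>x0 x1. tens E00 E01 E10 E11 x0 x1 y0 y1 \<in> M)"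
    using tensor_coordinates by blast
  obtain fS where fS: "bij_betw fS {..<a} S" using ex_bij_betw_nat_finite[OF S(2)] S(3) by (auto simp: atLeast0LessThan)
  obtain fT where fT: "bij_betw fT {..<a} T" using ex_bij_betw_nat_finite[OF T(2)] T(3) by (auto simp: atLeast0LessThan)
  have fSm: "fS i \<in> S" and fTm: "fT i \<in> T" if "i < a" for i using fS fT that by (auto simp: bij_betw_def)
  have "\<forall>i. \<exists>x0 x1. i < a \<longrightarrow> (x0 \<noteq> 0 \<or> x1 \<noteq> 0) \<and> (\<forall>y0 y1. tens E00 E01 E10 E11 x0 x1 y0 y1 \<in> fS i)"
    using cS fSm by blast
  then obtain x0 x1 where x: "\<And>i. i < a \<Longrightarrow> x0 i \<noteq> 0 \<or> x1 i \<noteq> 0"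
    "\<And>i y0 y1. i < a \<Longrightarrow> tens E00 E01 E10 E11 (x0 i) (x1 i) y0 y1 \<in> fS i" by metis
  have "\<forall>i. \<exists>y0 y1. i < a \<longrightarrow> (y0 \<noteq> 0 \<or> y1 \<noteq> 0) \<and> (\<forall>x0 x1. tens E00 E01 E10 E11 x0 x1 y0 y1 \<in> fT i)"
    using cT fTm by blast
  then obtain y0 y1 where y: "\<And>i. i < a \<Longrightarrow> y0 i \<noteq> 0 \<or> y1 i \<noteq> 0"
    "\<And>i x0 x1. i < a \<Longrightarrow> tens E00 E01 E10 E11 x0 x1 (y0 i) (y1 i) \<in> fT i" by metis
  have proportional: "\<exists>k. u0' = k * u0 \<and> u1' = k * u1"
    if "u0 * u1' = u1 * u0'" "u0 \<noteq> 0 \<or> u1 \<noteq> 0" for u0 u1 u0' u1' :: 'k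
  proof (cases "u0 = 0")
    case True
    then show ?thesis using that by (intro exI[of _ "u1' / u1"]) auto
  next
    case False
    then show ?thesis using that by (intro exI[of _ "u0' / u0"]) (auto simp: field_simps)
  qed
  \<comment> \<open>Lines with proportional parameters would share a nonzero tensor, against
    skewness.\<close>
  have xd: "x0 i * x1 j \<noteq> x1 i * x0 j" if ij: "i < a" "j < a" "i \<noteq> j" for i j
  proof
    assume "x0 i * x1 j = x1 i * x0 j"
    then obtain k where k: "x0 j = k * x0 i" "x1 j = k * x1 i" using proportional x(1)[OF ij(1)] by blast
    let ?t = "tens E00 E01 E10 E11 (x0 j) (x1 j) 1 0"
    have "?t = tens E00 E01 E10 E11 (x0 i) (x1 i) k 0" by (simp add: tens_def k mult.commute)
    then have "?t \<in> fS i" using x(2)[OF ij(1), of k 0] by simp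
    moreover have "?t \<in> fS j" using x(2)[OF ij(2)] .
    moreover have "fS i \<noteq> fS j" using fS ij by (auto simp: bij_betw_def inj_on_def)
    ultimately have "?t = 0" using skew_S[OF fSm[OF ij(1)] fSm[OF ij(2)]] by blast
    then show False using tens_nonzero[OF fr x(1)[OF ij(2)], of 1 0] by simp
  qed
  have yd: "y0 i * y1 j \<noteq> y1 i * y0 j" if ij: "i < a" "j < a" "i \<noteq> j" for i j
  proof
    assume "y0 i * y1 j = y1 i * y0 j"
    then obtain k where k: "y0 j = k * y0 i" "y1 j = k * y1 i" using proportional y(1)[OF ij(1)] by blast
    let ?t = "tens E00 E01 E10 E11 1 0 (y0 j) (y1 j)"
    have "?t = tens E00 E01 E10 E11 k 0 (y0 i) (y1 i)" by (simp add: tens_def k)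
    then have "?t \<in> fT i" using y(2)[OF ij(1), of k 0] by simp
    moreover have "?t \<in> fT j" using y(2)[OF ij(2)] .
    moreover have "fT i \<noteq> fT j" using fT ij by (auto simp: bij_betw_def inj_on_def)
    ultimately have "?t = 0" using skew_T[OF fTm[OF ij(1)] fTm[OF ij(2)]] by blast
    then show False using tens_nonzero[OF fr _ y(1)[OF ij(2)], of 1 0] by simp
  qed
  obtain u00 where u00: "dotp u00 E00 = 1" "dotp u00 E01 = 0" "dotp u00 E10 = 0" "dotp u00 E11 = 0"
    using frame_inverse(2)[OF fr, of 1 0 0 0] by blast
  obtain u01 where u01: "dotp u01 E00 = 0" "dotp u01 E01 = 1" "dotp u01 E10 = 0" "dotp u01 E11 = 0"
    using frame_inverse(2)[OF fr, of 0 1 0 0] by blast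
  obtain u10 where u10: "dotp u10 E00 = 0" "dotp u10 E01 = 0" "dotp u10 E10 = 1" "dotp u10 E11 = 0"
    using frame_inverse(2)[OF fr, of 0 0 1 0] by blast
  obtain u11 where u11: "dotp u11 E00 = 0" "dotp u11 E01 = 0" "dotp u11 E10 = 0" "dotp u11 E11 = 1"
    using frame_inverse(2)[OF fr, of 0 0 0 1] by blast
  have dot_add: "dotp u (v + w) = dotp u v + dotp u w" and dot_scale: "dotp u (c *s v) = c * dotp u v"
    for u v w :: "'k ^ 4" and c
    by (simp_all add: dotp_def algebra_simps sum.distrib sum_distrib_left)
  have coords: "\<alpha> = dotp u00 \<alpha> *s E00 + dotp u01 \<alpha> *s E01 + dotp u10 \<alpha> *s E10 + dotp u11 \<alpha> *s E11" for \<alpha>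
  proof -
    obtain A B C D where \<alpha>: "\<alpha> = A *s E00 + B *s E01 + C *s E10 + D *s E11" using frame_inverse(1)[OF fr] by blast
    have "dotp u00 \<alpha> = A" "dotp u01 \<alpha> = B" "dotp u10 \<alpha> = C" "dotp u11 \<alpha> = D"
      unfolding \<alpha> dot_add dot_scale u00 u01 u10 u11 by simp_all
    then show ?thesis using \<alpha> by simp
  qed
  define l00 l01 l10 l11 where "l00 = lin_form u00" and "l01 = lin_form u01" and "l10 = lin_form u10" and "l11 = lin_form u11"
  \<comment> \<open>\<open>None\<close> is the equation of the quadric; \<open>Some (i, j)\<close>
    is the equation of its tangent plane at a grid point, the plane spanned by the two grid
    lines.\<close>
  define gg where "gg = (\<lambda>ij. case ij of None \<Rightarrow> l00 * l11 - l10 * l01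
    | Some (i, j) \<Rightarrow> const_poly (y0 j) * (const_poly (x1 i) * l01 - const_poly (x0 i) * l11)
       - const_poly (y1 j) * (const_poly (x1 i) * l00 - const_poly (x0 i) * l10))"
  define Ix where "Ix = insert None (Some ` ({..<a} \<times> {..<a}))"
  have dot_sym: "dotp u v = dotp v u" for u v :: "'k ^ 4" by (simp add: dotp_def mult.commute)
  have ev: "eval_poly \<alpha> l00 = dotp u00 \<alpha>" "eval_poly \<alpha> l01 = dotp u01 \<alpha>"
     "eval_poly \<alpha> l10 = dotp u10 \<alpha>" "eval_poly \<alpha> l11 = dotp u11 \<alpha>" for \<alpha>
    by (simp_all add: l00_def l01_def l10_def l11_def eval_lin_form)
  have "\<exists>\<alpha>. eval_poly \<alpha> (gg ij) \<noteq> 0" if ijx: "ij \<in> Ix" for ij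
  proof (cases ij)
    case None
    have "eval_poly (E00 + E11) (gg None) = 1"
      by (simp add: gg_def ev dot_add u00 u01 u10 u11)
    then show ?thesis using None by (metis one_neq_zero)
  next
    case (Some p)
    then obtain i j where p: "p = (i, j)" "i < a" "j < a" using ijx by (auto simp: Ix_def)
    \<comment> \<open>On the four basis tensors the tangent plane takes, up to sign, the products of
      a coordinate of x with one of y; one of them is nonzero.\<close>
    have "eval_poly E01 (gg (Some (i, j))) = y0 j * x1 i" "eval_poly E11 (gg (Some (i, j))) = - y0 j * x0 i"
      "eval_poly E00 (gg (Some (i, j))) = - y1 j * x1 i" "eval_poly E10 (gg (Some (i, j))) = y1 j * x0 i"
      by (simp_all add: gg_def ev u00 u01 u10 u11)
    then show ?thesis using x(1)[OF p(2)] y(1)[OF p(3)] unfolding Some p(1)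
      by (metis mult_eq_0_iff neg_equal_0_iff_equal)
  qed
  moreover have "finite Ix" by (simp add: Ix_def)
  ultimately obtain \<alpha>0 where \<alpha>0: "\<forall>ij\<in>Ix. eval_poly \<alpha>0 (gg ij) \<noteq> 0"
    using eval_poly_prod_nonzero[of Ix gg] by blast
  have eval_prod: "eval_poly \<alpha> (prod gg A) = (\<Prod>ij\<in>A. eval_poly \<alpha> (gg ij))" for \<alpha> A
    by (induction A rule: infinite_finite_induct) simp_all
  have "eval_poly \<alpha>0 (prod gg Ix) \<noteq> 0" using \<alpha>0 \<open>finite Ix\<close> by (simp add: eval_prod)
  then have "\<exists>\<alpha>0. eval_poly \<alpha>0 (prod gg Ix) \<noteq> 0" by (rule exI)
  moreover have "\<exists>\<sigma> \<upsilon> e00 e01 e10 e11.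
       grid_algebra \<sigma> \<upsilon> a r (power_ideal X d) e00 e01 e10 e11 q d \<and> \<alpha> = e01 - e10"
    if "eval_poly \<alpha> (prod gg Ix) \<noteq> 0" for \<alpha>
  proof -
    have nz: "eval_poly \<alpha> (gg ij) \<noteq> 0" if "ij \<in> Ix" for ij
      using \<open>eval_poly \<alpha> (prod gg Ix) \<noteq> 0\<close> that \<open>finite Ix\<close> by (auto simp: eval_prod)
    have det: "dotp u00 \<alpha> * dotp u11 \<alpha> - dotp u10 \<alpha> * dotp u01 \<alpha> \<noteq> 0"
      using nz[of None] by (simp add: gg_def ev Ix_def)
    have gen: "y0 j * (x1 i * dotp u01 \<alpha> - x0 i * dotp u11 \<alpha>) - y1 j * (x1 i * dotp u00 \<alpha> - x0 i * dotp u10 \<alpha>) \<noteq> 0"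
      if "i < a" "j < a" for i j
      using nz[of "Some (i, j)"] that by (simp add: gg_def ev Ix_def)
    have "\<exists>e00 e01 e10 e11 \<sigma> \<upsilon>. frame e00 e01 e10 e11 \<and> e01 - e10 = \<alpha> \<and>
      inj_on \<sigma> {..<a} \<and> inj_on \<upsilon> {..<a} \<and> (\<forall>i<a. \<forall>j<a. \<sigma> i \<noteq> \<upsilon> j) \<and>
      (\<forall>i<a. \<forall>j<a. \<exists>c. c \<noteq> 0 \<and>
        gpt e00 e01 e10 e11 (\<sigma> i) (\<upsilon> j) = c *s tens E00 E01 E10 E11 (x0 i) (x1 i) (y0 j) (y1 j))"
      by (rule normal_form[OF fr _ _ _ _ coords det]) (rule x(1) y(1) xd yd gen; assumption)+
    then obtain e00 e01 e10 e11 \<sigma> \<upsilon> where nf: "frame e00 e01 e10 e11" "e01 - e10 = \<alpha>"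
      "inj_on \<sigma> {..<a}" "inj_on \<upsilon> {..<a}" "\<forall>i<a. \<forall>j<a. \<sigma> i \<noteq> \<upsilon> j"
      "\<forall>i<a. \<forall>j<a. \<exists>c. c \<noteq> 0 \<and>
        gpt e00 e01 e10 e11 (\<sigma> i) (\<upsilon> j) = c *s tens E00 E01 E10 E11 (x0 i) (x1 i) (y0 j) (y1 j)"
      by blast
    have P: "fS i \<inter> fT j = vec.span {tens E00 E01 E10 E11 (x0 i) (x1 i) (y0 j) (y1 j)}" if ij: "i < a" "j < a" for i j
      by (rule meet_eq_span[OF fr fSm[OF ij(1)] fTm[OF ij(2)] x(1)[OF ij(1)] y(1)[OF ij(2)] x(2)[OF ij(1)] y(2)[OF ij(2)]])
    have "grid_algebra \<sigma> \<upsilon> a r (power_ideal X d) e00 e01 e10 e11 q d"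
    proof (intro grid_algebra.intro grid_nodes.intro grid_algebra_axioms.intro mpoly4_ideal_power_ideal)
      show "r < a" using r by simp
      \<comment> \<open>For q = 0 the equation for d would give d = r < a - 1.\<close>
      show "1 \<le> q" using d r by (cases q) auto
      show "\<exists>u. dotp u e00 = A \<and> dotp u e01 = B \<and> dotp u e10 = C \<and> dotp u e11 = D" for A B C D
        by (rule frame_inverse(2)[OF nf(1)])
      show "\<exists>A B C D. x = A *s e00 + B *s e01 + C *s e10 + D *s e11" for x
        by (rule frame_inverse(1)[OF nf(1)])
    next
      fix i j assume ij: "i < a" "j < a"
      let ?t = "tens E00 E01 E10 E11 (x0 i) (x1 i) (y0 j) (y1 j)"
      obtain c where c: "c \<noteq> 0" "gpt e00 e01 e10 e11 (\<sigma> i) (\<upsilon> j) = c *s ?t" using nf(6) ij by blast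
      have "?t \<noteq> 0" by (rule tens_nonzero[OF fr x(1)[OF ij(1)] y(1)[OF ij(2)]])
      then have "c *s ?t \<noteq> 0" using c by simp
      moreover have "c *s ?t \<in> fS i \<inter> fT j" unfolding P[OF ij] by (intro vec.span_scale vec.span_base) simp
      moreover have "fS i \<inter> fT j \<in> X" unfolding X using fSm fTm ij by blast
      ultimately show "lin_form (gpt e00 e01 e10 e11 (\<sigma> i) (\<upsilon> j)) ^ d \<in> power_ideal X d"
        unfolding c(2) by (intro power_ideal_gen)
    next
      fix \<theta> :: "'k mpoly4 \<Rightarrow> 'k" and x
      assume \<theta>: "lfun \<theta>" and z: "\<And>i j g. i < a \<Longrightarrow> j < a \<Longrightarrow> \<theta> (lin_form (gpt e00 e01 e10 e11 (\<sigma> i) (\<upsilon> j)) ^ d * g) = 0"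
        and xI: "x \<in> power_ideal X d"
      show "\<theta> x = 0"
      proof (rule power_ideal_kill[OF \<theta> _ xI])
        fix \<beta> P' g assume b: "\<beta> \<noteq> 0" "P' \<in> X" "\<beta> \<in> P'"
        then obtain L M where LM: "P' = L \<inter> M" "L \<in> S" "M \<in> T" unfolding X by blast
        obtain i j where ij: "i < a" "j < a" "L = fS i" "M = fT j"
          using LM fS fT unfolding bij_betw_def by (metis imageE lessThan_iff)
        let ?t = "tens E00 E01 E10 E11 (x0 i) (x1 i) (y0 j) (y1 j)"
        obtain c where c: "c \<noteq> 0" "gpt e00 e01 e10 e11 (\<sigma> i) (\<upsilon> j) = c *s ?t" using nf(6) ij by blast
        have "\<beta> \<in> vec.span {?t}" using b LM ij P by auto
        then obtain k where "\<beta> = k *s ?t" using vec.span_singleton[of ?t] by auto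
        then have "\<beta> = (k / c) *s gpt e00 e01 e10 e11 (\<sigma> i) (\<upsilon> j)"
          unfolding c(2) using c(1) by (simp add: vector_smult_assoc)
        then have "lin_form \<beta> ^ d * g = const_poly ((k / c) ^ d) * (lin_form (gpt e00 e01 e10 e11 (\<sigma> i) (\<upsilon> j)) ^ d * g)"
          by (simp only: lin_form_scale power_mult_distrib const_poly_power mult.assoc)
        then show "\<theta> (lin_form \<beta> ^ d * g) = 0"
          by (simp only: lfun_scale[OF \<theta>] z[OF ij(1,2)] mult_zero_right)
      qed
    qed (use nf d r in auto)
    then show ?thesis using nf(2) by blast
  qed
  ultimately show ?thesis by (intro exI[of _ "prod gg Ix"] conjI allI impI)
qed

theorem theorem6p1:
  fixes F :: "'k::field_char_0 mpoly4"
    and X :: "('k ^ 4) set set"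
    and I :: "'k mpoly4 set"
    and a d q r :: nat
  assumes "a \<ge> 3"
    and "smooth_quadric F"
    and "is_grid F a X"
    and "d \<ge> a - 1"
    and "d = (a - 1) * q + r"
    and "r < a - 1"
    and "I = power_ideal X d"
  shows "delta_hilb I (d + q - 1) < int ((q + 1) * ((r + 1) choose 2)) \<and>
    for_general_lin_form (\<lambda>l.
      vectorspace.dim class_ring (mult_coker I l (d + q - 2) (d + q - 1))
        = (q + 1) * ((r + 1) choose 2)) \<and>
    (q + 1) * ((r + 1) choose 2) \<ge> 0 \<and>
    (r > 0 \<longrightarrow>
      for_general_lin_form (\<lambda>l. \<not> mult_inj I l (d + q - 2)) \<and>
      \<not> weak_lefschetz I)"
proof -
  obtain g \<alpha>0 where g: "eval_poly \<alpha>0 g \<noteq> 0"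
    "\<And>\<alpha>. eval_poly \<alpha> g \<noteq> 0 \<Longrightarrow> \<exists>\<sigma> \<upsilon> e00 e01 e10 e11.
       grid_algebra \<sigma> \<upsilon> a r I e00 e01 e10 e11 q d \<and> \<alpha> = e01 - e10"
    using grid_normal_form[OF assms(1,3-6), folded assms(7)] by (elim exE conjE) simp
  have t: "d + q - 2 = d + q - 1 - 1" by simp
  have A: "delta_hilb I (d + q - 1) < int ((q + 1) * ((r + 1) choose 2))"
    "vectorspace.dim class_ring (mult_coker I (lin_form \<alpha>) (d + q - 2) (d + q - 1)) = (q + 1) * ((r + 1) choose 2)"
    "\<not> mult_inj I (lin_form \<alpha>) (d + q - 2)"
    "r > 0 \<Longrightarrow> \<not> mult_surj I (lin_form \<alpha>) (d + q - 2) (d + q - 1)"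
    "d + q - 1 \<ge> 1" if \<alpha>: "eval_poly \<alpha> g \<noteq> 0" for \<alpha>
  proof -
    obtain \<sigma> \<upsilon> e00 e01 e10 e11 where "grid_algebra \<sigma> \<upsilon> a r I e00 e01 e10 e11 q d" and al: "\<alpha> = e01 - e10"
      using g(2)[OF \<alpha>] by blast
    then interpret grid_algebra \<sigma> \<upsilon> a r I e00 e01 e10 e11 q d by blast
    have al': "al = lin_form \<alpha>" by (simp add: al_def al)
    show "delta_hilb I (d + q - 1) < int ((q + 1) * ((r + 1) choose 2))"
      using delta_hilb_less unfolding tt_def .
    show "vectorspace.dim class_ring (mult_coker I (lin_form \<alpha>) (d + q - 2) (d + q - 1)) = (q + 1) * ((r + 1) choose 2)"
      using dim_coker unfolding tt_def al' t .
    show "\<not> mult_inj I (lin_form \<alpha>) (d + q - 2)"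
      using not_inj unfolding tt_def al' t .
    show "r > 0 \<Longrightarrow> \<not> mult_surj I (lin_form \<alpha>) (d + q - 2) (d + q - 1)"
      using not_surj unfolding tt_def al' t .
    show "d + q - 1 \<ge> 1" using tt_pos unfolding tt_def .
  qed
  have "\<not> weak_lefschetz I" if r: "r > 0"
  proof
    assume "weak_lefschetz I"
    then obtain U where U: "zariski_open U" "U \<noteq> {}"
      "\<And>\<alpha> t. \<alpha> \<in> U \<Longrightarrow> t \<ge> 1 \<Longrightarrow> mult_inj I (lin_form \<alpha>) (t - 1) \<or> mult_surj I (lin_form \<alpha>) (t - 1) t"
      unfolding weak_lefschetz_def for_general_lin_form_def by blast
    obtain G where G: "U = {\<alpha>. \<exists>g\<in>G. eval_poly \<alpha> g \<noteq> 0}" using U(1) unfolding zariski_open_def by blast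
    then obtain \<beta> g' where "g' \<in> G" "eval_poly \<beta> g' \<noteq> 0" using U(2) by blast
    \<comment> \<open>Two nonempty open sets meet, so the Lefschetz locus contains a form for which
      both injectivity and surjectivity fail in degree d + q - 1.\<close>
    then obtain \<alpha> where \<alpha>: "eval_poly \<alpha> g \<noteq> 0" "\<alpha> \<in> U"
      using eval_poly_common_nonzero[OF g(1)] unfolding G by blast
    show False using U(3)[OF \<alpha>(2) A(5)[OF \<alpha>(1)]] A(3,4)[OF \<alpha>(1)] r unfolding t by blast
  qed
  then show ?thesis
    using A(1)[OF g(1)] for_generalI[OF g(1), of "\<lambda>l. vectorspace.dim class_ring
        (mult_coker I l (d + q - 2) (d + q - 1)) = (q + 1) * ((r + 1) choose 2)"] A(2)
      for_generalI[OF g(1), of "\<lambda>l. \<not> mult_inj I l (d + q - 2)"] A(3)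
    by simp
qed

end
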